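(* Let $\hat V$ be an $\omega$-nonstandard model of $ZFC^-$. Then $\mathfrak{p}_{\hat V}=\mathfrak{t}_{\hat V}$.
   Context: $ZFC^-$ denotes $ZFC$ without the powerset axiom, with replacement strengthened to collection and choice strengthened to the well-ordering principle. For a model $\hat V \models ZFC^-$, write $\hat\omega$ for $\omega^{\hat V}$ and $\hat<$ for its order. $\hat V$ is $\omega$-nonstandard if $\hat\omega \neq \omega$. For infinite regular cardinals $\kappa,\theta$, a $(\kappa,\theta)$-cut in a linear order $(L,<)$ is a pair of sequences $(a_\alpha:\alpha<\kappa)$ increasing and $(b_\beta:\beta<\theta)$ decreasing with $a_\alpha<b_\beta$ for all $\alpha,\beta$, such that no $c\in L$ satisfies $a_\alpha<c<b_\beta$ for all $\alpha,\beta$. $\mathfrak{p}_{\hat V}$ is the least value of $\kappa+\theta$ over all pairs $(\kappa,\theta)$ such that $(\hat\omega,\hat<)$ admits a $(\kappa,\theta)$-cut. A tree is a partial order with meets and a minimum element in which the predecessors of each element are linearly ordered; $\mathrm{tree\text{-}tops}(T)$ is the least cardinal $\kappa$ such that there is a strictly increasing sequence $(s_\alpha:\alpha<\kappa)$ in $T$ with no upper bound in $T$. $\mathfrak{t}_{\hat V}$ is the minimum over all $\hat n\in\hat\omega$ of $\mathrm{tree\text{-}tops}$ of the (external) tree $(\hat n^{<\hat n},\subsetneq)$ of sequences (in $\hat V$) from $\hat n$ of $\hat V$-length less than $\hat n$, ordered by proper initial segment. *)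

theory Defs
  imports Main
begin

text \<open>A model of set theory is a structure (the whole type 'a, E) where E is the
membership relation. Formulas use named variables (natural numbers).\<close>

datatype form =
    Mem nat nat
  | Eq nat nat
  | Neg form
  | Conj form form
  | Ex nat form

primrec sat :: "('a \<Rightarrow> 'a \<Rightarrow> bool) \<Rightarrow> (nat \<Rightarrow> 'a) \<Rightarrow> form \<Rightarrow> bool" where
  "sat E \<rho> (Mem i j) = E (\<rho> i) (\<rho> j)"
| "sat E \<rho> (Eq i j) = (\<rho> i = \<rho> j)"
| "sat E \<rho> (Neg \<phi>) = (\<not> sat E \<rho> \<phi>)"
| "sat E \<rho> (Conj \<phi> \<psi>) = (sat E \<rho> \<phi> \<and> sat E \<rho> \<psi>)"
| "sat E \<rho> (Ex i \<phi>) = (\<exists>x. sat E (\<rho>(i := x)) \<phi>)"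

definition is_upair :: "('a \<Rightarrow> 'a \<Rightarrow> bool) \<Rightarrow> 'a \<Rightarrow> 'a \<Rightarrow> 'a \<Rightarrow> bool" where
  "is_upair E u a b \<longleftrightarrow> (\<forall>z. E z u \<longleftrightarrow> (z = a \<or> z = b))"

text \<open>Kuratowski ordered pair p = (a,b) = {{a},{a,b}}.\<close>
definition is_pair :: "('a \<Rightarrow> 'a \<Rightarrow> bool) \<Rightarrow> 'a \<Rightarrow> 'a \<Rightarrow> 'a \<Rightarrow> bool" where
  "is_pair E p a b \<longleftrightarrow> (\<forall>z. E z p \<longleftrightarrow> (is_upair E z a a \<or> is_upair E z a b))"

definition is_empty :: "('a \<Rightarrow> 'a \<Rightarrow> bool) \<Rightarrow> 'a \<Rightarrow> bool" where
  "is_empty E e \<longleftrightarrow> (\<forall>z. \<not> E z e)"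

definition is_succ :: "('a \<Rightarrow> 'a \<Rightarrow> bool) \<Rightarrow> 'a \<Rightarrow> 'a \<Rightarrow> bool" where
  "is_succ E x y \<longleftrightarrow> (\<forall>z. E z y \<longleftrightarrow> (E z x \<or> z = x))"

definition is_inductive :: "('a \<Rightarrow> 'a \<Rightarrow> bool) \<Rightarrow> 'a \<Rightarrow> bool" where
  "is_inductive E w \<longleftrightarrow>
     (\<exists>e. is_empty E e \<and> E e w) \<and> (\<forall>x. E x w \<longrightarrow> (\<exists>y. is_succ E x y \<and> E y w))"

definition is_omega :: "('a \<Rightarrow> 'a \<Rightarrow> bool) \<Rightarrow> 'a \<Rightarrow> bool" where
  "is_omega E w \<longleftrightarrow> is_inductive E w \<and> (\<forall>v. is_inductive E v \<longrightarrow> (\<forall>x. E x w \<longrightarrow> E x v))"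

definition ZFC_minus :: "('a \<Rightarrow> 'a \<Rightarrow> bool) \<Rightarrow> bool" where
  "ZFC_minus E \<longleftrightarrow>
     \<comment> \<open>extensionality\<close>
     (\<forall>x y. (\<forall>z. E z x \<longleftrightarrow> E z y) \<longrightarrow> x = y) \<and>
     \<comment> \<open>foundation\<close>
     (\<forall>x. (\<exists>y. E y x) \<longrightarrow> (\<exists>y. E y x \<and> \<not> (\<exists>z. E z y \<and> E z x))) \<and>
     \<comment> \<open>pairing\<close>
     (\<forall>a b. \<exists>c. E a c \<and> E b c) \<and>
     \<comment> \<open>union\<close>
     (\<forall>a. \<exists>u. \<forall>y z. E z y \<and> E y a \<longrightarrow> E z u) \<and>
     \<comment> \<open>infinity\<close>
     (\<exists>w. is_inductive E w) \<and>
     \<comment> \<open>separation schema (with parameters given by the assignment)\<close>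
     (\<forall>\<phi> \<rho> v a. \<exists>b. \<forall>z. E z b \<longleftrightarrow> (E z a \<and> sat E (\<rho>(v := z)) \<phi>)) \<and>
     \<comment> \<open>collection schema\<close>
     (\<forall>\<phi> \<rho> u v a. u \<noteq> v \<longrightarrow>
        (\<forall>x. E x a \<longrightarrow> (\<exists>y. sat E (\<rho>(u := x, v := y)) \<phi>)) \<longrightarrow>
        (\<exists>b. \<forall>x. E x a \<longrightarrow> (\<exists>y. E y b \<and> sat E (\<rho>(u := x, v := y)) \<phi>))) \<and>
     \<comment> \<open>well-ordering principle: every set carries a well-order (a set of ordered pairs)\<close>
     (\<forall>a. \<exists>r.
        (\<forall>p. E p r \<longrightarrow> (\<exists>x y. is_pair E p x y \<and> E x a \<and> E y a)) \<and>
        (\<forall>x. E x a \<longrightarrow> \<not> (\<exists>p. E p r \<and> is_pair E p x x)) \<and>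
        (\<forall>x y z. E x a \<and> E y a \<and> E z a \<and>
            (\<exists>p. E p r \<and> is_pair E p x y) \<and> (\<exists>q. E q r \<and> is_pair E q y z)
            \<longrightarrow> (\<exists>s. E s r \<and> is_pair E s x z)) \<and>
        (\<forall>x y. E x a \<and> E y a \<longrightarrow>
            x = y \<or> (\<exists>p. E p r \<and> is_pair E p x y) \<or> (\<exists>p. E p r \<and> is_pair E p y x)) \<and>
        (\<forall>s. (\<forall>x. E x s \<longrightarrow> E x a) \<and> (\<exists>x. E x s) \<longrightarrow>
            (\<exists>m. E m s \<and> \<not> (\<exists>x p. E x s \<and> E p r \<and> is_pair E p x m))))"

definition omega_nonstandard :: "('a \<Rightarrow> 'a \<Rightarrow> bool) \<Rightarrow> bool" where
  "omega_nonstandard E \<longleftrightarrow>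
     (\<forall>w. is_omega E w \<longrightarrow>
        \<not> (\<exists>f :: nat \<Rightarrow> 'a. bij_betw f UNIV {x. E x w} \<and>
              (\<forall>m n. m < n \<longleftrightarrow> E (f m) (f n))))"

definition is_cut ::
  "('a \<Rightarrow> 'a \<Rightarrow> bool) \<Rightarrow> 'a \<Rightarrow> 'a rel \<Rightarrow> 'a rel \<Rightarrow> ('a \<Rightarrow> 'a) \<Rightarrow> ('a \<Rightarrow> 'a) \<Rightarrow> bool" where
  "is_cut E w \<kappa> \<theta> a b \<longleftrightarrow>
     Card_order \<kappa> \<and> infinite (Field \<kappa>) \<and> regularCard \<kappa> \<and>
     Card_order \<theta> \<and> infinite (Field \<theta>) \<and> regularCard \<theta> \<and>
     (\<forall>\<alpha>\<in>Field \<kappa>. E (a \<alpha>) w) \<and> (\<forall>\<beta>\<in>Field \<theta>. E (b \<beta>) w) \<and>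
     (\<forall>\<alpha>\<in>Field \<kappa>. \<forall>\<alpha>'\<in>Field \<kappa>. (\<alpha>, \<alpha>') \<in> \<kappa> \<and> \<alpha> \<noteq> \<alpha>' \<longrightarrow> E (a \<alpha>) (a \<alpha>')) \<and>
     (\<forall>\<beta>\<in>Field \<theta>. \<forall>\<beta>'\<in>Field \<theta>. (\<beta>, \<beta>') \<in> \<theta> \<and> \<beta> \<noteq> \<beta>' \<longrightarrow> E (b \<beta>') (b \<beta>)) \<and>
     (\<forall>\<alpha>\<in>Field \<kappa>. \<forall>\<beta>\<in>Field \<theta>. E (a \<alpha>) (b \<beta>)) \<and>
     \<not> (\<exists>c. E c w \<and> (\<forall>\<alpha>\<in>Field \<kappa>. \<forall>\<beta>\<in>Field \<theta>. E (a \<alpha>) c \<and> E c (b \<beta>)))"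

text \<open>p_le E lambda: the cardinal p of the model is at most lambda, i.e. some cut
has kappa + theta at most lambda (p is the least such kappa + theta).\<close>
definition p_le :: "('a \<Rightarrow> 'a \<Rightarrow> bool) \<Rightarrow> 'a rel \<Rightarrow> bool" where
  "p_le E \<mu> \<longleftrightarrow> (\<exists>w \<kappa> \<theta> a b. is_omega E w \<and> is_cut E w \<kappa> \<theta> a b \<and> (BNF_Cardinal_Arithmetic.csum \<kappa> \<theta>, \<mu>) \<in> ordLeq)"

definition is_seq :: "('a \<Rightarrow> 'a \<Rightarrow> bool) \<Rightarrow> 'a \<Rightarrow> 'a \<Rightarrow> 'a \<Rightarrow> bool" where
  "is_seq E s m n \<longleftrightarrow>
     (\<forall>z. E z s \<longrightarrow> (\<exists>x y. is_pair E z x y \<and> E x m \<and> E y n)) \<and>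
     (\<forall>x. E x m \<longrightarrow>
        (\<exists>y z. E z s \<and> is_pair E z x y) \<and>
        (\<forall>y y' z z'. E z s \<and> is_pair E z x y \<and> E z' s \<and> is_pair E z' x y' \<longrightarrow> y = y'))"

definition tree_node :: "('a \<Rightarrow> 'a \<Rightarrow> bool) \<Rightarrow> 'a \<Rightarrow> 'a \<Rightarrow> bool" where
  "tree_node E n s \<longleftrightarrow> (\<exists>m. E m n \<and> is_seq E s m n)"

text \<open>Initial segment (reflexive) order: for such sequences, s is an initial
segment of t iff s is a subset of t.\<close>
definition tree_le :: "('a \<Rightarrow> 'a \<Rightarrow> bool) \<Rightarrow> 'a \<Rightarrow> 'a \<Rightarrow> bool" where
  "tree_le E s t \<longleftrightarrow> (\<forall>z. E z s \<longrightarrow> E z t)"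

definition tree_less :: "('a \<Rightarrow> 'a \<Rightarrow> bool) \<Rightarrow> 'a \<Rightarrow> 'a \<Rightarrow> bool" where
  "tree_less E s t \<longleftrightarrow> tree_le E s t \<and> s \<noteq> t"

definition unbounded_branch_seq ::
  "('a \<Rightarrow> 'a \<Rightarrow> bool) \<Rightarrow> 'a \<Rightarrow> 'a rel \<Rightarrow> ('a \<Rightarrow> 'a) \<Rightarrow> bool" where
  "unbounded_branch_seq E n \<kappa> s \<longleftrightarrow>
     Card_order \<kappa> \<and>
     (\<forall>\<alpha>\<in>Field \<kappa>. tree_node E n (s \<alpha>)) \<and>
     (\<forall>\<alpha>\<in>Field \<kappa>. \<forall>\<alpha>'\<in>Field \<kappa>. (\<alpha>, \<alpha>') \<in> \<kappa> \<and> \<alpha> \<noteq> \<alpha>' \<longrightarrow> tree_less E (s \<alpha>) (s \<alpha>')) \<and>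
     \<not> (\<exists>u. tree_node E n u \<and> (\<forall>\<alpha>\<in>Field \<kappa>. tree_le E (s \<alpha>) u))"

text \<open>t_le E lambda: t of the model is at most lambda, i.e. for some n in omega-hat
for which n^(<n) is a tree (nonempty, i.e. n nonzero) its tree-tops number is
at most lambda.\<close>
definition t_le :: "('a \<Rightarrow> 'a \<Rightarrow> bool) \<Rightarrow> 'a rel \<Rightarrow> bool" where
  "t_le E \<mu> \<longleftrightarrow> (\<exists>w n \<kappa> s. is_omega E w \<and> E n w \<and> (\<exists>x. E x n) \<and>
      unbounded_branch_seq E n \<kappa> s \<and> (\<kappa>, \<mu>) \<in> ordLeq)"

end

(*
Lower bounds for t give cuts as follows: in the lexicographic order of n^(<n), coded by numbers, an
unbounded chain (s_a) yields the cut of the codes of s_a and of s_a followed by the entry n.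

Conversely assume that all chains of length at most mu are bounded, and take a cut of minimal size.
It is not symmetric: one builds a chain of internal sequences y with y(i) > i and y(a_al) = b_al,
and a bound of the chain produces an element of the cut.  So let the lower side be (a_al : al < theta)
and, after reversing the order if necessary, the upper side (b_e : e < kappa) with kappa < theta.
Minimality says that smaller pre-cuts are filled.  Fix a colouring g of pairs from a set K of more than
kappa ordinals by elements of kappa such that g is unbounded on the pairs of every subset of K of size
more than kappa.  By recursion on al build a chain of internal sequences of length a_al + 1 that at
time a_al introduce a new point whose distance to the point of time a_be is b_(g(be,al)), points alive
at time i having distances at least i, and keep all the earlier points a_be alive; filled pre-cuts
allow one to cut off a bound of the chain so far before any of them dies.  In a bound of the whole
chain every point a_be survives beyond some b_e, as the times a_al and the b_e form a cut.  More than
kappa points of K share the same e, so the values of g on their pairs are bounded: a contradiction.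
*)
theory Submission
  imports Defs
begin

text \<open>The obstacle is the asymmetric case: the kappa values b_e cannot be matched with the
  theta times a_al by a decreasing sequence. They are encoded in distances of pairs instead, where
  each b_e can be used many times. The requirement that points alive at time i have distance at
  least i is internal, yet it tells the two sides of the cut apart: at the times a_al it costs
  nothing, because every b_e exceeds a_al, while at a time b_e it forbids all distances below b_e.
  Points must be allowed to die, since an internal sequence introduces a point at every time and
  only the external points a_be are under control. The set of these points is not a set of the
  model, so even a single row of distances has to be obtained from a bound of a chain, by a
  recursion nested in the main one. The rows are themselves sequences, and numerical codes are
  needed to bring them into some n^(<n). Internal arguments run through definable predicates;
  overspill takes the form that a bounded nonempty definable set of numbers has a maximum.\<close>

unbundle cardinal_syntax

section \<open>Definable predicates and terms\<close>

inductive dvar :: "((nat \<Rightarrow> 'a) \<Rightarrow> 'a) \<Rightarrow> bool" where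
  proj: "dvar (\<lambda>\<rho>. \<rho> i)"
| param: "dvar (\<lambda>\<rho>. c)"

text \<open>Definability with parameters. Environments are de Bruijn stacks, so that quantifier rules
  apply by plain resolution.\<close>
inductive dpred :: "('a \<Rightarrow> 'a \<Rightarrow> bool) \<Rightarrow> ((nat \<Rightarrow> 'a) \<Rightarrow> bool) \<Rightarrow> bool" for E where
  mem: "dvar t \<Longrightarrow> dvar u \<Longrightarrow> dpred E (\<lambda>\<rho>. E (t \<rho>) (u \<rho>))"
| eq: "dvar t \<Longrightarrow> dvar u \<Longrightarrow> dpred E (\<lambda>\<rho>. t \<rho> = u \<rho>)"
| neg: "dpred E P \<Longrightarrow> dpred E (\<lambda>\<rho>. \<not> P \<rho>)"
| conj: "dpred E P \<Longrightarrow> dpred E Q \<Longrightarrow> dpred E (\<lambda>\<rho>. P \<rho> \<and> Q \<rho>)"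
| ex: "dpred E P \<Longrightarrow> dpred E (\<lambda>\<rho>. \<exists>x. P (case_nat x \<rho>))"

text \<open>Even positions carry the stack and odd positions the parameters, so a formula has
  infinitely many of both at its disposal.\<close>

definition mix :: "(nat \<Rightarrow> 'a) \<Rightarrow> (nat \<Rightarrow> 'a) \<Rightarrow> nat \<Rightarrow> 'a" where
  "mix \<sigma> \<rho> i = (if even i then \<rho> (i div 2) else \<sigma> (i div 2))"

primrec rename :: "(nat \<Rightarrow> nat) \<Rightarrow> form \<Rightarrow> form" where
  "rename f (Mem i j) = Mem (f i) (f j)"
| "rename f (Eq i j) = Eq (f i) (f j)"
| "rename f (Neg \<phi>) = Neg (rename f \<phi>)"
| "rename f (Conj \<phi> \<psi>) = Conj (rename f \<phi>) (rename f \<psi>)"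
| "rename f (Ex i \<phi>) = Ex (f i) (rename f \<phi>)"

text \<open>Bound variables are renamed as well. Injectivity of \<open>f\<close> excludes capture,
  because an update at \<open>f i\<close> changes the composite assignment at \<open>i\<close>
  only.\<close>

lemma sat_rename:
  assumes "inj f"
  shows "sat E \<rho> (rename f \<phi>) \<longleftrightarrow> sat E (\<rho> \<circ> f) \<phi>"
proof (induction \<phi> arbitrary: \<rho>)
  case (Ex i \<phi>)
  have "(\<rho>(f i := x)) \<circ> f = (\<rho> \<circ> f)(i := x)" for x
    using assms by (auto simp: fun_eq_iff inj_eq)
  then show ?case using Ex by (simp add: o_def fun_upd_def)
qed auto

lemma dvar_mix:
  assumes "dvar t" shows "\<exists>i \<sigma>. \<forall>\<rho>. t \<rho> = mix \<sigma> \<rho> i"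
  using assms
proof cases
  case (proj i)
  then show ?thesis by (auto simp: mix_def intro!: exI[of _ "2 * i"])
next
  case (param c)
  then show ?thesis by (auto simp: mix_def intro!: exI[of _ 1] exI[of _ "\<lambda>_. c"])
qed

text \<open>Subformulas come with parameter lists of their own. Interleaving the lists gives a
  common one; \<open>f\<close> and \<open>g\<close> fix the stack positions and send the parameters
  of each list to their new places.\<close>

lemma mix_merge:
  obtains f g :: "nat \<Rightarrow> nat" and \<sigma> where "inj f" "inj g"
    "\<And>\<rho>. mix \<sigma> \<rho> \<circ> f = mix \<sigma>1 \<rho>" "\<And>\<rho>. mix \<sigma> \<rho> \<circ> g = mix \<sigma>2 \<rho>"
proof
  let ?f = "\<lambda>i::nat. if even i then i else 2 * (i - 1) + 1"
  let ?g = "\<lambda>i::nat. if even i then i else 2 * i + 1"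
  show "inj ?f"
    by (rule injI) (metis even_plus_one_iff dvd_triv_left add_right_cancel mult_left_cancel
        nat_minus_add_max diff_Suc_1 odd_Suc_minus_one zero_neq_numeral)
  show "inj ?g"
    by (rule injI) (metis even_plus_one_iff dvd_triv_left add_right_cancel mult_left_cancel
        zero_neq_numeral)
  show "mix (mix \<sigma>2 \<sigma>1) \<rho> \<circ> ?f = mix \<sigma>1 \<rho>" for \<rho>
    by (auto simp: fun_eq_iff mix_def elim!: oddE)
  show "mix (mix \<sigma>2 \<sigma>1) \<rho> \<circ> ?g = mix \<sigma>2 \<rho>" for \<rho>
    by (auto simp: fun_eq_iff mix_def elim!: oddE)
qed

lemma dpred_formula:
  assumes "dpred E P" shows "\<exists>\<phi> \<sigma>. \<forall>\<rho>. P \<rho> \<longleftrightarrow> sat E (mix \<sigma> \<rho>) \<phi>"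
proof -
  have bin: "\<exists>\<phi> \<sigma>. \<forall>\<rho>. R (p \<rho>) (q \<rho>) \<longleftrightarrow> sat E (mix \<sigma> \<rho>) \<phi>"
    if p: "dvar p" and q: "dvar q" and c: "\<And>i j. \<exists>\<phi>. \<forall>\<rho>. sat E \<rho> \<phi> = R (\<rho> i) (\<rho> j)" for p q R
  proof -
    obtain i \<sigma>1 j \<sigma>2 where i: "\<forall>\<rho>. p \<rho> = mix \<sigma>1 \<rho> i" and j: "\<forall>\<rho>. q \<rho> = mix \<sigma>2 \<rho> j"
      using dvar_mix[OF p] dvar_mix[OF q] by blast
    obtain f g \<sigma> where fg: "inj f" "inj g"
      "\<And>\<rho>. mix \<sigma> \<rho> \<circ> f = mix \<sigma>1 \<rho>" "\<And>\<rho>. mix \<sigma> \<rho> \<circ> g = mix \<sigma>2 \<rho>" by (rule mix_merge[of \<sigma>1 \<sigma>2]) (rule that)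
    obtain \<phi> where "\<forall>\<rho>. sat E \<rho> \<phi> = R (\<rho> (f i)) (\<rho> (g j))" using c by blast
    then have "\<forall>\<rho>. R (p \<rho>) (q \<rho>) \<longleftrightarrow> sat E (mix \<sigma> \<rho>) \<phi>"
      using i j fg(3,4)[symmetric] by simp
    then show ?thesis by blast
  qed
  show ?thesis using assms
  proof induction
    case (mem t u)
    show ?case
    proof (rule bin[OF mem])
      show "\<exists>\<phi>. \<forall>\<rho>. sat E \<rho> \<phi> = E (\<rho> i) (\<rho> j)" for i j
        by (rule exI[of _ "Mem i j"]) simp
    qed
  next
    case (eq t u)
    show ?case
    proof (rule bin[OF eq])
      show "\<exists>\<phi>. \<forall>\<rho>. sat E \<rho> \<phi> = (\<rho> i = \<rho> j)" for i j
        by (rule exI[of _ "Eq i j"]) simp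
    qed
  next
    case (neg P)
    then obtain \<phi> \<sigma> where "\<forall>\<rho>. P \<rho> \<longleftrightarrow> sat E (mix \<sigma> \<rho>) \<phi>" by blast
    then have "\<forall>\<rho>. (\<not> P \<rho>) \<longleftrightarrow> sat E (mix \<sigma> \<rho>) (Neg \<phi>)" by simp
    then show ?case by blast
  next
    case (conj P Q)
    then obtain \<phi> \<sigma>1 \<psi> \<sigma>2 where 1: "\<forall>\<rho>. P \<rho> \<longleftrightarrow> sat E (mix \<sigma>1 \<rho>) \<phi>" "\<forall>\<rho>. Q \<rho> \<longleftrightarrow> sat E (mix \<sigma>2 \<rho>) \<psi>"
      by blast
    obtain f g \<sigma> where "inj f" "inj g"
      "\<And>\<rho>. mix \<sigma> \<rho> \<circ> f = mix \<sigma>1 \<rho>" "\<And>\<rho>. mix \<sigma> \<rho> \<circ> g = mix \<sigma>2 \<rho>" by (rule mix_merge[of \<sigma>1 \<sigma>2]) (rule that)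
    then have "\<forall>\<rho>. (P \<rho> \<and> Q \<rho>) \<longleftrightarrow> sat E (mix \<sigma> \<rho>) (Conj (rename f \<phi>) (rename g \<psi>))"
      using 1 by (simp add: sat_rename)
    then show ?case by blast
  next
    case (ex P)
    then obtain \<phi> \<sigma> where 1: "\<forall>\<rho>. P \<rho> \<longleftrightarrow> sat E (mix \<sigma> \<rho>) \<phi>" by blast
    \<comment> \<open>The bound variable is put at position 1, a parameter slot. The remaining stack
      entries move down by one place and the parameters up by one place; the head
      \<open>\<sigma> 0\<close> of the new list is a dummy that the quantifier overwrites.\<close>
    let ?f = "\<lambda>i::nat. if i = 0 then 1 else if even i then i - 2 else i + 2"
    have f: "inj ?f"
    proof (rule injI)
      fix i j :: nat assume "?f i = ?f j"
      moreover have "even i \<or> odd i" "even j \<or> odd j" by auto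
      ultimately show "i = j" by (elim disjE evenE oddE) (auto split: if_splits, presburger+)
    qed
    have "(mix (case_nat (\<sigma> 0) \<sigma>) \<rho>)(1 := x) \<circ> ?f = mix \<sigma> (case_nat x \<rho>)" for \<rho> x
    proof
      fix i
      show "((mix (case_nat (\<sigma> 0) \<sigma>) \<rho>)(1 := x) \<circ> ?f) i = mix \<sigma> (case_nat x \<rho>) i"
      proof (cases "even i")
        case True
        then obtain k where "i = 2 * k" by blast
        then show ?thesis by (cases k) (auto simp: mix_def)
      next
        case False
        then obtain k where "i = 2 * k + 1" using oddE by blast
        then show ?thesis by (auto simp: mix_def)
      qed
    qed
    then have "\<forall>\<rho>. (\<exists>x. P (case_nat x \<rho>)) \<longleftrightarrow> sat E (mix (case_nat (\<sigma> 0) \<sigma>) \<rho>) (Ex 1 (rename ?f \<phi>))"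
      using 1 by (simp add: sat_rename[OF f])
    then show ?case by blast
  qed
qed

section \<open>Definable terms and renaming of variables\<close>

definition dterm :: "('a \<Rightarrow> 'a \<Rightarrow> bool) \<Rightarrow> ((nat \<Rightarrow> 'a) \<Rightarrow> 'a) \<Rightarrow> bool" where
  "dterm E t \<longleftrightarrow> dpred E (\<lambda>\<rho>. \<rho> 0 = t (\<lambda>i. \<rho> (Suc i)))"

lemma dpred_subst_var:
  assumes "dpred E P" "\<And>i. dvar (h i)"
  shows "dpred E (\<lambda>\<rho>. P (\<lambda>i. h i \<rho>))"
  using assms
proof (induction arbitrary: h)
  case (mem t u)
  have "dvar (\<lambda>\<rho>. s (\<lambda>i. h i \<rho>))" if "dvar s" for s
    using that mem.prems by (auto elim!: dvar.cases[of s] intro: dvar.intros)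
  then show ?case using mem dpred.mem by blast
next
  case (eq t u)
  have "dvar (\<lambda>\<rho>. s (\<lambda>i. h i \<rho>))" if "dvar s" for s
    using that eq.prems by (auto elim!: dvar.cases[of s] intro: dvar.intros)
  then show ?case using eq dpred.eq by blast
next
  case (neg P)
  then show ?case using dpred.neg by blast
next
  case (conj P Q)
  then show ?case using dpred.conj by blast
next
  case (ex P)
  let ?h = "\<lambda>i. case i of 0 \<Rightarrow> \<lambda>\<rho>. \<rho> 0 | Suc j \<Rightarrow> \<lambda>\<rho>. h j (\<lambda>i. \<rho> (Suc i))"
  have "dvar (?h i)" for i
  proof (cases i)
    case 0
    then show ?thesis by (auto intro: dvar.intros)
  next
    case (Suc j)
    from ex.prems[of j] have "dvar (\<lambda>\<rho>. h j (\<lambda>i. \<rho> (Suc i)))"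
      by cases (auto intro: dvar.intros)
    with Suc show ?thesis by simp
  qed
  then have "dpred E (\<lambda>\<rho>. P (\<lambda>i. ?h i \<rho>))" by (rule ex.IH)
  then have "dpred E (\<lambda>\<rho>. \<exists>x. P (\<lambda>i. ?h i (case_nat x \<rho>)))" by (rule dpred.ex)
  moreover have "(\<lambda>i. ?h i (case_nat x \<rho>)) = case_nat x (\<lambda>i. h i \<rho>)" for x \<rho>
    by (auto simp: fun_eq_iff split: nat.splits)
  ultimately show ?case by simp
qed

section \<open>Closure rules for definability\<close>

named_theorems dintro

text \<open>The bound variable and the rest of the stack are separate arguments of \<open>Q\<close>,
  so that the rule matches every quantified body by pattern unification.\<close>

lemma dpred_ex [dintro]:
  assumes "dpred E (\<lambda>\<rho>. Q (\<rho> 0) (\<lambda>i. \<rho> (Suc i)))"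
  shows "dpred E (\<lambda>\<rho>. \<exists>x. Q x \<rho>)"
  using dpred.ex[OF assms] by simp

lemma dpred_not [dintro]: "dpred E P \<Longrightarrow> dpred E (\<lambda>\<rho>. \<not> P \<rho>)"
  by (rule dpred.neg)

lemma dpred_conj [dintro]: "dpred E P \<Longrightarrow> dpred E Q \<Longrightarrow> dpred E (\<lambda>\<rho>. P \<rho> \<and> Q \<rho>)"
  by (rule dpred.conj)

lemma dpred_disj [dintro]:
  assumes "dpred E P" "dpred E Q" shows "dpred E (\<lambda>\<rho>. P \<rho> \<or> Q \<rho>)"
  using dpred_not[OF dpred_conj[OF dpred_not[OF assms(1)] dpred_not[OF assms(2)]]] by simp

lemma dpred_imp [dintro]:
  assumes "dpred E P" "dpred E Q" shows "dpred E (\<lambda>\<rho>. P \<rho> \<longrightarrow> Q \<rho>)"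
  using dpred_disj[OF dpred_not[OF assms(1)] assms(2)] by (simp only: imp_conv_disj)

lemma dpred_iff [dintro]:
  assumes "dpred E P" "dpred E Q" shows "dpred E (\<lambda>\<rho>. P \<rho> \<longleftrightarrow> Q \<rho>)"
  using dpred_conj[OF dpred_imp[OF assms] dpred_imp[OF assms(2,1)]] by (simp only: iff_conv_conj_imp)

lemma dpred_all [dintro]:
  assumes "dpred E (\<lambda>\<rho>. Q (\<rho> 0) (\<lambda>i. \<rho> (Suc i)))"
  shows "dpred E (\<lambda>\<rho>. \<forall>x. Q x \<rho>)"
  using dpred_not[OF dpred_ex[OF dpred_not[OF assms]]] by simp

lemma dterm_var [dintro]: "dterm E (\<lambda>\<rho>. \<rho> i)" "dterm E (\<lambda>\<rho>. c)"
  unfolding dterm_def by (rule dpred.eq; rule dvar.intros)+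

lemma dvar_case: "dvar (\<lambda>\<rho>. case j of 0 \<Rightarrow> \<rho> i | Suc j \<Rightarrow> \<rho> (k + j))"
  by (cases j) (auto intro: dvar.intros)

lemma dpred_shift:
  assumes "dpred E P" shows "dpred E (\<lambda>\<rho>. P (\<lambda>i. \<rho> (k + i)))"
  using dpred_subst_var[OF assms, of "\<lambda>i \<rho>. \<rho> (k + i)"] by (simp add: dvar.intros)

lemma dterm_lift:
  assumes "dterm E t" shows "dpred E (\<lambda>\<rho>. \<rho> i = t (\<lambda>j. \<rho> (k + j)))"
  using dpred_subst_var[OF assms[unfolded dterm_def],
      of "\<lambda>j \<rho>. case j of 0 \<Rightarrow> \<rho> i | Suc j \<Rightarrow> \<rho> (k + j)"]
  by (simp add: dvar_case)

lemma dterm_Suc: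
  assumes "dterm E t" shows "dterm E (\<lambda>\<rho>. t (\<lambda>i. \<rho> (Suc i)))"
  unfolding dterm_def using dterm_lift[OF assms, of 0 2] by simp

lemma dpred_mem [dintro]:
  assumes "dterm E t" "dterm E u" shows "dpred E (\<lambda>\<rho>. E (t \<rho>) (u \<rho>))"
proof -
  have "dpred E (\<lambda>\<rho>. \<exists>y x. x = t \<rho> \<and> y = u \<rho> \<and> E x y)"
    by (intro dpred_ex dpred_conj)
       (use dterm_lift[OF assms(1), of 0 2] dterm_lift[OF assms(2), of 1 2]
          dpred.mem[OF dvar.proj dvar.proj] in simp_all)
  then show ?thesis by simp
qed

lemma dpred_eq [dintro]:
  assumes "dterm E t" "dterm E u" shows "dpred E (\<lambda>\<rho>. t \<rho> = u \<rho>)"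
proof -
  have "dpred E (\<lambda>\<rho>. \<exists>x. x = t \<rho> \<and> x = u \<rho>)"
    by (intro dpred_ex dpred_conj)
       (use dterm_lift[OF assms(1), of 0 1] dterm_lift[OF assms(2), of 0 1] in simp_all)
  then show ?thesis by simp
qed

lemma dpred_subst:
  assumes "dpred E P" "\<And>i. dterm E (h i)"
  shows "dpred E (\<lambda>\<rho>. P (\<lambda>i. h i \<rho>))"
  using assms
proof (induction arbitrary: h)
  case (mem t u)
  have "dterm E (\<lambda>\<rho>. s (\<lambda>i. h i \<rho>))" if "dvar s" for s
    using that mem.prems by cases (simp_all add: dterm_var)
  then show ?case using mem by (intro dpred_mem)
next
  case (eq t u)
  have "dterm E (\<lambda>\<rho>. s (\<lambda>i. h i \<rho>))" if "dvar s" for s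
    using that eq.prems by cases (simp_all add: dterm_var)
  then show ?case using eq by (intro dpred_eq)
next
  case (neg P)
  then show ?case by (simp add: dpred_not)
next
  case (conj P Q)
  then show ?case by (simp add: dpred_conj)
next
  case (ex P)
  let ?h = "\<lambda>i. case i of 0 \<Rightarrow> \<lambda>\<rho>. \<rho> 0 | Suc j \<Rightarrow> \<lambda>\<rho>. h j (\<lambda>i. \<rho> (Suc i))"
  have "dterm E (?h i)" for i
    using dterm_Suc[OF ex.prems] by (cases i) (simp_all add: dterm_var)
  then have "dpred E (\<lambda>\<rho>. P (\<lambda>i. ?h i \<rho>))" by (rule ex.IH)
  then have "dpred E (\<lambda>\<rho>. \<exists>x. P (\<lambda>i. ?h i (case_nat x \<rho>)))" by (rule dpred.ex)
  moreover have "(\<lambda>i. ?h i (case_nat x \<rho>)) = case_nat x (\<lambda>i. h i \<rho>)" for x \<rho>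
    by (auto simp: fun_eq_iff split: nat.splits)
  ultimately show ?case by simp
qed

lemma dterm_subst:
  assumes "dterm E f" "\<And>i. dterm E (h i)"
  shows "dterm E (\<lambda>\<rho>. f (\<lambda>i. h i \<rho>))"
  unfolding dterm_def
  using dpred_subst[OF assms(1)[unfolded dterm_def],
      of "\<lambda>j. case j of 0 \<Rightarrow> \<lambda>\<rho>. \<rho> 0 | Suc j \<Rightarrow> \<lambda>\<rho>. h j (\<lambda>i. \<rho> (Suc i))"]
    dterm_Suc[OF assms(2)]
  by (simp add: dterm_var split: nat.split)

lemma dterm_nth:
  assumes "\<forall>t\<in>set ts. dterm E t"
  shows "dterm E (\<lambda>\<rho>. if i < length ts then (ts ! i) \<rho> else c)"
  using assms by (cases "i < length ts") (simp_all add: dterm_var)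

lemma dpred_subst_list:
  assumes "dpred E P" "\<forall>t\<in>set ts. dterm E t"
  shows "dpred E (\<lambda>\<rho>. P (\<lambda>i. if i < length ts then (ts ! i) \<rho> else undefined))"
  by (rule dpred_subst[OF assms(1) dterm_nth[OF assms(2)]])

lemma dterm_subst_list:
  assumes "dterm E f" "\<forall>t\<in>set ts. dterm E t"
  shows "dterm E (\<lambda>\<rho>. f (\<lambda>i. if i < length ts then (ts ! i) \<rho> else undefined))"
  by (rule dterm_subst[OF assms(1) dterm_nth[OF assms(2)]])

lemma dpred_subst1:
  assumes "dpred E (\<lambda>\<rho>. R (\<rho> 0))" "dterm E t"
  shows "dpred E (\<lambda>\<rho>. R (t \<rho>))"
  using dpred_subst_list[OF assms(1), of "[t]"] assms by simp

lemma dpred_subst2: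
  assumes "dpred E (\<lambda>\<rho>. R (\<rho> 0) (\<rho> 1))" "dterm E t" "dterm E u"
  shows "dpred E (\<lambda>\<rho>. R (t \<rho>) (u \<rho>))"
  using dpred_subst_list[OF assms(1), of "[t, u]"] assms by simp

lemma dterm_subst1:
  assumes "dterm E (\<lambda>\<rho>. f (\<rho> 0))" "dterm E t"
  shows "dterm E (\<lambda>\<rho>. f (t \<rho>))"
  using dterm_subst_list[OF assms(1), of "[t]"] assms by simp

lemma dterm_subst2:
  assumes "dterm E (\<lambda>\<rho>. f (\<rho> 0) (\<rho> 1))" "dterm E t" "dterm E u"
  shows "dterm E (\<lambda>\<rho>. f (t \<rho>) (u \<rho>))"
  using dterm_subst_list[OF assms(1), of "[t, u]"] assms by simp

lemma dterm_subst3: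
  assumes "dterm E (\<lambda>\<rho>. f (\<rho> 0) (\<rho> 1) (\<rho> 2))" "dterm E t" "dterm E u" "dterm E v"
  shows "dterm E (\<lambda>\<rho>. f (t \<rho>) (u \<rho>) (v \<rho>))"
  using dterm_subst_list[OF assms(1), of "[t, u, v]"] assms by simp

lemma dpred_const [dintro]: "dpred E (\<lambda>\<rho>. P)"
proof -
  have "dpred E (\<lambda>\<rho>. (undefined :: 'a) = undefined)" by (intro dintro)
  from this dpred_not[OF this] show ?thesis by (cases P) auto
qed

lemma dterm_if [dintro]:
  assumes "dpred E P" "dterm E t" "dterm E u"
  shows "dterm E (\<lambda>\<rho>. if P \<rho> then t \<rho> else u \<rho>)"
proof -
  have "dpred E (\<lambda>\<rho>. (P (\<lambda>i. \<rho> (Suc i)) \<longrightarrow> \<rho> 0 = t (\<lambda>i. \<rho> (Suc i)))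
     \<and> (\<not> P (\<lambda>i. \<rho> (Suc i)) \<longrightarrow> \<rho> 0 = u (\<lambda>i. \<rho> (Suc i))))"
    by (intro dpred_conj dpred_imp dpred_not)
       (use dpred_shift[OF assms(1), of 1] assms(2,3) in \<open>simp_all add: dterm_def\<close>)
  moreover have "(B \<longrightarrow> x = y) \<and> (\<not> B \<longrightarrow> x = z) \<longleftrightarrow> x = (if B then y else z)" for B and x y z :: 'a
    by auto
  ultimately show ?thesis unfolding dterm_def by (simp only:)
qed

text \<open>The default value makes this description operator definable even where \<open>THE\<close> is
  unspecified.\<close>
definition the1 :: "'a \<Rightarrow> ('a \<Rightarrow> bool) \<Rightarrow> 'a" where
  "the1 d P = (if \<exists>!y. P y then (THE y. P y) else d)"

lemma the1_eq:
  assumes "P y" "\<And>z. P z \<Longrightarrow> z = y" shows "the1 d P = y"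
proof -
  have "\<exists>!y. P y" using assms by (rule ex1I)
  moreover have "(THE y. P y) = y" using assms by (rule the_equality)
  ultimately show ?thesis by (simp add: the1_def)
qed

lemma the1_iff:
  "x = the1 d S \<longleftrightarrow> (\<exists>y. S y \<and> (\<forall>z. S z \<longrightarrow> z = y)) \<and> S x \<or>
     \<not> (\<exists>y. S y \<and> (\<forall>z. S z \<longrightarrow> z = y)) \<and> x = d"
proof (cases "\<exists>y. S y \<and> (\<forall>z. S z \<longrightarrow> z = y)")
  case True
  then obtain y where y: "S y" "\<And>z. S z \<Longrightarrow> z = y" by blast
  from the1_eq[of S, OF this] True y show ?thesis by metis
next
  case False
  then have "the1 d S = d" by (simp only: the1_def Ex1_def if_False)
  then show ?thesis using False by (simp only: simp_thms)
qed

lemma dterm_the1 [dintro]: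
  assumes "dpred E (\<lambda>\<rho>. R (\<rho> 0) (\<lambda>i. \<rho> (Suc i)))"
  shows "dterm E (\<lambda>\<rho>. the1 d (\<lambda>y. R y \<rho>))"
proof -
  have R: "dpred E (\<lambda>\<rho>. R (\<rho> i) (\<lambda>j. \<rho> (k + j)))" for i k
    using dpred_subst_var[OF assms, of "\<lambda>j \<rho>. case j of 0 \<Rightarrow> \<rho> i | Suc j \<Rightarrow> \<rho> (k + j)"]
    by (simp add: dvar_case)
  have u: "dpred E (\<lambda>\<rho>. \<exists>y. R y (\<lambda>i. \<rho> (Suc i)) \<and> (\<forall>z. R z (\<lambda>i. \<rho> (Suc i)) \<longrightarrow> z = y))"
    by (intro dpred_ex dpred_conj dpred_all dpred_imp dintro) (use R[of 0 2] R[of 0 3] in \<open>simp_all add: numeral_2_eq_2 numeral_3_eq_3\<close>)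
  have "dpred E (\<lambda>\<rho>. ((\<exists>y. R y (\<lambda>i. \<rho> (Suc i)) \<and> (\<forall>z. R z (\<lambda>i. \<rho> (Suc i)) \<longrightarrow> z = y))
      \<and> R (\<rho> 0) (\<lambda>i. \<rho> (Suc i))) \<or>
     (\<not> (\<exists>y. R y (\<lambda>i. \<rho> (Suc i)) \<and> (\<forall>z. R z (\<lambda>i. \<rho> (Suc i)) \<longrightarrow> z = y)) \<and> \<rho> 0 = d))"
    using assms u by (intro dpred_disj dpred_conj dpred_not dpred_eq dterm_var)
  then show ?thesis unfolding dterm_def the1_iff .
qed

section \<open>Cofinal sequences and a colouring\<close>

lemma Card_order_wf_strict:
  assumes "Card_order r" shows "wf (r - Id)"
  using assms unfolding card_order_on_def well_order_on_def by blast

lemma Card_order_linear: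
  assumes "Card_order r" "\<alpha> \<in> Field r" "\<beta> \<in> Field r" "\<alpha> \<noteq> \<beta>"
  shows "(\<alpha>, \<beta>) \<in> r \<or> (\<beta>, \<alpha>) \<in> r"
  using assms unfolding card_order_on_def well_order_on_def linear_order_on_def total_on_def by blast

lemma Card_order_trans:
  assumes "Card_order r" "(\<alpha>, \<beta>) \<in> r" "(\<beta>, \<gamma>) \<in> r" shows "(\<alpha>, \<gamma>) \<in> r"
  using assms unfolding card_order_on_def well_order_on_def linear_order_on_def partial_order_on_def
    preorder_on_def trans_def by blast

lemma Card_order_antisym:
  assumes "Card_order r" "(\<alpha>, \<beta>) \<in> r" "(\<beta>, \<alpha>) \<in> r" shows "\<alpha> = \<beta>"
  using assms unfolding card_order_on_def well_order_on_def linear_order_on_def partial_order_on_def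
    antisym_def by blast

lemma Card_order_refl:
  assumes "Card_order r" "\<alpha> \<in> Field r" shows "(\<alpha>, \<alpha>) \<in> r"
  using assms unfolding card_order_on_def well_order_on_def linear_order_on_def partial_order_on_def
    preorder_on_def refl_on_def by blast

lemma Card_order_no_max:
  assumes r: "Card_order r" "infinite (Field r)" and a: "\<alpha> \<in> Field r"
  shows "\<exists>\<beta>. (\<alpha>, \<beta>) \<in> r \<and> \<alpha> \<noteq> \<beta>"
  using infinite_Card_order_limit[OF r a] by blast

lemma finite_linear_max:
  assumes "finite A" "A \<noteq> {}" "A \<subseteq> X"
    and trans: "\<And>x y z. x \<in> X \<Longrightarrow> y \<in> X \<Longrightarrow> z \<in> X \<Longrightarrow> lt x y \<Longrightarrow> lt y z \<Longrightarrow> lt x z"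
    and total: "\<And>x y. x \<in> X \<Longrightarrow> y \<in> X \<Longrightarrow> x = y \<or> lt x y \<or> lt y x"
  shows "\<exists>m\<in>A. \<forall>a\<in>A. a = m \<or> lt a m"
  using assms(1-3)
proof (induction rule: finite_ne_induct)
  case (insert x F)
  then obtain m where m: "m \<in> F" "\<forall>a\<in>F. a = m \<or> lt a m" by auto
  consider "x = m" | "lt x m" | "lt m x" using total[of x m] m(1) insert.prems by auto
  then show ?case
  proof cases
    case 3
    have "lt a x" if a: "a \<in> F" for a
    proof (cases "a = m")
      case False
      then show ?thesis using m(2) a 3 trans[of a m x] m(1) insert.prems by blast
    qed (use 3 in simp)
    then show ?thesis by auto
  qed (use m in auto)
qed auto

text \<open>\<open>A\<close> is a cofinal subset of least cardinality. By minimality every smaller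
  subset of \<open>X\<close> is bounded, so recursion along \<open>|A|\<close> yields an increasing
  sequence. A cofinal set of indices has a cofinal image, which forces regularity. The abstract
  order covers increasing and decreasing sequences of numbers as well as chains of nodes.\<close>

lemma regular_cofinal_sequence:
  fixes X :: "'a set"
  assumes trans: "\<And>x y z. x \<in> X \<Longrightarrow> y \<in> X \<Longrightarrow> z \<in> X \<Longrightarrow> lt x y \<Longrightarrow> lt y z \<Longrightarrow> lt x z"
    and total: "\<And>x y. x \<in> X \<Longrightarrow> y \<in> X \<Longrightarrow> x = y \<or> lt x y \<or> lt y x"
    and irrefl: "\<And>x. x \<in> X \<Longrightarrow> \<not> lt x x"
    and ne: "X \<noteq> {}" and no_max: "\<And>x. x \<in> X \<Longrightarrow> \<exists>y\<in>X. lt x y"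
  shows "\<exists>(r :: 'a rel) f. Card_order r \<and> infinite (Field r) \<and> regularCard r \<and> r \<le>o |X| \<and>
    (\<forall>\<alpha>\<in>Field r. f \<alpha> \<in> X) \<and> (\<forall>\<alpha> \<beta>. (\<alpha>, \<beta>) \<in> r \<longrightarrow> \<alpha> \<noteq> \<beta> \<longrightarrow> lt (f \<alpha>) (f \<beta>)) \<and>
    (\<forall>x\<in>X. \<exists>\<alpha>\<in>Field r. lt x (f \<alpha>))"
proof -
  define C where "C = {A. A \<subseteq> X \<and> (\<forall>x\<in>X. \<exists>a\<in>A. lt x a)}"
  have "X \<in> C" using no_max by (auto simp: C_def)
  then obtain A where A: "A \<in> C" and min: "\<And>B. B \<in> C \<Longrightarrow> |A| \<le>o |B|"
    using exists_minim_Card_order[of "card_of ` C"] card_of_Card_order by auto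
  have AX: "A \<subseteq> X" and cof: "\<And>x. x \<in> X \<Longrightarrow> \<exists>a\<in>A. lt x a" using A by (auto simp: C_def)
  have infA: "infinite A"
  proof
    assume fin: "finite A"
    have neA: "A \<noteq> {}" using ne cof by blast
    have "\<exists>m\<in>A. \<forall>a\<in>A. a = m \<or> lt a m"
    proof (rule finite_linear_max[OF fin neA AX])
      show "lt x z" if "x \<in> X" "y \<in> X" "z \<in> X" "lt x y" "lt y z" for x y z by (rule trans[OF that])
      show "x = y \<or> lt x y \<or> lt y x" if "x \<in> X" "y \<in> X" for x y by (rule total[OF that])
    qed
    then obtain m where m: "m \<in> A" "\<forall>a\<in>A. a = m \<or> lt a m" by blast
    then obtain a where a: "a \<in> A" "lt m a" using cof[of m] AX by blast
    then have "m \<in> X" "a \<in> X" "a = m \<or> lt a m" using m AX by blast+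
    then show False using a(2) trans[of m a m] irrefl[of m] by blast
  qed
  \<comment> \<open>A set that is not cofinal leaves some \<open>x\<close> with none of its members
    above; this is a weak bound only, and any larger element is a strict one.\<close>
  have small: "\<exists>z\<in>X. \<forall>b\<in>B. lt b z" if B: "B \<subseteq> X" "|B| <o |A|" for B
  proof -
    have "B \<notin> C" using min B(2) not_ordLess_ordLeq by blast
    then obtain x where x: "x \<in> X" "\<forall>b\<in>B. \<not> lt x b" using B by (auto simp: C_def)
    then obtain z where z: "z \<in> X" "lt x z" using no_max[of x] by blast
    have "lt b z" if b: "b \<in> B" for b
    proof -
      have "b \<in> X" "\<not> lt x b" using b B x by blast+
      then have "x = b \<or> lt b x" using total[of x b] x by blast
      then show ?thesis using z trans[of b x z] x \<open>b \<in> X\<close> by blast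
    qed
    then show ?thesis using z by blast
  qed
  let ?r = "|A|"
  have r: "Card_order ?r" "Field ?r = A" by (rule card_of_Card_order, rule Field_card_of)
  \<comment> \<open>The next value has to exceed \<open>x\<close> itself, for cofinality, and all
    earlier values.\<close>
  have "\<exists>f. \<forall>x. x \<in> A \<longrightarrow> f x \<in> X \<and> lt x (f x) \<and> (\<forall>y. (y, x) \<in> ?r - Id \<longrightarrow> lt (f y) (f x))"
  proof (rule dependent_wf_choice[OF Card_order_wf_strict[OF r(1)]])
    fix x and f :: "'a \<Rightarrow> 'a"
    assume IH: "\<And>y. (y, x) \<in> ?r - Id \<Longrightarrow> y \<in> A \<longrightarrow> f y \<in> X \<and> lt y (f y) \<and> (\<forall>z. (z, y) \<in> ?r - Id \<longrightarrow> lt (f z) (f y))"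
    show "\<exists>g. x \<in> A \<longrightarrow> g \<in> X \<and> lt x g \<and> (\<forall>y. (y, x) \<in> ?r - Id \<longrightarrow> lt (f y) g)"
    proof (cases "x \<in> A")
      case True
      let ?B = "f ` underS ?r x"
      have "?B \<subseteq> X" using IH r(2) by (fastforce simp: underS_def Field_def)
      moreover have "|?B| <o ?r"
        using card_of_image card_of_underS[OF r(1)] r(2) True ordLeq_ordLess_trans by blast
      ultimately obtain z where z: "z \<in> X" "\<forall>b\<in>?B. lt b z" using small by blast
      obtain x' where x': "x' \<in> X" "lt x x'" using no_max True AX by blast
      show ?thesis
      proof (cases "lt z x'")
        case lt: True
        have "lt b x'" if "b \<in> ?B" for b
          using that z x' lt trans[of b z x'] \<open>?B \<subseteq> X\<close> by blast
        then show ?thesis using x' by (auto simp: underS_def)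
      next
        case False
        then have "lt x z" using total[of z x'] z x' trans[of x x' z] True AX by blast
        then show ?thesis using z by (auto simp: underS_def)
      qed
    qed auto
  qed auto
  then obtain f where f: "\<And>x. x \<in> A \<Longrightarrow> f x \<in> X \<and> lt x (f x)"
    "\<And>x y. (y, x) \<in> ?r \<Longrightarrow> y \<noteq> x \<Longrightarrow> lt (f y) (f x)"
    using r(2) by (auto simp: Field_def)
  have cofin: "\<exists>\<alpha>\<in>A. lt x (f \<alpha>)" if x: "x \<in> X" for x
  proof -
    obtain a where a: "a \<in> A" "lt x a" using cof[OF x] by blast
    then show ?thesis using f(1)[OF a(1)] trans[of x a "f a"] x AX by blast
  qed
  have "regularCard ?r" unfolding regularCard_def
  proof (intro allI impI)
    fix K assume K: "K \<subseteq> Field ?r \<and> cofinal K ?r"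
    have "f ` K \<in> C" unfolding C_def
    proof (intro CollectI conjI ballI)
      show "f ` K \<subseteq> X" using K f(1) r(2) by blast
      fix x assume x: "x \<in> X"
      then obtain \<alpha> where \<alpha>: "\<alpha> \<in> A" "lt x (f \<alpha>)" using cofin by blast
      then obtain \<beta> where \<beta>: "\<beta> \<in> K" "\<alpha> \<noteq> \<beta>" "(\<alpha>, \<beta>) \<in> ?r" using K unfolding cofinal_def r(2) by blast
      then have "\<beta> \<in> A" using K r(2) by blast
      then have "lt x (f \<beta>)"
        using trans[of x "f \<alpha>" "f \<beta>"] f(1)[OF \<alpha>(1)] f(1)[of \<beta>] f(2)[OF \<beta>(3,2)] \<alpha>(2) x by blast
      then show "\<exists>a\<in>f ` K. lt x a" using \<beta> by blast
    qed
    then have "|A| \<le>o |K|" using min card_of_image ordLeq_transitive by blast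
    moreover have "|K| \<le>o |A|" using K r(2) card_of_mono1 by metis
    ultimately show "|K| =o ?r" by (simp add: ordIso_iff_ordLeq)
  qed
  moreover have "?r \<le>o |X|" using AX by (rule card_of_mono1)
  ultimately show ?thesis using r infA f cofin
    by (intro exI[of _ ?r] exI[of _ f] conjI) simp_all
qed

text \<open>Otherwise \<open>K\<close> would be a union of at most \<open>|B|\<close> fibres of size
  at most \<open>|B|\<close>. This takes the place of the regularity of the successor cardinal of
  \<open>|B|\<close>.\<close>

lemma pigeonhole_large_fibre:
  assumes "infinite B" "h ` K \<subseteq> B" "\<not> |K| \<le>o |B|"
  shows "\<exists>\<epsilon>\<in>B. \<not> |{\<beta> \<in> K. h \<beta> = \<epsilon>}| \<le>o |B|"
proof (rule ccontr)
  assume "\<not> ?thesis"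
  then have "|\<Union>\<epsilon>\<in>B. {\<beta> \<in> K. h \<beta> = \<epsilon>}| \<le>o |B|"
    using assms(1) by (intro card_of_UNION_ordLeq_infinite ordLeq_refl card_of_Card_order) auto
  moreover have "(\<Union>\<epsilon>\<in>B. {\<beta> \<in> K. h \<beta> = \<epsilon>}) = K" using assms(2) by blast
  ultimately show False using assms(3) by simp
qed

text \<open>The order type of \<open>W\<close> exceeds \<open>\<kappa>\<close>, so
  \<open>\<kappa>\<close> is isomorphic to a proper initial segment of \<open>W\<close>, cut off by
  some \<open>\<gamma>\<close>.\<close>

lemma large_initial_segment:
  assumes "Card_order \<kappa>" "Card_order r" "W \<subseteq> Field r" "\<not> |W| \<le>o \<kappa>"
  shows "\<exists>\<gamma>\<in>W. \<kappa> \<le>o |W \<inter> underS r \<gamma>|"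
proof -
  let ?R = "Restr r W"
  have wr: "Well_order r" using assms(2) by (simp add: card_order_on_def)
  then have wR: "Well_order ?R" and FR: "Field ?R = W"
    using Well_order_Restr assms(3) Refl_Field_Restr2[of r W]
    unfolding well_order_on_def linear_order_on_def partial_order_on_def preorder_on_def by blast+
  have wk: "Well_order \<kappa>" using assms(1) by (simp add: card_order_on_def)
  have "\<not> ?R \<le>o \<kappa>"
  proof
    assume "?R \<le>o \<kappa>"
    moreover have "|W| \<le>o ?R" using wR FR card_of_least by metis
    ultimately show False using assms(4) ordLeq_transitive by blast
  qed
  then have "\<kappa> <o ?R" using not_ordLeq_iff_ordLess[OF wk wR] by blast
  then obtain \<gamma> where \<gamma>: "\<gamma> \<in> W" "\<kappa> =o Restr ?R (underS ?R \<gamma>)"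
    using ordLess_iff_ordIso_Restr[OF wR wk] FR by auto
  have "|Field \<kappa>| =o |Field (Restr ?R (underS ?R \<gamma>))|" using \<gamma>(2) by (rule card_of_cong)
  moreover have "Field (Restr ?R (underS ?R \<gamma>)) \<subseteq> W \<inter> underS r \<gamma>"
    by (auto simp: Field_def underS_def)
  ultimately have "|Field \<kappa>| \<le>o |W \<inter> underS r \<gamma>|"
    using card_of_mono1 ordIso_ordLeq_trans by blast
  then have "\<kappa> \<le>o |W \<inter> underS r \<gamma>|"
    using card_of_Field_ordIso[OF assms(1)] ordIso_symmetric ordIso_ordLeq_trans by blast
  with \<gamma>(1) show ?thesis by blast
qed

text \<open>The colour of \<open>(\<beta>, \<gamma>)\<close> is the image of \<open>\<beta>\<close> under an injection of the predecessors of \<open>\<gamma>\<close>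
  into \<open>\<kappa>\<close>.\<close>
lemma unbounded_colouring:
  fixes \<kappa> \<theta> :: "'a rel"
  assumes k: "Card_order \<kappa>" "infinite (Field \<kappa>)" and t: "Card_order \<theta>" and less: "\<kappa> <o \<theta>"
  obtains K :: "'a set" and g :: "'a \<Rightarrow> 'a \<Rightarrow> 'a" where "K \<subseteq> Field \<theta>" "\<not> |K| \<le>o \<kappa>"
    "\<And>\<beta> \<gamma>. g \<beta> \<gamma> \<in> Field \<kappa>"
    "\<And>W \<epsilon>. W \<subseteq> K \<Longrightarrow> \<not> |W| \<le>o \<kappa> \<Longrightarrow> \<epsilon> \<in> Field \<kappa> \<Longrightarrow>
      \<exists>\<beta>\<in>W. \<exists>\<gamma>\<in>W. (\<beta>, \<gamma>) \<in> \<theta> \<and> \<beta> \<noteq> \<gamma> \<and> (g \<beta> \<gamma>, \<epsilon>) \<notin> \<kappa>"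
proof -
  \<comment> \<open>This is the initial segment of \<open>\<theta>\<close> whose order type is the
    successor cardinal of \<open>\<kappa>\<close>; the predecessors of each member can be coloured
    injectively.\<close>
  define K where "K = {\<gamma> \<in> Field \<theta>. |underS \<theta> \<gamma>| \<le>o \<kappa>}"
  have kF: "|Field \<kappa>| =o \<kappa>" using card_of_Field_ordIso k(1) .
  have "\<forall>\<gamma>\<in>K. \<exists>f. inj_on f (underS \<theta> \<gamma>) \<and> f ` underS \<theta> \<gamma> \<subseteq> Field \<kappa>"
  proof
    fix \<gamma> assume "\<gamma> \<in> K"
    then have "|underS \<theta> \<gamma>| \<le>o |Field \<kappa>|"
      using ordLeq_ordIso_trans[OF _ ordIso_symmetric[OF kF]] unfolding K_def by blast
    then show "\<exists>f. inj_on f (underS \<theta> \<gamma>) \<and> f ` underS \<theta> \<gamma> \<subseteq> Field \<kappa>"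
      using card_of_ordLeq by blast
  qed
  from bchoice[OF this] obtain f where f: "\<And>\<gamma>. \<gamma> \<in> K \<Longrightarrow> inj_on (f \<gamma>) (underS \<theta> \<gamma>)"
    "\<And>\<gamma>. \<gamma> \<in> K \<Longrightarrow> f \<gamma> ` underS \<theta> \<gamma> \<subseteq> Field \<kappa>" by blast
  obtain \<epsilon>0 where \<epsilon>0: "\<epsilon>0 \<in> Field \<kappa>" using k(2) by fastforce
  define g where "g \<beta> \<gamma> = (if \<gamma> \<in> K \<and> \<beta> \<in> underS \<theta> \<gamma> then f \<gamma> \<beta> else \<epsilon>0)" for \<beta> \<gamma>
  have Kbig: "\<not> |K| \<le>o \<kappa>"
  proof
    assume K: "|K| \<le>o \<kappa>"
    have "K \<noteq> Field \<theta>"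
    proof
      assume "K = Field \<theta>"
      then have "|Field \<theta>| \<le>o \<kappa>" using K by simp
      then have "\<theta> \<le>o \<kappa>" using card_of_Field_ordIso[OF t] ordIso_symmetric ordIso_ordLeq_trans by blast
      then show False using less not_ordLess_ordLeq by blast
    qed
    \<comment> \<open>The least element outside \<open>K\<close> has all its predecessors in
      \<open>K\<close>, hence at most \<open>\<kappa>\<close> of them, and so belongs to
      \<open>K\<close> after all.\<close>
    then obtain x where x: "x \<in> Field \<theta>" "x \<notin> K" by (auto simp: K_def)
    from wfE_min[OF Card_order_wf_strict[OF t], of x "Field \<theta> - K"] x
    obtain y where y: "y \<in> Field \<theta>" "y \<notin> K" "\<And>z. (z, y) \<in> \<theta> - Id \<Longrightarrow> z \<notin> Field \<theta> - K" by blast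
    have "underS \<theta> y \<subseteq> K"
      using y(3) by (auto simp: underS_def Field_def)
    then have "|underS \<theta> y| \<le>o \<kappa>" using K card_of_mono1 ordLeq_transitive by blast
    then show False using y by (simp add: K_def)
  qed
  show ?thesis
  proof
    show "K \<subseteq> Field \<theta>" by (auto simp: K_def)
    show "\<not> |K| \<le>o \<kappa>" by (rule Kbig)
    show "g \<beta> \<gamma> \<in> Field \<kappa>" for \<beta> \<gamma> using f(2) \<epsilon>0 by (auto simp: g_def)
    fix W \<epsilon> assume W: "W \<subseteq> K" "\<not> |W| \<le>o \<kappa>" and \<epsilon>: "\<epsilon> \<in> Field \<kappa>"
    \<comment> \<open>A larger \<open>\<epsilon>'\<close> places all colours up to
      \<open>\<epsilon>\<close> in a proper initial segment of \<open>\<kappa>\<close>, of size less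
      than \<open>\<kappa>\<close>, whereas some \<open>\<gamma>\<close> has at least
      \<open>\<kappa>\<close> predecessors in \<open>W\<close>, with pairwise different
      colours.\<close>
    obtain \<epsilon>' where \<epsilon>': "(\<epsilon>, \<epsilon>') \<in> \<kappa>" "\<epsilon> \<noteq> \<epsilon>'" using Card_order_no_max[OF k \<epsilon>] by blast
    have "W \<subseteq> Field \<theta>" using W by (auto simp: K_def)
    then obtain \<gamma> where \<gamma>: "\<gamma> \<in> W" "\<kappa> \<le>o |W \<inter> underS \<theta> \<gamma>|"
      using large_initial_segment[OF k(1) t _ W(2)] by blast
    show "\<exists>\<beta>\<in>W. \<exists>\<gamma>\<in>W. (\<beta>, \<gamma>) \<in> \<theta> \<and> \<beta> \<noteq> \<gamma> \<and> (g \<beta> \<gamma>, \<epsilon>) \<notin> \<kappa>"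
    proof (rule ccontr)
      assume "\<not> ?thesis"
      then have "\<And>\<beta>. \<beta> \<in> W \<inter> underS \<theta> \<gamma> \<Longrightarrow> (g \<beta> \<gamma>, \<epsilon>) \<in> \<kappa>"
        using \<gamma>(1) by (auto simp: underS_def)
      moreover have "(\<alpha>, \<epsilon>) \<in> \<kappa> \<Longrightarrow> \<alpha> \<in> underS \<kappa> \<epsilon>'" for \<alpha>
        using Card_order_trans[OF k(1) _ \<epsilon>'(1)] Card_order_antisym[OF k(1) \<epsilon>'(1)] \<epsilon>'(2) by (auto simp: underS_def)
      ultimately have "f \<gamma> ` (W \<inter> underS \<theta> \<gamma>) \<subseteq> underS \<kappa> \<epsilon>'"
        using \<gamma>(1) W(1) by (fastforce simp: g_def)
      moreover have "inj_on (f \<gamma>) (W \<inter> underS \<theta> \<gamma>)"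
        using f(1) \<gamma>(1) W(1) by (meson inf_le2 inj_on_subset subsetD)
      ultimately have "|W \<inter> underS \<theta> \<gamma>| \<le>o |underS \<kappa> \<epsilon>'|" using card_of_ordLeq by blast
      moreover have "|underS \<kappa> \<epsilon>'| <o \<kappa>"
        using card_of_underS[OF k(1)] \<epsilon>'(1) by (auto simp: Field_def)
      ultimately have "\<kappa> <o \<kappa>" using \<gamma>(2) ordLeq_ordLess_trans ordLeq_transitive by blast
      then show False using ordLess_irreflexive by blast
    qed
  qed
qed

section \<open>Sets, pairs and functions of the model\<close>

locale zfc_minus_model =
  fixes E :: "'a \<Rightarrow> 'a \<Rightarrow> bool"
  assumes zfc_minus: "ZFC_minus E"
begin

section \<open>The axioms restated for definable predicates\<close>

lemma set_eqI:
  assumes "\<And>z. E z x \<longleftrightarrow> E z y" shows "x = y"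
proof -
  have "\<forall>x y. (\<forall>z. E z x \<longleftrightarrow> E z y) \<longrightarrow> x = y"
    using zfc_minus unfolding ZFC_minus_def by (elim conjE)
  then show ?thesis using assms by blast
qed

lemma foundation:
  assumes "E y x" shows "\<exists>y. E y x \<and> \<not> (\<exists>z. E z y \<and> E z x)"
proof -
  have "\<forall>x. (\<exists>y. E y x) \<longrightarrow> (\<exists>y. E y x \<and> \<not> (\<exists>z. E z y \<and> E z x))"
    using zfc_minus unfolding ZFC_minus_def by (elim conjE)
  then show ?thesis using assms by blast
qed

lemma pairing: "\<exists>c. E a c \<and> E b c"
proof -
  have "\<forall>a b. \<exists>c. E a c \<and> E b c"
    using zfc_minus unfolding ZFC_minus_def by (elim conjE)
  then show ?thesis by blast
qed

lemma union: "\<exists>u. \<forall>y z. E z y \<and> E y a \<longrightarrow> E z u"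
proof -
  have "\<forall>a. \<exists>u. \<forall>y z. E z y \<and> E y a \<longrightarrow> E z u"
    using zfc_minus unfolding ZFC_minus_def by (elim conjE)
  then show ?thesis by blast
qed

lemma infinity: "\<exists>w. is_inductive E w"
  using zfc_minus unfolding ZFC_minus_def by (elim conjE)

lemma separation:
  assumes "dpred E (\<lambda>\<rho>. P (\<rho> 0))"
  shows "\<exists>b. \<forall>z. E z b \<longleftrightarrow> E z a \<and> P z"
proof -
  obtain \<phi> \<sigma> where s: "\<And>\<rho>. P (\<rho> 0) \<longleftrightarrow> sat E (mix \<sigma> \<rho>) \<phi>"
    using dpred_formula[OF assms] by blast
  have "\<forall>\<phi> \<rho> v a. \<exists>b. \<forall>z. E z b \<longleftrightarrow> (E z a \<and> sat E (\<rho>(v := z)) \<phi>)"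
    using zfc_minus unfolding ZFC_minus_def by (elim conjE)
  then obtain b where b: "\<forall>z. E z b \<longleftrightarrow> (E z a \<and> sat E ((mix \<sigma> \<sigma>)(0 := z)) \<phi>)" by blast
  have "(mix \<sigma> \<sigma>)(0 := z) = mix \<sigma> (\<sigma>(0 := z))" for z
    by (auto simp: fun_eq_iff mix_def)
  then have "sat E ((mix \<sigma> \<sigma>)(0 := z)) \<phi> \<longleftrightarrow> P z" for z using s[of "\<sigma>(0 := z)"] by simp
  with b show ?thesis by auto
qed

lemma collection:
  assumes "dpred E (\<lambda>\<rho>. R (\<rho> 0) (\<rho> 1))" "\<And>x. E x a \<Longrightarrow> \<exists>y. R x y"
  shows "\<exists>b. \<forall>x. E x a \<longrightarrow> (\<exists>y. E y b \<and> R x y)"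
proof -
  obtain \<phi> \<sigma> where s: "\<And>\<rho>. R (\<rho> 0) (\<rho> 1) \<longleftrightarrow> sat E (mix \<sigma> \<rho>) \<phi>"
    using dpred_formula[OF assms(1)] by blast
  have coll: "\<forall>\<phi> \<rho> u v a. u \<noteq> v \<longrightarrow>
        (\<forall>x. E x a \<longrightarrow> (\<exists>y. sat E (\<rho>(u := x, v := y)) \<phi>)) \<longrightarrow>
        (\<exists>b. \<forall>x. E x a \<longrightarrow> (\<exists>y. E y b \<and> sat E (\<rho>(u := x, v := y)) \<phi>))"
    using zfc_minus unfolding ZFC_minus_def by (elim conjE)
  \<comment> \<open>In the interleaving the variables 0 and 2 are the stack positions 0 and
    1.\<close>
  have "(mix \<sigma> \<sigma>)(0 := x, 2 := y) = mix \<sigma> (\<sigma>(0 := x, 1 := y))" for x y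
    by (rule ext) (auto simp: mix_def elim!: evenE)
  then have "sat E ((mix \<sigma> \<sigma>)(0 := x, 2 := y)) \<phi> \<longleftrightarrow> R x y" for x y
    using s[of "\<sigma>(0 := x, 1 := y)"] by simp
  with coll[rule_format, of 0 2 a "mix \<sigma> \<sigma>" \<phi>] assms(2) show ?thesis by simp
qed

text \<open>A total operator: \<open>the1\<close> returns a default when the class is not a set, so
  that definability of \<open>Coll\<close> terms requires no proof that the set exists.\<close>

definition Coll :: "('a \<Rightarrow> bool) \<Rightarrow> 'a" where
  "Coll P = the1 undefined (\<lambda>b. \<forall>z. E z b \<longleftrightarrow> P z)"

lemma mem_Coll:
  assumes "\<exists>b. \<forall>z. P z \<longrightarrow> E z b" "dpred E (\<lambda>\<rho>. P (\<rho> 0))"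
  shows "E z (Coll P) \<longleftrightarrow> P z"
proof -
  obtain b where "\<forall>z. P z \<longrightarrow> E z b" using assms(1) by blast
  moreover obtain c where "\<forall>z. E z c \<longleftrightarrow> E z b \<and> P z" using separation[OF assms(2)] by blast
  ultimately have c: "\<forall>z. E z c \<longleftrightarrow> P z" by blast
  then have "Coll P = c" unfolding Coll_def by (rule the1_eq) (auto intro: set_eqI simp: c)
  with c show ?thesis by simp
qed

lemma dterm_Coll [dintro]:
  assumes "dpred E (\<lambda>\<rho>. P (\<rho> 0) (\<lambda>i. \<rho> (Suc i)))"
  shows "dterm E (\<lambda>\<rho>. Coll (\<lambda>z. P z \<rho>))"
  unfolding Coll_def
proof (rule dterm_the1, rule dpred_all, rule dpred_iff)
  show "dpred E (\<lambda>\<rho>. P (\<rho> 0) (\<lambda>i. \<rho> (Suc (Suc i))))"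
    using dpred_subst_var[OF assms, of "\<lambda>j \<rho>. case j of 0 \<Rightarrow> \<rho> 0 | Suc j \<Rightarrow> \<rho> (2 + j)"]
    by (simp add: dvar_case)
qed (intro dintro)

section \<open>Pairs and internal functions\<close>

definition zero :: 'a where "zero = Coll (\<lambda>z. False)"
definition upair :: "'a \<Rightarrow> 'a \<Rightarrow> 'a" where "upair a b = Coll (\<lambda>z. z = a \<or> z = b)"
definition pr :: "'a \<Rightarrow> 'a \<Rightarrow> 'a" where "pr a b = upair (upair a a) (upair a b)"
definition sc :: "'a \<Rightarrow> 'a" where "sc x = Coll (\<lambda>z. E z x \<or> z = x)"

lemma mem_zero [simp]: "\<not> E z zero"
  unfolding zero_def by (subst mem_Coll) (simp, intro dintro, simp)

lemma mem_upair [simp]: "E z (upair a b) \<longleftrightarrow> z = a \<or> z = b"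
  unfolding upair_def
proof (rule mem_Coll)
  show "\<exists>c. \<forall>z. z = a \<or> z = b \<longrightarrow> E z c" using pairing[of a b] by blast
qed (intro dintro)

lemma dterm_upair [dintro]: "dterm E t \<Longrightarrow> dterm E u \<Longrightarrow> dterm E (\<lambda>\<rho>. upair (t \<rho>) (u \<rho>))"
  by (rule dterm_subst2[of E upair]) (unfold upair_def, intro dintro)

lemma mem_sc [simp]: "E z (sc x) \<longleftrightarrow> E z x \<or> z = x"
  unfolding sc_def
proof (rule mem_Coll)
  obtain u where "\<forall>y z. E z y \<and> E y (upair x (upair x x)) \<longrightarrow> E z u" using union by blast
  then have "\<forall>z. E z x \<or> z = x \<longrightarrow> E z u" by (metis mem_upair)
  then show "\<exists>c. \<forall>z. E z x \<or> z = x \<longrightarrow> E z c" by blast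
qed (intro dintro)

lemma dterm_sc [dintro]: "dterm E t \<Longrightarrow> dterm E (\<lambda>\<rho>. sc (t \<rho>))"
  by (rule dterm_subst1[of E sc]) (unfold sc_def, intro dintro)

lemma upair_eq_iff: "upair a b = upair c d \<longleftrightarrow> a = c \<and> b = d \<or> a = d \<and> b = c"
proof
  assume "upair a b = upair c d"
  then have "\<forall>z. z = a \<or> z = b \<longleftrightarrow> z = c \<or> z = d" by (metis mem_upair)
  then show "a = c \<and> b = d \<or> a = d \<and> b = c" by metis
next
  assume "a = c \<and> b = d \<or> a = d \<and> b = c"
  then show "upair a b = upair c d" by (auto intro: set_eqI)
qed

lemma pr_eq_iff [simp]: "pr a b = pr c d \<longleftrightarrow> a = c \<and> b = d"
  unfolding pr_def upair_eq_iff by auto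

lemma dterm_pr [dintro]: "dterm E t \<Longrightarrow> dterm E u \<Longrightarrow> dterm E (\<lambda>\<rho>. pr (t \<rho>) (u \<rho>))"
  unfolding pr_def by (intro dintro)

lemma is_upair_iff: "is_upair E u a b \<longleftrightarrow> u = upair a b"
  unfolding is_upair_def by (auto intro: set_eqI)

lemma is_pair_iff: "is_pair E p a b \<longleftrightarrow> p = pr a b"
  unfolding is_pair_def is_upair_iff pr_def by (auto intro: set_eqI)

lemma is_succ_iff: "is_succ E x y \<longleftrightarrow> y = sc x"
  unfolding is_succ_def by (auto intro: set_eqI)

lemma is_empty_iff: "is_empty E e \<longleftrightarrow> e = zero"
  unfolding is_empty_def by (auto intro: set_eqI)

definition fn :: "'a \<Rightarrow> 'a \<Rightarrow> bool" where
  "fn s m \<longleftrightarrow> (\<forall>z. E z s \<longrightarrow> (\<exists>x y. E x m \<and> z = pr x y)) \<and>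
     (\<forall>x. E x m \<longrightarrow> (\<exists>y. E (pr x y) s \<and> (\<forall>y'. E (pr x y') s \<longrightarrow> y' = y)))"

definition ap :: "'a \<Rightarrow> 'a \<Rightarrow> 'a" where
  "ap s x = the1 zero (\<lambda>y. E (pr x y) s)"

definition mk :: "'a \<Rightarrow> ('a \<Rightarrow> 'a) \<Rightarrow> 'a" where
  "mk m f = Coll (\<lambda>z. \<exists>x. E x m \<and> z = pr x (f x))"

lemma dpred_fn [dintro]: "dterm E t \<Longrightarrow> dterm E u \<Longrightarrow> dpred E (\<lambda>\<rho>. fn (t \<rho>) (u \<rho>))"
  by (rule dpred_subst2[of E fn]) (unfold fn_def, intro dintro)

lemma dterm_ap [dintro]: "dterm E t \<Longrightarrow> dterm E u \<Longrightarrow> dterm E (\<lambda>\<rho>. ap (t \<rho>) (u \<rho>))"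
  by (rule dterm_subst2[of E ap]) (unfold ap_def, intro dintro)

lemma fn_mem_iff:
  assumes "fn s m" "E x m" shows "E (pr x y) s \<longleftrightarrow> y = ap s x"
proof -
  from assms obtain y0 where y0: "E (pr x y0) s" "\<And>y'. E (pr x y') s \<Longrightarrow> y' = y0"
    unfolding fn_def by blast
  then have "ap s x = y0" unfolding ap_def by (rule the1_eq)
  with y0 show ?thesis by blast
qed

lemma fn_mem:
  assumes "fn s m" shows "E z s \<longleftrightarrow> (\<exists>x. E x m \<and> z = pr x (ap s x))"
proof
  assume z: "E z s"
  with assms obtain x y where x: "E x m" "z = pr x y" unfolding fn_def by blast
  with z fn_mem_iff[OF assms x(1), of y] show "\<exists>x. E x m \<and> z = pr x (ap s x)" by auto
qed (use fn_mem_iff[OF assms] in auto)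

lemma mem_mk:
  assumes "dterm E (\<lambda>\<rho>. f (\<rho> 0))"
  shows "E z (mk m f) \<longleftrightarrow> (\<exists>x. E x m \<and> z = pr x (f x))"
  unfolding mk_def
proof (rule mem_Coll)
  note [dintro] = dterm_subst1[OF assms]
  \<comment> \<open>Collection bounds the graph directly: the pairs themselves are the collected
    witnesses.\<close>
  have "\<exists>b. \<forall>x. E x m \<longrightarrow> (\<exists>y. E y b \<and> y = pr x (f x))"
    by (rule collection) (intro dintro, blast)
  then show "\<exists>b. \<forall>z. (\<exists>x. E x m \<and> z = pr x (f x)) \<longrightarrow> E z b" by blast
  show "dpred E (\<lambda>\<rho>. \<exists>x. E x m \<and> \<rho> 0 = pr x (f x))" by (intro dintro)
qed

lemma fn_mk:
  assumes "dterm E (\<lambda>\<rho>. f (\<rho> 0))"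
  shows "fn (mk m f) m"
  unfolding fn_def mem_mk[OF assms] by auto

lemma ap_mk:
  assumes "dterm E (\<lambda>\<rho>. f (\<rho> 0))" "E x m"
  shows "ap (mk m f) x = f x"
  using fn_mem_iff[OF fn_mk[OF assms(1)] assms(2), of "f x"] mem_mk[OF assms(1)] assms(2) by auto

lemma fn_eqI:
  assumes "fn s m" "fn t m" "\<And>x. E x m \<Longrightarrow> ap s x = ap t x"
  shows "s = t"
  by (rule set_eqI) (auto simp: fn_mem[OF assms(1)] fn_mem[OF assms(2)] assms(3))

lemma tree_le_fn_iff:
  assumes "fn s m" "fn t k"
  shows "tree_le E s t \<longleftrightarrow> (\<forall>x. E x m \<longrightarrow> E x k \<and> ap s x = ap t x)"
  unfolding tree_le_def fn_mem[OF assms(1)] fn_mem[OF assms(2)] by auto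

lemma is_seq_iff: "is_seq E s m n \<longleftrightarrow> fn s m \<and> (\<forall>x. E x m \<longrightarrow> E (ap s x) n)"
proof
  assume s: "is_seq E s m n"
  then have f: "fn s m" unfolding is_seq_def is_pair_iff fn_def by blast
  moreover have "E (ap s x) n" if "E x m" for x
  proof -
    have "E (pr x (ap s x)) s" using fn_mem_iff[OF f that] by simp
    then obtain x' y where "pr x (ap s x) = pr x' y" "E y n"
      using s unfolding is_seq_def is_pair_iff by blast
    then show ?thesis by auto
  qed
  ultimately show "fn s m \<and> (\<forall>x. E x m \<longrightarrow> E (ap s x) n)" by blast
next
  assume "fn s m \<and> (\<forall>x. E x m \<longrightarrow> E (ap s x) n)"
  then show "is_seq E s m n" unfolding is_seq_def is_pair_iff
    by (auto simp: fn_mem)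
qed

section \<open>The natural numbers of the model\<close>

lemma is_inductive_iff: "is_inductive E v \<longleftrightarrow> E zero v \<and> (\<forall>x. E x v \<longrightarrow> E (sc x) v)"
  unfolding is_inductive_def is_empty_iff is_succ_iff by simp

definition om :: 'a where
  "om = Coll (\<lambda>x. \<forall>v. E zero v \<and> (\<forall>x. E x v \<longrightarrow> E (sc x) v) \<longrightarrow> E x v)"

abbreviation N :: "'a \<Rightarrow> bool" where "N x \<equiv> E x om"

lemma N_iff: "N x \<longleftrightarrow> (\<forall>v. E zero v \<and> (\<forall>x. E x v \<longrightarrow> E (sc x) v) \<longrightarrow> E x v)"
  unfolding om_def
proof (rule mem_Coll)
  obtain w where "is_inductive E w" using infinity by blast
  then show "\<exists>b. \<forall>x. (\<forall>v. E zero v \<and> (\<forall>x. E x v \<longrightarrow> E (sc x) v) \<longrightarrow> E x v) \<longrightarrow> E x b"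
    unfolding is_inductive_iff by blast
qed (intro dintro)

lemma N_zero [simp]: "N zero" unfolding N_iff by blast

lemma N_sc [simp]: "N x \<Longrightarrow> N (sc x)" unfolding N_iff by blast

text \<open>Separation turns a definable predicate into an inductive subset of \<open>om\<close>. In
  a nonstandard \<open>om\<close> induction fails for external predicates such as being standard,
  whence the definability goal in every induction.\<close>

lemma om_induct [consumes 1, case_names dpred zero sc]:
  assumes "N n" "dpred E (\<lambda>\<rho>. P (\<rho> 0))" "P zero" "\<And>x. N x \<Longrightarrow> P x \<Longrightarrow> P (sc x)"
  shows "P n"
proof -
  obtain b where b: "\<forall>z. E z b \<longleftrightarrow> N z \<and> P z" using separation[OF assms(2)] by blast
  have "E zero b \<and> (\<forall>x. E x b \<longrightarrow> E (sc x) b)" using b assms(3,4) by simp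
  then have "E n b" using assms(1)[unfolded N_iff] by blast
  with b show ?thesis by blast
qed

lemma is_omega_iff: "is_omega E w \<longleftrightarrow> w = om"
proof
  assume w: "is_omega E w"
  show "w = om"
  proof (rule set_eqI)
    show "E z w \<longleftrightarrow> N z" for z
      using w unfolding is_omega_def is_inductive_iff N_iff by blast
  qed
next
  assume "w = om"
  then show "is_omega E w" unfolding is_omega_def is_inductive_iff using N_iff by auto
qed

lemma mem_irrefl [simp]: "\<not> E x x"
proof
  assume "E x x"
  moreover have "E x (upair x x)" by simp
  from foundation[OF this] have "\<not> (\<exists>z. E z x \<and> z = x)" by auto
  ultimately show False by blast
qed

lemma N_trans: "N n \<Longrightarrow> E x n \<Longrightarrow> N x"
  by (induction n rule: om_induct) (intro dintro, auto)

lemma lt_trans: "N n \<Longrightarrow> E x y \<Longrightarrow> E y n \<Longrightarrow> E x n"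
proof (induction n rule: om_induct)
  case dpred
  show ?case by (intro dintro)
qed auto

lemma zero_cases: "N n \<Longrightarrow> n = zero \<or> E zero n"
proof (induction n rule: om_induct)
  case dpred
  show ?case by (intro dintro)
qed auto

lemma sc_mono: "N n \<Longrightarrow> E x n \<Longrightarrow> E (sc x) (sc n)"
proof (induction n rule: om_induct)
  case dpred
  show ?case by (intro dintro)
qed auto

section \<open>The order of the natural numbers\<close>

definition le :: "'a \<Rightarrow> 'a \<Rightarrow> bool" where "le x y \<longleftrightarrow> E x y \<or> x = y"

lemma dpred_le [dintro]: "dterm E t \<Longrightarrow> dterm E u \<Longrightarrow> dpred E (\<lambda>\<rho>. le (t \<rho>) (u \<rho>))"
  unfolding le_def by (intro dintro)

lemma lt_linear: "N n \<Longrightarrow> N m \<Longrightarrow> E m n \<or> m = n \<or> E n m"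
proof (induction n rule: om_induct)
  case dpred
  show ?case by (intro dintro)
next
  case zero
  then show ?case using zero_cases by blast
next
  case (sc n)
  then show ?case using sc_mono[of m n] by auto
qed

lemma le_refl [simp]: "le x x" by (simp add: le_def)
lemma lt_imp_le: "E x y \<Longrightarrow> le x y" by (simp add: le_def)
lemma le_iff_lt_sc: "le x y \<longleftrightarrow> E x (sc y)" by (simp add: le_def)
lemma N_le: "N n \<Longrightarrow> le x n \<Longrightarrow> N x" using N_trans[of n x] unfolding le_def by blast
lemma le_lt_trans: "N n \<Longrightarrow> le x y \<Longrightarrow> E y n \<Longrightarrow> E x n" using lt_trans[of n x y] unfolding le_def by blast
lemma lt_le_trans: "N n \<Longrightarrow> E x y \<Longrightarrow> le y n \<Longrightarrow> E x n" using lt_trans[of n x y] unfolding le_def by blast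
lemma le_trans: "N n \<Longrightarrow> le x y \<Longrightarrow> le y n \<Longrightarrow> le x n" using lt_trans[of n x y] unfolding le_def by blast
lemma not_lt: "N x \<Longrightarrow> N y \<Longrightarrow> \<not> E x y \<longleftrightarrow> le y x"
  using lt_linear[of x y] lt_trans[of x x y] unfolding le_def by auto
lemma not_le: "N x \<Longrightarrow> N y \<Longrightarrow> \<not> le x y \<longleftrightarrow> E y x"
  using not_lt[of y x] by blast
lemma le_antisym: "N x \<Longrightarrow> le x y \<Longrightarrow> le y x \<Longrightarrow> x = y"
  using lt_trans[of x x y] unfolding le_def by auto
lemma lt_asym: "N x \<Longrightarrow> E x y \<Longrightarrow> \<not> E y x" using lt_trans[of x x y] by auto
lemma sc_le_iff: "N x \<Longrightarrow> N y \<Longrightarrow> le (sc x) y \<longleftrightarrow> E x y"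
  using sc_mono[of y x] lt_trans[of y x "sc x"] by (auto simp: le_def)
lemma zero_le: "N n \<Longrightarrow> le zero n" using zero_cases by (auto simp: le_def)
lemma sc_eq_iff: "N x \<Longrightarrow> N y \<Longrightarrow> sc x = sc y \<longleftrightarrow> x = y"
  using sc_le_iff[of x "sc y"] sc_le_iff[of y "sc x"] by (metis le_antisym le_iff_lt_sc le_refl N_sc)
lemma zero_neq_sc [simp]: "zero \<noteq> sc x" using mem_sc[of x x] by (metis mem_zero)
lemma N_cases: "N n \<Longrightarrow> n = zero \<or> (\<exists>m. N m \<and> n = sc m)"
proof (induction n rule: om_induct)
  case dpred
  show ?case by (intro dintro)
qed auto

lemma N_least:
  assumes "dpred E (\<lambda>\<rho>. P (\<rho> 0))" "N n" "P n"
  shows "\<exists>x. N x \<and> P x \<and> (\<forall>y. E y x \<longrightarrow> \<not> P y)"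
proof -
  obtain b where b: "\<forall>z. E z b \<longleftrightarrow> N z \<and> P z" using separation[OF assms(1)] by blast
  then have "E n b" using assms by blast
  from foundation[OF this] b N_trans show ?thesis by blast
qed

text \<open>The form of overspill used below: when a bounded definable property holds on an external
  set of numbers, its greatest instance lies above the whole set.\<close>

lemma N_greatest:
  assumes "dpred E (\<lambda>\<rho>. P (\<rho> 0))" "N n" "\<And>x. N x \<Longrightarrow> P x \<Longrightarrow> le x n" "N x0" "P x0"
  shows "\<exists>x. N x \<and> P x \<and> (\<forall>y. N y \<longrightarrow> P y \<longrightarrow> le y x)"
proof -
  note [dintro] = dpred_subst1[OF assms(1)]
  have "(\<forall>x. N x \<longrightarrow> P x \<longrightarrow> le x n) \<longrightarrow> ?thesis" using assms(2)
  proof (induction n rule: om_induct)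
    case dpred
    show ?case by (intro dintro)
  next
    case zero
    then show ?case using assms(4,5) le_antisym[OF _ _ zero_le] by blast
  next
    case (sc n)
    then show ?case by (metis le_def mem_sc)
  qed
  with assms(3) show ?thesis by blast
qed

section \<open>Recursion and arithmetic\<close>

text \<open>Approximations up to \<open>i\<close> are sets, so recursion becomes definable by
  quantifying over them. The parameter \<open>p\<close> is an explicit argument to make the
  resulting function definable in \<open>p\<close> too.\<close>

definition rc_graph :: "('a \<Rightarrow> 'a) \<Rightarrow> ('a \<Rightarrow> 'a \<Rightarrow> 'a \<Rightarrow> 'a) \<Rightarrow> 'a \<Rightarrow> 'a \<Rightarrow> 'a \<Rightarrow> bool" where
  "rc_graph z H p i g \<longleftrightarrow> fn g (sc i) \<and> ap g zero = z p \<and>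
     (\<forall>j. E j i \<longrightarrow> ap g (sc j) = H p j (ap g j))"

definition rc :: "('a \<Rightarrow> 'a) \<Rightarrow> ('a \<Rightarrow> 'a \<Rightarrow> 'a \<Rightarrow> 'a) \<Rightarrow> 'a \<Rightarrow> 'a \<Rightarrow> 'a" where
  "rc z H p i = the1 zero (\<lambda>y. \<exists>g. rc_graph z H p i g \<and> y = ap g i)"

lemma dterm_rc [dintro]:
  assumes "dterm E (\<lambda>\<rho>. z (\<rho> 0))" "dterm E (\<lambda>\<rho>. H (\<rho> 0) (\<rho> 1) (\<rho> 2))" "dterm E t" "dterm E u"
  shows "dterm E (\<lambda>\<rho>. rc z H (t \<rho>) (u \<rho>))"
proof (rule dterm_subst2[OF _ assms(3,4)])
  note [dintro] = dterm_subst1[OF assms(1)] dterm_subst3[OF assms(2)]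
  show "dterm E (\<lambda>\<rho>. rc z H (\<rho> 0) (\<rho> 1))"
    unfolding rc_def rc_graph_def by (intro dintro)
qed

context
  fixes z :: "'a \<Rightarrow> 'a" and H :: "'a \<Rightarrow> 'a \<Rightarrow> 'a \<Rightarrow> 'a"
  assumes z: "dterm E (\<lambda>\<rho>. z (\<rho> 0))" and H: "dterm E (\<lambda>\<rho>. H (\<rho> 0) (\<rho> 1) (\<rho> 2))"
begin

lemma zH: "dterm E t \<Longrightarrow> dterm E (\<lambda>\<rho>. z (t \<rho>))"
  "dterm E t \<Longrightarrow> dterm E u \<Longrightarrow> dterm E v \<Longrightarrow> dterm E (\<lambda>\<rho>. H (t \<rho>) (u \<rho>) (v \<rho>))"
  using dterm_subst1[OF z] dterm_subst3[OF H] by blast+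

lemma rc_graph_unique:
  assumes "rc_graph z H p i g" "rc_graph z H p i' g'" "N i" "N i'"
  shows "N j \<Longrightarrow> le j i \<Longrightarrow> le j i' \<Longrightarrow> ap g j = ap g' j"
proof (induction j rule: om_induct)
  case dpred
  show ?case by (intro dintro zH)
next
  case zero
  then show ?case using assms(1,2) by (simp add: rc_graph_def)
next
  case (sc j)
  then have "E j i" "E j i'" using assms(3,4) by (simp_all add: sc_le_iff)
  then show ?case using sc assms(1,2) by (auto simp: rc_graph_def lt_imp_le)
qed

lemma rc_graph_exists: "N i \<Longrightarrow> \<exists>g. rc_graph z H p i g"
proof (induction i rule: om_induct)
  case dpred
  show ?case unfolding rc_graph_def by (intro dintro zH)
next
  case zero
  have d: "dterm E (\<lambda>\<rho>. z p)" by (intro dintro zH)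
  have "rc_graph z H p zero (mk (sc zero) (\<lambda>_. z p))"
    unfolding rc_graph_def using fn_mk[OF d] ap_mk[OF d] by simp
  then show ?case by blast
next
  case (sc i)
  then obtain g where g: "rc_graph z H p i g" by blast
  let ?f = "\<lambda>x. if x = sc i then H p i (ap g i) else ap g x"
  have d: "dterm E (\<lambda>\<rho>. ?f (\<rho> 0))" by (intro dintro zH)
  have ne: "sc j \<noteq> sc i" "j \<noteq> sc i" if "E j i" for j
    using that sc(1) N_trans[of i j] lt_asym[of i j] by (auto simp: sc_eq_iff)
  have ni: "i \<noteq> sc i" by (metis mem_sc mem_irrefl)
  have "rc_graph z H p (sc i) (mk (sc (sc i)) ?f)"
    unfolding rc_graph_def using g fn_mk[OF d] ap_mk[OF d] sc(1) ne ni
      sc_mono[of i] sc_mono[of "sc i"] zero_le[of "sc i"] zero_cases[of i]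
    by (auto simp: rc_graph_def)
  then show ?case by blast
qed

lemma rc_eq: "N i \<Longrightarrow> rc_graph z H p i g \<Longrightarrow> rc z H p i = ap g i"
  unfolding rc_def by (rule the1_eq) (auto intro: rc_graph_unique)

lemma rc_zero: "rc z H p zero = z p"
  using rc_graph_exists[of zero p] rc_eq[of zero p] by (auto simp: rc_graph_def)

lemma rc_sc: assumes "N i" shows "rc z H p (sc i) = H p i (rc z H p i)"
proof -
  obtain g where g: "rc_graph z H p (sc i) g" using rc_graph_exists assms by fastforce
  obtain g' where g': "rc_graph z H p i g'" using rc_graph_exists assms by blast
  have "ap g i = ap g' i" by (rule rc_graph_unique[OF g g']) (use assms in \<open>auto simp: le_def\<close>)
  then show ?thesis using rc_eq[OF _ g] rc_eq[OF _ g'] g assms by (simp add: rc_graph_def)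
qed

end

section \<open>Addition and multiplication\<close>

definition add :: "'a \<Rightarrow> 'a \<Rightarrow> 'a" where "add = rc (\<lambda>p. p) (\<lambda>p j v. sc v)"
definition mul :: "'a \<Rightarrow> 'a \<Rightarrow> 'a" where "mul = rc (\<lambda>p. zero) (\<lambda>p j v. add v p)"

lemma dterm_add [dintro]: "dterm E t \<Longrightarrow> dterm E u \<Longrightarrow> dterm E (\<lambda>\<rho>. add (t \<rho>) (u \<rho>))"
  unfolding add_def by (intro dintro)

lemma dterm_mul [dintro]: "dterm E t \<Longrightarrow> dterm E u \<Longrightarrow> dterm E (\<lambda>\<rho>. mul (t \<rho>) (u \<rho>))"
  unfolding mul_def by (intro dintro)

lemma add_zero [simp]: "add p zero = p"
  unfolding add_def by (rule rc_zero) (intro dintro)+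

lemma add_sc [simp]: "N i \<Longrightarrow> add p (sc i) = sc (add p i)"
  unfolding add_def by (rule rc_sc) (intro dintro)+

lemma mul_zero [simp]: "mul p zero = zero"
  unfolding mul_def by (rule rc_zero) (intro dintro)+

lemma mul_sc [simp]: "N i \<Longrightarrow> mul p (sc i) = add (mul p i) p"
  unfolding mul_def by (rule rc_sc) (intro dintro)+

lemma N_add: "N i \<Longrightarrow> N p \<Longrightarrow> N (add p i)"
  by (induction i rule: om_induct) (intro dintro, auto)

lemma N_mul: "N i \<Longrightarrow> N p \<Longrightarrow> N (mul p i)"
  by (induction i rule: om_induct) (intro dintro, auto simp: N_add)

lemma add_less: "N i \<Longrightarrow> N p \<Longrightarrow> E j i \<Longrightarrow> E (add p j) (add p i)"
proof (induction i rule: om_induct)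
  case dpred
  show ?case by (intro dintro)
qed auto

lemma le_add: "N i \<Longrightarrow> N p \<Longrightarrow> le p (add p i)"
  using add_less[of i p zero] zero_cases[of i] by (auto simp: le_def)

lemma mul_less: "N i \<Longrightarrow> N p \<Longrightarrow> E j i \<Longrightarrow> le (add (mul p j) p) (mul p i)"
proof (induction i rule: om_induct)
  case dpred
  show ?case by (intro dintro)
next
  case (sc i)
  then show ?case using le_trans[OF _ _ le_add[of p "mul p i"]] by (auto simp: N_add N_mul)
qed auto

text \<open>Passing from \<open>y\<close> to its successor already gains \<open>p\<close>, more than
  the digit \<open>d\<close> can contribute: the leading part decides.\<close>

lemma digit_less:
  assumes "N p" "N y'" "N d'" "E y y'" "E d p"
  shows "E (add (mul p y) d) (add (mul p y') d')"
proof -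
  have N: "N y" "N (mul p y')" "N (mul p y)" using assms N_trans N_mul by blast+
  have "E (add (mul p y) d) (add (mul p y) p)" by (rule add_less) (use assms N in auto)
  then have "E (add (mul p y) d) (mul p y')"
    using mul_less[of y' p y] assms N lt_le_trans by blast
  then show ?thesis using le_add[of d' "mul p y'"] assms N lt_le_trans N_add by blast
qed

section \<open>Sequences and their lexicographic codes\<close>

definition len :: "'a \<Rightarrow> 'a" where "len s = the1 zero (fn s)"

lemma dterm_len [dintro]: "dterm E t \<Longrightarrow> dterm E (\<lambda>\<rho>. len (t \<rho>))"
proof (rule dterm_subst1[of E len])
  have "dterm E (\<lambda>\<rho>. the1 zero (\<lambda>m. fn (\<rho> 0) m))" by (intro dintro)
  then show "dterm E (\<lambda>\<rho>. len (\<rho> 0))" by (simp add: len_def)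
qed

lemma len_eq: assumes "fn s m" shows "len s = m"
proof -
  have "m' = m" if "fn s m'" for m'
  proof (rule set_eqI)
    show "E x m' \<longleftrightarrow> E x m" for x
      using fn_mem[OF that, of "pr x (ap s x)"] fn_mem[OF assms, of "pr x (ap s x)"] by auto
  qed
  with assms show ?thesis unfolding len_def by (rule the1_eq)
qed

lemma len_mk [simp]: "dterm E (\<lambda>\<rho>. f (\<rho> 0)) \<Longrightarrow> len (mk m f) = m"
  by (rule len_eq) (rule fn_mk)

text \<open>The condition on entries is left open because two levels occur: entries are numbers
  below \<open>n\<close> in the trees themselves, and nodes of such a tree in the asymmetric
  case.\<close>

definition sq :: "('a \<Rightarrow> bool) \<Rightarrow> 'a \<Rightarrow> 'a \<Rightarrow> bool" where
  "sq A n s \<longleftrightarrow> fn s (len s) \<and> E (len s) n \<and> (\<forall>x. E x (len s) \<longrightarrow> A (ap s x))"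

lemma dpred_sq [dintro]:
  assumes "dpred E (\<lambda>\<rho>. A (\<rho> 0) (\<lambda>i. \<rho> (Suc i)))" "dterm E t" "dterm E u"
  shows "dpred E (\<lambda>\<rho>. sq (\<lambda>y. A y \<rho>) (t \<rho>) (u \<rho>))"
proof -
  have all: "dpred E (\<lambda>\<rho>. \<forall>x. E x (len (u \<rho>)) \<longrightarrow> A (ap (u \<rho>) x) \<rho>)"
  proof (rule dpred_all, rule dpred_imp)
    show "dpred E (\<lambda>\<rho>. A (ap (u (\<lambda>i. \<rho> (Suc i))) (\<rho> 0)) (\<lambda>i. \<rho> (Suc i)))"
      using dpred_subst[OF assms(1), of "\<lambda>j. case j of 0 \<Rightarrow> \<lambda>\<rho>. ap (u (\<lambda>i. \<rho> (Suc i))) (\<rho> 0) | Suc j \<Rightarrow> \<lambda>\<rho>. \<rho> (Suc j)"]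
        dterm_ap[OF dterm_Suc[OF assms(3)] dterm_var(1)]
      by (simp add: dterm_var split: nat.split)
  qed (intro dintro dterm_Suc[OF assms(3)])
  then show ?thesis
    unfolding sq_def by (intro dpred_conj[OF _ dpred_conj[OF _ all]]) (intro dintro assms)+
qed

lemma tree_node_iff: "tree_node E n = sq (\<lambda>y. E y n) n"
  unfolding tree_node_def is_seq_iff sq_def fun_eq_iff by (metis len_eq)

lemma tree_le_iff:
  assumes "fn s (len s)" "fn t (len t)"
  shows "tree_le E s t \<longleftrightarrow> (\<forall>x. E x (len s) \<longrightarrow> E x (len t) \<and> ap s x = ap t x)"
  by (rule tree_le_fn_iff[OF assms])

lemma tree_le_len:
  assumes "fn s (len s)" "fn t (len t)" "N (len s)" "N (len t)" "tree_le E s t"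
  shows "le (len s) (len t)"
proof (rule ccontr)
  assume "\<not> le (len s) (len t)"
  then have "E (len t) (len s)" using assms by (simp add: not_le)
  then have "E (len t) (len t)" using assms tree_le_iff by blast
  then show False by simp
qed

lemma tree_less_len:
  assumes "fn s (len s)" "fn t (len t)" "N (len s)" "N (len t)" "tree_less E s t"
  shows "E (len s) (len t)"
proof -
  have "len s \<noteq> len t"
  proof
    assume eq: "len s = len t"
    have "s = t" by (rule fn_eqI[of _ "len s"]) (use assms eq tree_le_iff in \<open>auto simp: tree_less_def\<close>)
    then show False using assms by (simp add: tree_less_def)
  qed
  then show ?thesis using tree_le_len[OF assms(1-4)] assms(5) by (simp add: tree_less_def le_def)
qed

section \<open>Lexicographic codes\<close>

lemma sc_neq_zero [simp]: "sc x \<noteq> zero" using zero_neq_sc by metis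

text \<open>Entries are shifted by one so that the digit zero can mark the end of \<open>s\<close>;
  a proper initial segment then has the smaller code.\<close>

definition dg :: "'a \<Rightarrow> 'a \<Rightarrow> 'a" where
  "dg s i = (if E i (len s) then sc (ap s i) else zero)"

text \<open>Horner's scheme with the most significant digit first, which makes the numerical order
  the lexicographic one.\<close>

definition cd :: "'a \<Rightarrow> 'a \<Rightarrow> 'a \<Rightarrow> 'a" where
  "cd b = rc (\<lambda>s. zero) (\<lambda>s i v. add (mul b v) (dg s i))"

text \<open>Base \<open>n + 2\<close> leaves room for the entry \<open>n\<close>, which bounds all extensions of a sequence from
  above.\<close>
definition code :: "'a \<Rightarrow> 'a \<Rightarrow> 'a" where "code n s = cd (sc (sc n)) s n"

definition codable :: "'a \<Rightarrow> 'a \<Rightarrow> bool" where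
  "codable n s \<longleftrightarrow> fn s (len s) \<and> le (len s) n \<and> (\<forall>i. E i (len s) \<longrightarrow> le (ap s i) n)"

lemma dterm_dg [dintro]: "dterm E t \<Longrightarrow> dterm E u \<Longrightarrow> dterm E (\<lambda>\<rho>. dg (t \<rho>) (u \<rho>))"
  unfolding dg_def by (intro dintro)

lemma dterm_cd [dintro]: "dterm E t \<Longrightarrow> dterm E u \<Longrightarrow> dterm E (\<lambda>\<rho>. cd b (t \<rho>) (u \<rho>))"
  unfolding cd_def by (intro dintro)

lemma dterm_code [dintro]: "dterm E t \<Longrightarrow> dterm E (\<lambda>\<rho>. code n (t \<rho>))"
  unfolding code_def by (intro dintro)

lemma cd_zero [simp]: "cd b s zero = zero"
  unfolding cd_def by (rule rc_zero) (intro dintro)+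

lemma cd_sc [simp]: "N i \<Longrightarrow> cd b s (sc i) = add (mul b (cd b s i)) (dg s i)"
  unfolding cd_def by (rule rc_sc) (intro dintro)+

lemma dg_less: "N n \<Longrightarrow> codable n s \<Longrightarrow> E (dg s i) (sc (sc n))"
  unfolding dg_def codable_def using sc_mono[of "sc n" "ap s i"] zero_cases[of n]
  by (auto simp: le_def)

lemma N_dg: "N n \<Longrightarrow> codable n s \<Longrightarrow> N (dg s i)"
  using dg_less[of n s i] N_trans[of "sc (sc n)" "dg s i"] by (simp del: mem_sc)

lemma N_cd: "N i \<Longrightarrow> N n \<Longrightarrow> codable n s \<Longrightarrow> N (cd (sc (sc n)) s i)"
  by (induction i rule: om_induct) (intro dintro, auto simp: N_dg N_add N_mul)

lemma cd_cong: "N k \<Longrightarrow> \<forall>j. E j k \<longrightarrow> dg s j = dg t j \<Longrightarrow> cd b s k = cd b t k"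
proof (induction k rule: om_induct)
  case dpred
  show ?case by (intro dintro)
qed auto

text \<open>All digits are below the base, so later digits cannot undo the first difference.\<close>

lemma cd_less:
  assumes "N n" "codable n s" "codable n t" "N i" "E (dg s i) (dg t i)"
    and eq: "\<forall>j. E j i \<longrightarrow> dg s j = dg t j"
  shows "N k \<Longrightarrow> E i k \<Longrightarrow> E (cd (sc (sc n)) s k) (cd (sc (sc n)) t k)"
proof (induction k rule: om_induct)
  case dpred
  show ?case by (intro dintro)
next
  case (sc k)
  have "N (mul (sc (sc n)) (cd (sc (sc n)) s k))" using assms sc by (simp add: N_mul N_cd)
  show ?case
  proof (cases "i = k")
    case True
    have "cd (sc (sc n)) s k = cd (sc (sc n)) t k" using cd_cong[OF sc(1)] eq True by blast
    then show ?thesis using sc assms True by (simp add: add_less N_mul N_cd N_dg)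
  next
    case False
    then show ?thesis using sc assms by (simp add: N_cd N_dg digit_less[OF _ _ _ _ dg_less])
  qed
qed auto

lemma code_less:
  assumes "N n" "codable n s" "codable n t" "E i n" "E (dg s i) (dg t i)"
    "\<And>j. E j i \<Longrightarrow> dg s j = dg t j"
  shows "E (code n s) (code n t)"
  unfolding code_def using cd_less[of n s t i n] assms N_trans by blast

lemma N_code: "N n \<Longrightarrow> codable n s \<Longrightarrow> N (code n s)"
  unfolding code_def by (rule N_cd)

lemma dg_first_difference:
  assumes "N n" "codable n s" "codable n t" "E i n" "dg s i \<noteq> dg t i"
  obtains j where "le j i" "E (dg s j) (dg t j) \<or> E (dg t j) (dg s j)" "\<And>k. E k j \<Longrightarrow> dg s k = dg t k"
proof -
  have "dpred E (\<lambda>\<rho>. dg s (\<rho> 0) \<noteq> dg t (\<rho> 0))" by (intro dintro)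
  from N_least[OF this, of i] assms N_trans
  obtain j where j: "N j" "dg s j \<noteq> dg t j" "\<And>k. E k j \<Longrightarrow> dg s k = dg t k" by blast
  moreover have "le j i" using not_lt[of i j] j assms N_trans by blast
  moreover have "E (dg s j) (dg t j) \<or> E (dg t j) (dg s j)"
    using j(2) lt_linear[of "dg s j" "dg t j"] assms N_dg by metis
  ultimately show ?thesis using that by blast
qed

lemma code_inj:
  assumes "N n" "codable n s" "codable n t" "code n s = code n t"
  shows "s = t"
proof -
  have dg: "dg s i = dg t i" if "E i n" for i
  proof (rule ccontr)
    assume "dg s i \<noteq> dg t i"
    from dg_first_difference[OF assms(1-3) that this]
    obtain j where j: "le j i" "E (dg s j) (dg t j) \<or> E (dg t j) (dg s j)" "\<And>k. E k j \<Longrightarrow> dg s k = dg t k"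
      by metis
    have "E j n" using le_lt_trans[OF assms(1) j(1) that] .
    with j code_less[OF assms(1-3), of j] code_less[OF assms(1,3,2), of j] assms(4) show False by auto
  qed
  have n: "E i n" if "E i (len u)" "codable n u" for i u
    using lt_le_trans[OF assms(1)] that unfolding codable_def by blast
  have eq: "len s = len t"
  proof (rule set_eqI)
    show "E i (len s) \<longleftrightarrow> E i (len t)" for i
      using dg[of i] n[of i] assms(2,3) by (auto simp: dg_def split: if_splits)
  qed
  show ?thesis
  proof (rule fn_eqI)
    show "fn s (len s)" "fn t (len s)" using assms(2,3) eq by (simp_all add: codable_def)
    fix x assume x: "E x (len s)"
    then have "sc (ap s x) = sc (ap t x)" using dg[of x] n[of x s] assms eq by (simp add: dg_def)
    moreover have "N (ap s x)" "N (ap t x)" using x assms eq N_le unfolding codable_def by auto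
    ultimately show "ap s x = ap t x" by (simp add: sc_eq_iff)
  qed
qed

text \<open>A code has \<open>n\<close> digits in base \<open>n + 2\<close>. The bound is what makes
  sequences of codes nodes of a tree of the same kind over a larger number.\<close>

lemma code_bounded:
  assumes "N n" shows "\<exists>K. N K \<and> (\<forall>s. codable n s \<longrightarrow> E (code n s) K)"
proof -
  \<comment> \<open>\<open>pw i\<close> is the power \<open>(n + 2)^i\<close>; the recursion
    parameter is a dummy.\<close>
  define pw where "pw = rc (\<lambda>_. sc zero) (\<lambda>_ _ v. mul (sc (sc n)) v) zero"
  have pw0: "pw zero = sc zero" unfolding pw_def by (rule rc_zero) (intro dintro)+
  have pws: "pw (sc i) = mul (sc (sc n)) (pw i)" if "N i" for i
    unfolding pw_def by (rule rc_sc) ((intro dintro)+, fact that)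
  have d: "dterm E t \<Longrightarrow> dterm E (\<lambda>\<rho>. pw (t \<rho>))" for t unfolding pw_def by (intro dintro)
  have N_pw: "N (pw i)" if "N i" for i using that
    by (induction i rule: om_induct) (intro dintro d, simp_all add: pw0 pws N_mul assms)
  have "E (cd (sc (sc n)) s i) (pw i)" if s: "codable n s" and i: "N i" for s i using i
  proof (induction i rule: om_induct)
    case dpred
    show ?case by (intro dintro d)
  next
    case zero
    then show ?case by (simp add: pw0)
  next
    case (sc i)
    then have "E (add (mul (sc (sc n)) (cd (sc (sc n)) s i)) (dg s i)) (add (mul (sc (sc n)) (pw i)) zero)"
      by (intro digit_less dg_less) (simp_all add: assms s N_pw)
    then show ?case using sc by (simp add: pws)
  qed
  then show ?thesis unfolding code_def using N_pw assms by blast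
qed

lemma tree_node_codable: "N n \<Longrightarrow> tree_node E n s \<Longrightarrow> codable n s"
  by (simp add: tree_node_iff sq_def codable_def le_def)

section \<open>The cut determined by an unbounded chain\<close>

definition apd :: "'a \<Rightarrow> 'a \<Rightarrow> 'a" where
  "apd s v = mk (sc (len s)) (\<lambda>i. if i = len s then v else ap s i)"

lemma apd:
  shows fn_apd: "fn (apd s v) (sc (len s))" and len_apd [simp]: "len (apd s v) = sc (len s)"
    and ap_apd: "E i (sc (len s)) \<Longrightarrow> ap (apd s v) i = (if i = len s then v else ap s i)"
proof -
  have d: "dterm E (\<lambda>\<rho>. if \<rho> 0 = len s then v else ap s (\<rho> 0))" by (intro dintro)
  show "fn (apd s v) (sc (len s))" "len (apd s v) = sc (len s)"
    "E i (sc (len s)) \<Longrightarrow> ap (apd s v) i = (if i = len s then v else ap s i)"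
    unfolding apd_def using fn_mk[OF d] len_mk[OF d] ap_mk[OF d] by simp_all
qed

lemma codable_apd:
  assumes "N n" "tree_node E n s" shows "codable n (apd s n)"
proof -
  have "E (len s) n" using assms by (simp add: tree_node_iff sq_def)
  moreover from this have "le (sc (len s)) n" using assms N_trans by (simp add: sc_le_iff)
  ultimately show ?thesis using assms fn_apd[of s n]
    by (auto simp: codable_def ap_apd tree_node_iff sq_def lt_imp_le)
qed

text \<open>A number \<open>c\<close> filling the cut need not be a code. The greatest code of a
  node that is at most \<open>c\<close> still lies between the two sides, and a node with such a
  code agrees with every \<open>s \<alpha>\<close> on its whole length, so it would bound the
  chain.\<close>

lemma unbounded_chain_cut:
  assumes n: "N n" and r: "Card_order r" "infinite (Field r)" "regularCard r"
    and node: "\<And>\<alpha>. \<alpha> \<in> Field r \<Longrightarrow> tree_node E n (s \<alpha>)"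
    and less: "\<And>\<alpha> \<beta>. (\<alpha>, \<beta>) \<in> r \<Longrightarrow> \<alpha> \<noteq> \<beta> \<Longrightarrow> tree_less E (s \<alpha>) (s \<beta>)"
    and unbounded: "\<not> (\<exists>u. tree_node E n u \<and> (\<forall>\<alpha>\<in>Field r. tree_le E (s \<alpha>) u))"
  shows "is_cut E om r r (\<lambda>\<alpha>. code n (s \<alpha>)) (\<lambda>\<alpha>. code n (apd (s \<alpha>) n))"
proof -
  let ?x = "\<lambda>\<alpha>. code n (s \<alpha>)" and ?y = "\<lambda>\<alpha>. code n (apd (s \<alpha>) n)"
  have fn: "fn (s \<alpha>) (len (s \<alpha>))" and dn: "E (len (s \<alpha>)) n"
    and vn: "\<And>i. E i (len (s \<alpha>)) \<Longrightarrow> E (ap (s \<alpha>) i) n" if "\<alpha> \<in> Field r" for \<alpha>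
    using node[OF that] by (auto simp: tree_node_iff sq_def)
  have cx: "codable n (s \<alpha>)" and cy: "codable n (apd (s \<alpha>) n)" if "\<alpha> \<in> Field r" for \<alpha>
    using node[OF that] tree_node_codable codable_apd n by blast+
  have less': "E (len (s \<alpha>)) (len (s \<beta>))" "\<And>x. E x (len (s \<alpha>)) \<Longrightarrow> ap (s \<beta>) x = ap (s \<alpha>) x \<and> E x (len (s \<beta>))"
    if "(\<alpha>, \<beta>) \<in> r" "\<alpha> \<noteq> \<beta>" for \<alpha> \<beta>
  proof -
    have F: "\<alpha> \<in> Field r" "\<beta> \<in> Field r" using that by (auto simp: Field_def)
    show "E (len (s \<alpha>)) (len (s \<beta>))"
      using tree_less_len[OF fn[OF F(1)] fn[OF F(2)]] dn[OF F(1)] dn[OF F(2)] N_trans[OF n] less[OF that] by blast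
    show "ap (s \<beta>) x = ap (s \<alpha>) x \<and> E x (len (s \<beta>))" if "E x (len (s \<alpha>))" for x
      using tree_le_iff[OF fn[OF F(1)] fn[OF F(2)]] less[OF \<open>(\<alpha>, \<beta>) \<in> r\<close> \<open>\<alpha> \<noteq> \<beta>\<close>] that
      by (auto simp: tree_less_def)
  qed
  have irr: "x \<noteq> y" if "E x y" for x y using that by auto
  have xx: "E (?x \<alpha>) (?x \<beta>)" if ab: "(\<alpha>, \<beta>) \<in> r" "\<alpha> \<noteq> \<beta>" for \<alpha> \<beta>
  proof -
    have F: "\<alpha> \<in> Field r" "\<beta> \<in> Field r" using that by (auto simp: Field_def)
    show ?thesis
    proof (rule code_less[OF n cx[OF F(1)] cx[OF F(2)] dn[OF F(1)]])
      \<comment> \<open>At this position \<open>s \<alpha>\<close> has the end marker zero, while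
        the longer \<open>s \<beta>\<close> has a successor.\<close>
      show "E (dg (s \<alpha>) (len (s \<alpha>))) (dg (s \<beta>) (len (s \<alpha>)))"
        using less'(1)[OF ab] zero_cases[of "ap (s \<beta>) (len (s \<alpha>))"]
          vn[OF F(2) less'(1)[OF ab]] N_trans[OF n] by (auto simp: dg_def)
      show "dg (s \<alpha>) j = dg (s \<beta>) j" if "E j (len (s \<alpha>))" for j
        using less'(2)[OF ab that] that by (simp add: dg_def)
    qed
  qed
  have yy: "E (?y \<beta>) (?y \<alpha>)" if ab: "(\<alpha>, \<beta>) \<in> r" "\<alpha> \<noteq> \<beta>" for \<alpha> \<beta>
  proof -
    have F: "\<alpha> \<in> Field r" "\<beta> \<in> Field r" using that by (auto simp: Field_def)
    show ?thesis
    proof (rule code_less[OF n cy[OF F(2)] cy[OF F(1)] dn[OF F(1)]])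
      \<comment> \<open>The appended entry has the digit \<open>n + 1\<close>, and the entry of
        \<open>s \<beta>\<close> at this position, being less than \<open>n\<close>, a digit of at
        most \<open>n\<close>.\<close>
      show "E (dg (apd (s \<beta>) n) (len (s \<alpha>))) (dg (apd (s \<alpha>) n) (len (s \<alpha>)))"
        using less'(1)[OF ab] irr vn[OF F(2) less'(1)[OF ab]] sc_mono[OF n]
        by (auto simp: dg_def ap_apd)
      show "dg (apd (s \<beta>) n) j = dg (apd (s \<alpha>) n) j" if "E j (len (s \<alpha>))" for j
        using less'(2)[OF ab that] that irr[OF that] irr[of j "len (s \<beta>)"] by (simp add: dg_def ap_apd)
    qed
  qed
  have xy0: "E (?x \<alpha>) (?y \<alpha>)" if F: "\<alpha> \<in> Field r" for \<alpha>
  proof (rule code_less[OF n cx[OF F] cy[OF F] dn[OF F]])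
    show "E (dg (s \<alpha>) (len (s \<alpha>))) (dg (apd (s \<alpha>) n) (len (s \<alpha>)))"
      using zero_cases[OF n] by (auto simp: dg_def ap_apd)
    show "dg (s \<alpha>) j = dg (apd (s \<alpha>) n) j" if "E j (len (s \<alpha>))" for j
      using that irr[OF that] by (simp add: dg_def ap_apd)
  qed
  have Nx: "N (?x \<alpha>)" and Ny: "N (?y \<alpha>)" if "\<alpha> \<in> Field r" for \<alpha>
    using cx[OF that] cy[OF that] N_code n by blast+
  have wo: "(\<alpha>, \<beta>) \<in> r \<or> (\<beta>, \<alpha>) \<in> r" if "\<alpha> \<in> Field r" "\<beta> \<in> Field r" "\<alpha> \<noteq> \<beta>" for \<alpha> \<beta>
    using r(1) that unfolding card_order_on_def well_order_on_def linear_order_on_def total_on_def by blast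
  have xy: "E (?x \<alpha>) (?y \<beta>)" if F: "\<alpha> \<in> Field r" "\<beta> \<in> Field r" for \<alpha> \<beta>
  proof (cases "\<alpha> = \<beta>")
    case False
    with wo F consider "(\<alpha>, \<beta>) \<in> r" | "(\<beta>, \<alpha>) \<in> r" by blast
    then show ?thesis
    proof cases
      case 1
      then show ?thesis using lt_trans[OF Ny[OF F(2)] xx[OF 1 False] xy0[OF F(2)]] by blast
    next
      case 2
      then show ?thesis using lt_trans[OF Ny[OF F(2)] xy0[OF F(1)] yy[OF 2]] False by blast
    qed
  qed (use xy0 F in simp)
  have "False" if c: "N c" "\<And>\<alpha> \<beta>. \<alpha> \<in> Field r \<Longrightarrow> \<beta> \<in> Field r \<Longrightarrow> E (?x \<alpha>) c \<and> E c (?y \<beta>)" for c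
  proof -
    obtain \<alpha>0 where \<alpha>0: "\<alpha>0 \<in> Field r" using r(2) by fastforce
    have "dpred E (\<lambda>\<rho>. \<exists>u. tree_node E n u \<and> \<rho> 0 = code n u \<and> le (\<rho> 0) c)"
      unfolding tree_node_iff by (intro dintro)
    from N_greatest[OF this c(1), of "?x \<alpha>0"] c(2)[OF \<alpha>0 \<alpha>0] node[OF \<alpha>0] Nx[OF \<alpha>0] lt_imp_le
    obtain v where v: "\<exists>u. tree_node E n u \<and> v = code n u \<and> le v c"
      "\<And>y. N y \<Longrightarrow> \<exists>u. tree_node E n u \<and> y = code n u \<and> le y c \<Longrightarrow> le y v" by blast
    then obtain u where u: "tree_node E n u" "le (code n u) c" "v = code n u" by blast
    have u3: "le (code n u') (code n u)" if "tree_node E n u'" "N (code n u')" "le (code n u') c" for u'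
      using v(2)[OF that(2)] that u(3) by blast
    have cu: "codable n u" using u n tree_node_codable by blast
    have "tree_le E (s \<alpha>) u" if F: "\<alpha> \<in> Field r" for \<alpha>
    proof -
      have lo: "le (?x \<alpha>) (code n u)" using u3[OF node[OF F] Nx[OF F]] c(2)[OF F F] lt_imp_le by blast
      have hi: "E (code n u) (?y \<alpha>)" using le_lt_trans[OF Ny[OF F] u(2)] c(2)[OF F F] by blast
      have dg: "dg (s \<alpha>) i = dg u i" if i: "E i (len (s \<alpha>))" for i
      proof (rule ccontr)
        assume ne: "dg (s \<alpha>) i \<noteq> dg u i"
        have "E i n" using lt_trans[OF n i dn[OF F]] .
        from dg_first_difference[OF n cx[OF F] cu this ne]
        obtain j where j: "le j i" "E (dg (s \<alpha>) j) (dg u j) \<or> E (dg u j) (dg (s \<alpha>) j)"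
          "\<And>k. E k j \<Longrightarrow> dg (s \<alpha>) k = dg u k" by metis
        have jn: "E j n" using le_lt_trans[OF n j(1) \<open>E i n\<close>] .
        have jd: "E j (len (s \<alpha>))" using le_lt_trans[OF _ j(1) i] N_trans[OF n dn[OF F]] by blast
        have eq: "dg (apd (s \<alpha>) n) k = dg (s \<alpha>) k" if "le k j" for k
          using le_lt_trans[OF _ that jd] N_trans[OF n dn[OF F]] irr[of k "len (s \<alpha>)"] by (auto simp: dg_def ap_apd)
        \<comment> \<open>A first difference upwards puts \<open>u\<close> above all extensions of
          \<open>s \<alpha>\<close>, in particular above the upper code; a difference downwards puts
          it below the code of \<open>s \<alpha>\<close>.\<close>
        show False using j(2)
        proof
          assume "E (dg (s \<alpha>) j) (dg u j)"
          then have "E (?y \<alpha>) (code n u)"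
            by (intro code_less[OF n cy[OF F] cu jn]) (use j eq in \<open>auto simp: le_def\<close>)
          then show False using hi lt_asym[OF Ny[OF F]] by blast
        next
          assume "E (dg u j) (dg (s \<alpha>) j)"
          then have "E (code n u) (?x \<alpha>)"
            by (intro code_less[OF n cu cx[OF F] jn]) (use j in auto)
          then show False using lo not_lt[OF N_code[OF n cu] Nx[OF F]] by blast
        qed
      qed
      show ?thesis
      proof (subst tree_le_iff)
        show "fn (s \<alpha>) (len (s \<alpha>))" "fn u (len u)" using fn F u by (auto simp: tree_node_iff sq_def)
        show "\<forall>x. E x (len (s \<alpha>)) \<longrightarrow> E x (len u) \<and> ap (s \<alpha>) x = ap u x"
        proof (intro allI impI)
          fix x assume x: "E x (len (s \<alpha>))"
          have "sc (ap (s \<alpha>) x) = dg u x" using dg[OF x] x by (simp add: dg_def)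
          then have "E x (len u)" "sc (ap (s \<alpha>) x) = sc (ap u x)" by (auto simp: dg_def split: if_splits)
          moreover from this have "N (ap u x)" "N (ap (s \<alpha>) x)"
            using u vn[OF F x] N_trans[OF n] by (auto simp: tree_node_iff sq_def)
          ultimately show "E x (len u) \<and> ap (s \<alpha>) x = ap u x" by (simp add: sc_eq_iff)
        qed
      qed
    qed
    with u unbounded show False by blast
  qed
  then have "\<not> (\<exists>c. N c \<and> (\<forall>\<alpha>\<in>Field r. \<forall>\<beta>\<in>Field r. E (?x \<alpha>) c \<and> E c (?y \<beta>)))" by metis
  with r Nx Ny xx yy xy show ?thesis unfolding is_cut_def by (intro conjI) simp_all
qed

section \<open>Chains of sequences\<close>

lemma tree_le_refl: "tree_le E s s" by (simp add: tree_le_def)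
lemma tree_le_trans: "tree_le E s t \<Longrightarrow> tree_le E t u \<Longrightarrow> tree_le E s u" by (simp add: tree_le_def)
lemma tree_le_antisym: "tree_le E s t \<Longrightarrow> tree_le E t s \<Longrightarrow> s = t"
  by (rule set_eqI) (auto simp: tree_le_def)
lemma tree_less_trans: "tree_less E s t \<Longrightarrow> tree_less E t u \<Longrightarrow> tree_less E s u"
  unfolding tree_less_def using tree_le_trans tree_le_antisym by blast

lemma empty_node: "E z n \<Longrightarrow> N n \<Longrightarrow> tree_node E n (mk zero (\<lambda>i. i))"
  using fn_mk[OF dterm_var(1), of zero] len_mk[OF dterm_var(1), of zero] zero_cases[of n]
  by (auto simp: tree_node_iff sq_def)

text \<open>An unbounded chain is nonempty and has no greatest element, as required for extracting a
  regular cofinal sequence. A chain witnessing \<open>t_le\<close> may have singular length, whereas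
  cuts have regular sides.\<close>

lemma unbounded_chain_cofinal_sequence:
  fixes C :: "'a set"
  assumes n: "N n" "E z n" and node: "\<And>s. s \<in> C \<Longrightarrow> tree_node E n s"
    and chain: "\<And>s t. s \<in> C \<Longrightarrow> t \<in> C \<Longrightarrow> tree_le E s t \<or> tree_le E t s"
    and unbounded: "\<not> (\<exists>u. tree_node E n u \<and> (\<forall>s\<in>C. tree_le E s u))"
  shows "\<exists>(r :: 'a rel) f. Card_order r \<and> infinite (Field r) \<and> regularCard r \<and> r \<le>o |C| \<and>
    (\<forall>\<alpha>\<in>Field r. f \<alpha> \<in> C) \<and> (\<forall>\<alpha> \<beta>. (\<alpha>, \<beta>) \<in> r \<longrightarrow> \<alpha> \<noteq> \<beta> \<longrightarrow> tree_less E (f \<alpha>) (f \<beta>)) \<and>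
    (\<forall>x\<in>C. \<exists>\<alpha>\<in>Field r. tree_less E x (f \<alpha>))"
proof (rule regular_cofinal_sequence)
  show "C \<noteq> {}" using unbounded empty_node[OF n(2,1)] by blast
  show "s = t \<or> tree_less E s t \<or> tree_less E t s" if "s \<in> C" "t \<in> C" for s t
    using chain[OF that] by (auto simp: tree_less_def)
  show "\<exists>t\<in>C. tree_less E s t" if s: "s \<in> C" for s
  proof -
    obtain t where "t \<in> C" "\<not> tree_le E t s" using unbounded node s by blast
    then show ?thesis using chain[OF s] tree_le_refl by (auto simp: tree_less_def)
  qed
next
  show "tree_less E x z" if "tree_less E x y" "tree_less E y z" for x y z
    using that by (rule tree_less_trans)
qed (simp add: tree_less_def)

lemma t_le_imp_p_le:
  assumes \<mu>: "Card_order \<mu>" and t: "t_le E \<mu>" shows "p_le E \<mu>"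
proof -
  from t obtain n z \<kappa> s where n: "N n" "E z n" and s: "unbounded_branch_seq E n \<kappa> s" and \<kappa>: "\<kappa> \<le>o \<mu>"
    unfolding t_le_def is_omega_iff by blast
  have s: "Card_order \<kappa>" "\<forall>\<alpha>\<in>Field \<kappa>. tree_node E n (s \<alpha>)"
    "\<forall>\<alpha>\<in>Field \<kappa>. \<forall>\<alpha>'\<in>Field \<kappa>. (\<alpha>, \<alpha>') \<in> \<kappa> \<and> \<alpha> \<noteq> \<alpha>' \<longrightarrow> tree_less E (s \<alpha>) (s \<alpha>')"
    "\<not> (\<exists>u. tree_node E n u \<and> (\<forall>\<alpha>\<in>Field \<kappa>. tree_le E (s \<alpha>) u))"
    using s unfolding unbounded_branch_seq_def by simp_all
  let ?C = "s ` Field \<kappa>"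
  have chain: "tree_le E x y \<or> tree_le E y x" if xy: "x \<in> ?C" "y \<in> ?C" for x y
  proof -
    obtain \<alpha> \<beta> where ab: "\<alpha> \<in> Field \<kappa>" "x = s \<alpha>" "\<beta> \<in> Field \<kappa>" "y = s \<beta>" using xy by blast
    show ?thesis
    proof (cases "\<alpha> = \<beta>")
      case False
      with Card_order_linear[OF s(1) ab(1,3)] s(3) ab show ?thesis by (auto simp: tree_less_def)
    qed (simp add: ab tree_le_refl)
  qed
  have node: "tree_node E n x" if "x \<in> ?C" for x using s(2) that by blast
  have "\<not> (\<exists>u. tree_node E n u \<and> (\<forall>x\<in>?C. tree_le E x u))" using s(4) by blast
  from unbounded_chain_cofinal_sequence[OF n node chain this]
  obtain r :: "'a rel" and f where r: "Card_order r" "infinite (Field r)" "regularCard r" "r \<le>o |?C|"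
    and f: "\<forall>\<alpha>\<in>Field r. f \<alpha> \<in> ?C"
      "\<forall>\<alpha> \<beta>. (\<alpha>, \<beta>) \<in> r \<longrightarrow> \<alpha> \<noteq> \<beta> \<longrightarrow> tree_less E (f \<alpha>) (f \<beta>)"
      "\<forall>x\<in>?C. \<exists>\<alpha>\<in>Field r. tree_less E x (f \<alpha>)"
    by blast
  have "\<not> (\<exists>u. tree_node E n u \<and> (\<forall>\<alpha>\<in>Field r. tree_le E (f \<alpha>) u))"
  proof
    assume "\<exists>u. tree_node E n u \<and> (\<forall>\<alpha>\<in>Field r. tree_le E (f \<alpha>) u)"
    then obtain u where u: "tree_node E n u" "\<forall>\<alpha>\<in>Field r. tree_le E (f \<alpha>) u" by blast
    have "tree_le E (s \<alpha>) u" if "\<alpha> \<in> Field \<kappa>" for \<alpha>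
    proof -
      obtain \<beta> where "\<beta> \<in> Field r" "tree_less E (s \<alpha>) (f \<beta>)" using f(3) \<open>\<alpha> \<in> Field \<kappa>\<close> by blast
      then show ?thesis using u(2) tree_le_trans[of "s \<alpha>" "f \<beta>" u] by (simp add: tree_less_def)
    qed
    with s(4) u(1) show False by blast
  qed
  moreover have "tree_node E n (f \<alpha>)" if "\<alpha> \<in> Field r" for \<alpha> using f(1) node that by blast
  ultimately have cut: "is_cut E om r r (\<lambda>\<alpha>. code n (f \<alpha>)) (\<lambda>\<alpha>. code n (apd (f \<alpha>) n))"
    using f(2) by (intro unbounded_chain_cut[OF n(1) r(1-3)]) simp_all
  have "|?C| \<le>o \<kappa>"
    using card_of_image[of s "Field \<kappa>"] card_of_Field_ordIso[OF s(1)] ordLeq_ordIso_trans by blast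
  then have r\<mu>: "r \<le>o \<mu>" using r(4) \<kappa> ordLeq_transitive by blast
  \<comment> \<open>The infinite \<open>r\<close> below \<open>\<mu>\<close> makes
    \<open>\<mu>\<close> infinite, so the sum of the two equal sides is absorbed.\<close>
  then have "Cinfinite \<mu>"
    using r(2) \<mu> card_of_ordLeq_infinite[OF card_of_mono2[OF r\<mu>]] unfolding cinfinite_def by blast
  then have "r +c r \<le>o \<mu>" using csum_cinfinite_bound[OF r\<mu> r\<mu> r(1) r(1)] by blast
  with cut show ?thesis unfolding p_le_def is_omega_iff by blast
qed

text \<open>The usable form of the failure of \<open>t_le\<close>: chains are given as plain sets of
  nodes, and an unbounded one thinned to a cofinal increasing sequence would witness
  \<open>t_le E \<mu>\<close>.\<close>

lemma chain_bound:
  assumes nt: "\<not> t_le E \<mu>" and n: "N n" "E z n" and C: "|C| \<le>o \<mu>"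
    and node: "\<And>s. s \<in> C \<Longrightarrow> tree_node E n s"
    and chain: "\<And>s t. s \<in> C \<Longrightarrow> t \<in> C \<Longrightarrow> tree_le E s t \<or> tree_le E t s"
  shows "\<exists>u. tree_node E n u \<and> (\<forall>s\<in>C. tree_le E s u)"
proof (rule ccontr)
  assume un: "\<not> ?thesis"
  from unbounded_chain_cofinal_sequence[OF n node chain un]
  obtain r :: "'a rel" and f where r: "Card_order r" "r \<le>o |C|"
    and f: "\<forall>\<alpha>\<in>Field r. f \<alpha> \<in> C"
      "\<forall>\<alpha> \<beta>. (\<alpha>, \<beta>) \<in> r \<longrightarrow> \<alpha> \<noteq> \<beta> \<longrightarrow> tree_less E (f \<alpha>) (f \<beta>)"
      "\<forall>x\<in>C. \<exists>\<alpha>\<in>Field r. tree_less E x (f \<alpha>)"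
    by blast
  have "\<not> (\<exists>u. tree_node E n u \<and> (\<forall>\<alpha>\<in>Field r. tree_le E (f \<alpha>) u))"
  proof
    assume "\<exists>u. tree_node E n u \<and> (\<forall>\<alpha>\<in>Field r. tree_le E (f \<alpha>) u)"
    then obtain u where u: "tree_node E n u" "\<forall>\<alpha>\<in>Field r. tree_le E (f \<alpha>) u" by blast
    have "tree_le E s u" if "s \<in> C" for s
    proof -
      obtain \<beta> where "\<beta> \<in> Field r" "tree_less E s (f \<beta>)" using f(3) \<open>s \<in> C\<close> by blast
      then show ?thesis using u(2) tree_le_trans[of s "f \<beta>" u] by (simp add: tree_less_def)
    qed
    with un u(1) show False by blast
  qed
  with r f(1,2) node have "unbounded_branch_seq E n r f" unfolding unbounded_branch_seq_def by simp
  moreover have "r \<le>o \<mu>" using r(2) C ordLeq_transitive by blast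
  ultimately have "t_le E \<mu>" unfolding t_le_def is_omega_iff using n by blast
  with nt show False by blast
qed

text \<open>Replacing entries by their codes gives a chain of ordinary nodes. Beyond the lengths of
  the chain its bound may have entries that code nothing, so only the longest prefix consisting of
  codes is decoded.\<close>

lemma coded_chain_bound:
  assumes nt: "\<not> t_le E \<mu>" and n: "N n" "E z n" and C: "|C| \<le>o \<mu>"
    and node: "\<And>s. s \<in> C \<Longrightarrow> sq (tree_node E n) n s"
    and chain: "\<And>s t. s \<in> C \<Longrightarrow> t \<in> C \<Longrightarrow> tree_le E s t \<or> tree_le E t s"
  shows "\<exists>u. sq (tree_node E n) n u \<and> (\<forall>s\<in>C. tree_le E s u)"
proof -
  obtain K where K: "N K" "\<And>s. codable n s \<Longrightarrow> E (code n s) K" using code_bounded[OF n(1)] by blast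
  \<comment> \<open>The larger of \<open>n\<close> and \<open>K\<close>: lengths are below
    \<open>n\<close> and codes below \<open>K\<close>, and the tree uses one number for
    both.\<close>
  define M where "M = (if le n K then K else n)"
  have M: "N M" "le n M" "le K M"
    using n(1) K(1) not_le[of n K] by (auto simp: M_def lt_imp_le)
  have EM: "E z M" using lt_le_trans[OF M(1) n(2) M(2)] .
  define cs where "cs s = mk (len s) (\<lambda>i. code n (ap s i))" for s
  have d: "dterm E (\<lambda>\<rho>. code n (ap s (\<rho> 0)))" for s by (intro dintro)
  have cs: "fn (cs s) (len s)" "len (cs s) = len s" "E i (len s) \<Longrightarrow> ap (cs s) i = code n (ap s i)" for s i
    unfolding cs_def using fn_mk[OF d] len_mk[OF d] ap_mk[OF d] by simp_all
  have "\<exists>u. tree_node E M u \<and> (\<forall>s\<in>cs ` C. tree_le E s u)"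
  proof (rule chain_bound[OF nt M(1) EM])
    show "|cs ` C| \<le>o \<mu>" using card_of_image C ordLeq_transitive by blast
    show "tree_node E M s'" if s': "s' \<in> cs ` C" for s'
    proof -
      obtain s where s: "s \<in> C" "s' = cs s" using s' by blast
      have "E (len s) M" using node[OF s(1)] lt_le_trans[OF M(1) _ M(2)] by (simp add: sq_def)
      moreover have "E (code n (ap s i)) M" if i: "E i (len s)" for i
      proof -
        have "codable n (ap s i)" using node[OF s(1)] i tree_node_codable[OF n(1)] by (simp add: sq_def)
        then show ?thesis using K(2) lt_le_trans[OF M(1) _ M(3)] by blast
      qed
      ultimately show ?thesis using cs s by (simp add: tree_node_iff sq_def)
    qed
    fix s' t' assume "s' \<in> cs ` C" "t' \<in> cs ` C"
    then obtain s t where s: "s \<in> C" "s' = cs s" "t \<in> C" "t' = cs t" by blast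
    have "tree_le E (cs x) (cs y)" if "x \<in> C" "y \<in> C" "tree_le E x y" for x y
    proof -
      have "\<forall>i. E i (len x) \<longrightarrow> E i (len y) \<and> ap x i = ap y i"
        using that node tree_le_iff[of x y] by (simp add: sq_def)
      then show ?thesis using tree_le_iff[of "cs x" "cs y"] cs by simp
    qed
    then show "tree_le E s' t' \<or> tree_le E t' s'" using chain[OF s(1,3)] s by blast
  qed
  then obtain v where v: "tree_node E M v" "\<And>s. s \<in> C \<Longrightarrow> tree_le E (cs s) v" by blast
  have vfn: "fn v (len v)" using v(1) by (simp add: tree_node_iff sq_def)
  let ?P = "\<lambda>m. E m n \<and> (\<forall>i. E i m \<longrightarrow> E i (len v) \<and> (\<exists>x. tree_node E n x \<and> ap v i = code n x))"
  have dn: "dterm E t \<Longrightarrow> dpred E (\<lambda>\<rho>. tree_node E n (t \<rho>))" for t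
    unfolding tree_node_iff by (intro dintro)
  have "dpred E (\<lambda>\<rho>. ?P (\<rho> 0))" by (intro dintro dn)
  moreover have "?P zero" using n zero_cases[of n] by auto
  ultimately obtain m where m: "N m" "?P m" "\<And>y. N y \<Longrightarrow> ?P y \<Longrightarrow> le y m"
    using N_greatest[of ?P n zero] n(1) lt_imp_le N_zero by blast
  define u where "u = mk m (\<lambda>i. the1 zero (\<lambda>x. tree_node E n x \<and> ap v i = code n x))"
  have du: "dterm E (\<lambda>\<rho>. the1 zero (\<lambda>x. tree_node E n x \<and> ap v (\<rho> 0) = code n x))"
    by (intro dintro dn)
  have ap_u: "ap u i = x" if "E i m" "tree_node E n x" "ap v i = code n x" for i x
  proof -
    have "the1 zero (\<lambda>x. tree_node E n x \<and> ap v i = code n x) = x"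
      by (rule the1_eq) (use that code_inj[OF n(1)] tree_node_codable[OF n(1)] in auto)
    then show ?thesis unfolding u_def using ap_mk[OF du that(1)] by simp
  qed
  have u: "fn u m" "len u = m" unfolding u_def by (rule fn_mk[OF du], rule len_mk[OF du])
  have "sq (tree_node E n) n u"
    unfolding sq_def u(2) using u(1) m(2) ap_u by metis
  moreover have "tree_le E s u" if s: "s \<in> C" for s
  proof -
    have le: "\<forall>i. E i (len s) \<longrightarrow> E i (len v) \<and> code n (ap s i) = ap v i"
      using v(2)[OF s] tree_le_iff[of "cs s" v] cs vfn by simp
    have ns: "fn s (len s)" "E (len s) n" "\<And>i. E i (len s) \<Longrightarrow> tree_node E n (ap s i)"
      using node[OF s] by (auto simp: sq_def)
    have "?P (len s)" using le ns by metis
    then have lem: "le (len s) m" using m(3) N_trans[OF n(1) ns(2)] by blast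
    show ?thesis
    proof (subst tree_le_iff)
      show "fn s (len s)" "fn u (len u)" using ns u by auto
      show "\<forall>i. E i (len s) \<longrightarrow> E i (len u) \<and> ap s i = ap u i"
      proof (intro allI impI)
        fix i assume i: "E i (len s)"
        have "E i m" using lt_le_trans[OF m(1) i lem] .
        then show "E i (len u) \<and> ap s i = ap u i"
          using ap_u[of i "ap s i"] ns(3)[OF i] le i u(2) by auto
      qed
    qed
  qed
  ultimately show ?thesis by blast
qed

section \<open>Filling small pre-cuts\<close>

text \<open>Cuts with a side of size \<open>\<theta>\<close> remain possible, because the cut to be
  refuted has such a side.\<close>

definition no_cut_below :: "'a rel \<Rightarrow> bool" where
  "no_cut_below \<theta> \<longleftrightarrow> \<not> (\<exists>r r' a b. is_cut E om r r' a b \<and> r <o \<theta> \<and> r' <o \<theta>)"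

text \<open>A greatest element of \<open>X\<close> or a least element of \<open>Y\<close> fills the
  pre-cut. Otherwise regular sequences, cofinal in \<open>X\<close> and coinitial in
  \<open>Y\<close>, would form a cut with both sides below \<open>\<theta>\<close>.\<close>

lemma fill_pre_cut:
  fixes X Y :: "'a set"
  assumes nc: "no_cut_below \<theta>" and X: "|X| <o \<theta>" "X \<noteq> {}" "\<And>x. x \<in> X \<Longrightarrow> N x"
    and Y: "|Y| <o \<theta>" "Y \<noteq> {}" "\<And>y. y \<in> Y \<Longrightarrow> N y"
    and XY: "\<And>x y. x \<in> X \<Longrightarrow> y \<in> Y \<Longrightarrow> le x y"
  shows "\<exists>c. N c \<and> (\<forall>x\<in>X. le x c) \<and> (\<forall>y\<in>Y. le c y)"
proof (cases "(\<exists>x\<in>X. \<forall>x'\<in>X. le x' x) \<or> (\<exists>y\<in>Y. \<forall>y'\<in>Y. le y y')")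
  case True
  then show ?thesis
  proof
    assume "\<exists>x\<in>X. \<forall>x'\<in>X. le x' x"
    then obtain x where "x \<in> X" "\<forall>x'\<in>X. le x' x" by blast
    then show ?thesis using XY X(3) by (intro exI[of _ x]) simp
  next
    assume "\<exists>y\<in>Y. \<forall>y'\<in>Y. le y y'"
    then obtain y where "y \<in> Y" "\<forall>y'\<in>Y. le y y'" by blast
    then show ?thesis using XY Y(3) by (intro exI[of _ y]) simp
  qed
next
  case False
  have "\<exists>(r :: 'a rel) f. Card_order r \<and> infinite (Field r) \<and> regularCard r \<and> r \<le>o |X| \<and>
    (\<forall>\<alpha>\<in>Field r. f \<alpha> \<in> X) \<and> (\<forall>\<alpha> \<beta>. (\<alpha>, \<beta>) \<in> r \<longrightarrow> \<alpha> \<noteq> \<beta> \<longrightarrow> E (f \<alpha>) (f \<beta>)) \<and>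
    (\<forall>x\<in>X. \<exists>\<alpha>\<in>Field r. E x (f \<alpha>))"
  proof (rule regular_cofinal_sequence[where lt = E])
    show "x = y \<or> E x y \<or> E y x" if "x \<in> X" "y \<in> X" for x y using lt_linear[of y x] X(3) that by blast
    show "\<exists>y\<in>X. E x y" if x: "x \<in> X" for x
    proof -
      obtain y where "y \<in> X" "\<not> le y x" using False x by blast
      then show ?thesis using not_le[OF X(3) X(3)] x by blast
    qed
    show "E x z" if "z \<in> X" "E x y" "E y z" for x y z using lt_trans[OF X(3)] that by blast
  qed (use X(2) in simp_all)
  then obtain r :: "'a rel" and f where r: "Card_order r" "infinite (Field r)" "regularCard r" "r \<le>o |X|"
    and f: "\<forall>\<alpha>\<in>Field r. f \<alpha> \<in> X" "\<forall>\<alpha> \<beta>. (\<alpha>, \<beta>) \<in> r \<longrightarrow> \<alpha> \<noteq> \<beta> \<longrightarrow> E (f \<alpha>) (f \<beta>)"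
      "\<forall>x\<in>X. \<exists>\<alpha>\<in>Field r. E x (f \<alpha>)" by blast
  have "\<exists>(r :: 'a rel) f. Card_order r \<and> infinite (Field r) \<and> regularCard r \<and> r \<le>o |Y| \<and>
    (\<forall>\<alpha>\<in>Field r. f \<alpha> \<in> Y) \<and> (\<forall>\<alpha> \<beta>. (\<alpha>, \<beta>) \<in> r \<longrightarrow> \<alpha> \<noteq> \<beta> \<longrightarrow> E (f \<beta>) (f \<alpha>)) \<and>
    (\<forall>x\<in>Y. \<exists>\<alpha>\<in>Field r. E (f \<alpha>) x)"
  proof (rule regular_cofinal_sequence[where lt = "\<lambda>x y. E y x"])
    show "x = y \<or> E y x \<or> E x y" if "x \<in> Y" "y \<in> Y" for x y using lt_linear[of y x] Y(3) that by blast
    show "\<exists>y\<in>Y. E y x" if x: "x \<in> Y" for x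
    proof -
      obtain y where "y \<in> Y" "\<not> le x y" using False x by blast
      then show ?thesis using not_le[OF Y(3) Y(3)] x by blast
    qed
    show "E z x" if "x \<in> Y" "E y x" "E z y" for x y z using lt_trans[OF Y(3)] that by blast
  qed (use Y(2) in simp_all)
  then obtain r' :: "'a rel" and g where r': "Card_order r'" "infinite (Field r')" "regularCard r'" "r' \<le>o |Y|"
    and g: "\<forall>\<alpha>\<in>Field r'. g \<alpha> \<in> Y" "\<forall>\<alpha> \<beta>. (\<alpha>, \<beta>) \<in> r' \<longrightarrow> \<alpha> \<noteq> \<beta> \<longrightarrow> E (g \<beta>) (g \<alpha>)"
      "\<forall>x\<in>Y. \<exists>\<alpha>\<in>Field r'. E (g \<alpha>) x" by blast
  have "E (f \<alpha>) (g \<beta>)" if F: "\<alpha> \<in> Field r" "\<beta> \<in> Field r'" for \<alpha> \<beta>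
  proof -
    have XF: "f \<alpha> \<in> X" "g \<beta> \<in> Y" using f(1) g(1) F by simp_all
    then obtain \<alpha>' where \<alpha>': "\<alpha>' \<in> Field r" "E (f \<alpha>) (f \<alpha>')" using f(3) by blast
    have "le (f \<alpha>') (g \<beta>)" using XY[OF _ XF(2)] f(1) \<alpha>'(1) by blast
    then show ?thesis using lt_le_trans[OF Y(3)[OF XF(2)] \<alpha>'(2)] by blast
  qed
  moreover have "\<not> is_cut E om r r' f g"
    using nc ordLeq_ordLess_trans[OF r(4) X(1)] ordLeq_ordLess_trans[OF r'(4) Y(1)]
    unfolding no_cut_below_def by blast
  moreover have "\<forall>\<alpha>\<in>Field r. N (f \<alpha>)" "\<forall>\<alpha>\<in>Field r'. N (g \<alpha>)" using f(1) g(1) X(3) Y(3) by auto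
  ultimately have "\<exists>c. N c \<and> (\<forall>\<alpha>\<in>Field r. \<forall>\<beta>\<in>Field r'. E (f \<alpha>) c \<and> E c (g \<beta>))"
    using r(1-3) r'(1-3) f(2) g(2) unfolding is_cut_def by simp
  then obtain c where c: "N c" "\<forall>\<alpha>\<in>Field r. \<forall>\<beta>\<in>Field r'. E (f \<alpha>) c \<and> E c (g \<beta>)" by (elim exE conjE)
  note c = c(1) c(2)[rule_format]
  obtain \<alpha>0 where ab1: "\<alpha>0 \<in> Field r" using r(2) by fastforce
  obtain \<beta>0 where ab2: "\<beta>0 \<in> Field r'" using r'(2) by fastforce
  have Xc: "\<forall>x\<in>X. le x c"
  proof
    fix x assume "x \<in> X"
    then obtain \<alpha> where \<alpha>: "\<alpha> \<in> Field r" "E x (f \<alpha>)" using bspec[OF f(3)] by metis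
    have "E x c" using lt_trans[OF c(1) \<alpha>(2)] c(2)[OF \<alpha>(1) ab2] by simp
    then show "le x c" by (rule lt_imp_le)
  qed
  have Yc: "\<forall>y\<in>Y. le c y"
  proof
    fix y assume y: "y \<in> Y"
    then obtain \<beta> where \<beta>: "\<beta> \<in> Field r'" "E (g \<beta>) y" using bspec[OF g(3)] by metis
    have "E c y" using lt_trans[OF Y(3)[OF y] _ \<beta>(2)] c(2)[OF ab1 \<beta>(1)] by simp
    then show "le c y" by (rule lt_imp_le)
  qed
  show ?thesis by (intro exI[of _ c] conjI c(1) Xc Yc)
qed

text \<open>In applications \<open>Q \<gamma> y\<close> says that the restriction of some sequence to length \<open>y\<close> has a property
  that its restrictions inherit, and \<open>X\<close> consists of the lengths of a chain below that sequence.\<close>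
lemma fill_conditions:
  fixes X \<Gamma> :: "'a set" and Q :: "'a \<Rightarrow> 'a \<Rightarrow> bool"
  assumes nc: "no_cut_below \<theta>" and X: "|X| <o \<theta>" "\<And>x. x \<in> X \<Longrightarrow> le x L" and L: "N L"
    and G: "|\<Gamma>| <o \<theta>" "\<And>\<gamma>. \<gamma> \<in> \<Gamma> \<Longrightarrow> dpred E (\<lambda>\<rho>. Q \<gamma> (\<rho> 0))"
    and Q0: "\<And>\<gamma>. \<gamma> \<in> \<Gamma> \<Longrightarrow> Q \<gamma> zero"
    and Q: "\<And>\<gamma> x y. \<gamma> \<in> \<Gamma> \<Longrightarrow> x \<in> X \<Longrightarrow> le y x \<Longrightarrow> Q \<gamma> y"
  shows "\<exists>c. N c \<and> le c L \<and> (\<forall>x\<in>X. le x c) \<and> (\<forall>\<gamma>\<in>\<Gamma>. \<forall>y. le y c \<longrightarrow> Q \<gamma> y)"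
proof (cases "X = {} \<or> \<Gamma> = {}")
  case True
  then show ?thesis
  proof
    assume "X = {}"
    moreover have "y = zero" if "le y zero" for y using that by (simp add: le_def)
    ultimately show ?thesis using Q0 zero_le[OF L] by (intro exI[of _ zero]) auto
  next
    assume "\<Gamma> = {}"
    then show ?thesis using X L by (intro exI[of _ L]) auto
  qed
next
  case False
  \<comment> \<open>For each condition the greatest length up to \<open>L\<close> through which it
    holds without interruption. These lengths are the upper side of the pre-cut, and
    \<open>X\<close> is the lower one.\<close>
  have "\<forall>\<gamma>\<in>\<Gamma>. \<exists>m. N m \<and> (le m L \<and> (\<forall>y. le y m \<longrightarrow> Q \<gamma> y)) \<and>
     (\<forall>y. N y \<longrightarrow> le y L \<and> (\<forall>y'. le y' y \<longrightarrow> Q \<gamma> y') \<longrightarrow> le y m)"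
  proof
    fix \<gamma> assume g: "\<gamma> \<in> \<Gamma>"
    note [dintro] = dpred_subst1[OF G(2)[OF g]]
    show "\<exists>m. N m \<and> (le m L \<and> (\<forall>y. le y m \<longrightarrow> Q \<gamma> y)) \<and>
       (\<forall>y. N y \<longrightarrow> le y L \<and> (\<forall>y'. le y' y \<longrightarrow> Q \<gamma> y') \<longrightarrow> le y m)"
    proof (rule N_greatest[OF _ L _ N_zero])
      show "dpred E (\<lambda>\<rho>. le (\<rho> 0) L \<and> (\<forall>y. le y (\<rho> 0) \<longrightarrow> Q \<gamma> y))" by (intro dintro)
      show "le zero L \<and> (\<forall>y. le y zero \<longrightarrow> Q \<gamma> y)" using Q0[OF g] zero_le[OF L] by (auto simp: le_def)
    qed blast
  qed
  from bchoice[OF this] obtain m where m: "\<And>\<gamma>. \<gamma> \<in> \<Gamma> \<Longrightarrow> N (m \<gamma>)" "\<And>\<gamma>. \<gamma> \<in> \<Gamma> \<Longrightarrow> le (m \<gamma>) L"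
    "\<And>\<gamma> y. \<gamma> \<in> \<Gamma> \<Longrightarrow> le y (m \<gamma>) \<Longrightarrow> Q \<gamma> y"
    "\<And>\<gamma> y. \<gamma> \<in> \<Gamma> \<Longrightarrow> N y \<Longrightarrow> le y L \<Longrightarrow> (\<And>y'. le y' y \<Longrightarrow> Q \<gamma> y') \<Longrightarrow> le y (m \<gamma>)" by metis
  have "\<exists>c. N c \<and> (\<forall>x\<in>X. le x c) \<and> (\<forall>y\<in>m ` \<Gamma>. le c y)"
  proof (rule fill_pre_cut[OF nc X(1)])
    show "|m ` \<Gamma>| <o \<theta>" using card_of_image G(1) ordLeq_ordLess_trans by blast
    show "N x" if "x \<in> X" for x using X(2)[OF that] L N_le by blast
    then show "le x y" if "x \<in> X" "y \<in> m ` \<Gamma>" for x y using that m(4) X(2) Q by blast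
  qed (use False m(1) in auto)
  then obtain c where c: "N c" "\<forall>x\<in>X. le x c" "\<forall>\<gamma>\<in>\<Gamma>. le c (m \<gamma>)" by blast
  obtain \<gamma>0 where "\<gamma>0 \<in> \<Gamma>" using False by blast
  then have "le c L" using c(3) m(2) le_trans[OF L] by blast
  moreover have "Q \<gamma> y" if "\<gamma> \<in> \<Gamma>" "le y c" for \<gamma> y
    using c(3) m(3)[OF that(1)] le_trans[OF m(1)[OF that(1)] that(2)] that by blast
  ultimately show ?thesis using c by blast
qed

section \<open>Reflection of cuts\<close>

lemma zero_add: "N i \<Longrightarrow> add zero i = i"
  by (induction i rule: om_induct) (intro dintro, simp_all)

lemma sc_add: "N i \<Longrightarrow> N p \<Longrightarrow> add (sc p) i = sc (add p i)"
  by (induction i rule: om_induct) (intro dintro, simp_all)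

lemma add_commute: "N i \<Longrightarrow> N p \<Longrightarrow> add p i = add i p"
  by (induction i rule: om_induct) (intro dintro, simp_all add: zero_add sc_add)

lemma add_complement_exists: "N n \<Longrightarrow> \<forall>x. le x n \<longrightarrow> (\<exists>y. N y \<and> add x y = n)"
proof (induction n rule: om_induct)
  case dpred
  show ?case by (intro dintro)
next
  case zero
  show ?case
  proof (intro allI impI)
    fix x assume "le x zero"
    then have "x = zero" by (simp add: le_def)
    then show "\<exists>y. N y \<and> add x y = zero" by (intro exI[of _ zero]) simp
  qed
next
  case (sc n)
  show ?case
  proof (intro allI impI)
    fix x assume "le x (sc n)"
    then consider "le x n" | "x = sc n" by (auto simp: le_def)
    then show "\<exists>y. N y \<and> add x y = sc n"
    proof cases
      case 1
      then obtain y where "N y" "add x y = n" using sc by blast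
      then show ?thesis by (intro exI[of _ "sc y"]) simp
    next
      case 2
      then show ?thesis by (intro exI[of _ zero]) simp
    qed
  qed
qed

lemma add_left_cancel:
  assumes "N p" "N y" "N z" "add p y = add p z" shows "y = z"
  using lt_linear[OF assms(2,3)] add_less[OF assms(2,1), of z] add_less[OF assms(3,1), of y] assms(4)
  by auto

lemma order_reversal:
  assumes n: "N n"
  obtains R where "\<And>x. le x n \<Longrightarrow> le (R x) n" "\<And>x. le x n \<Longrightarrow> R (R x) = x"
    "\<And>x y. le x n \<Longrightarrow> le y n \<Longrightarrow> E x y \<Longrightarrow> E (R y) (R x)"
proof -
  \<comment> \<open>\<open>R x\<close> is \<open>n - x\<close>; it serves only to transport external
    sequences.\<close>
  define R where "R x = (SOME y. N y \<and> add x y = n)" for x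
  have R: "N (R x) \<and> add x (R x) = n" if "le x n" for x
    unfolding R_def by (rule someI_ex) (use add_complement_exists[OF n] that in simp)
  have R_eq: "R x = y" if "le x n" "N y" "add x y = n" for x y
  proof (rule add_left_cancel)
    show "N x" using N_le[OF n that(1)] .
  qed (use R[OF that(1)] that in simp_all)
  have R_le: "le (R x) n" if x: "le x n" for x
    using le_add[of x "R x"] add_commute[of x "R x"] R[OF x] N_le[OF n x] by simp
  show ?thesis
  proof
    fix x assume x: "le x n"
    show "le (R x) n" using R_le[OF x] .
    show "R (R x) = x"
      using R_eq[OF R_le[OF x] N_le[OF n x]] add_commute[of x "R x"] R[OF x] N_le[OF n x] by simp
  next
    fix x y assume x: "le x n" and y: "le y n" and xy: "E x y"
    have Nx: "N x" "N y" "N (R x)" "N (R y)" using R N_le[OF n] x y by simp_all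
    show "E (R y) (R x)"
    proof (rule ccontr)
      assume "\<not> E (R y) (R x)"
      then have le: "le (R x) (R y)" using not_lt[OF Nx(4,3)] by simp
      have "E (add x (R x)) (add y (R x))"
        using add_less[OF Nx(2,3) xy] add_commute[OF Nx(3,1)] add_commute[OF Nx(3,2)] by simp
      moreover have "le (add y (R x)) (add y (R y))"
        using le add_less[OF Nx(4,2), of "R x"] by (auto simp: le_def)
      ultimately have "E (add x (R x)) (add y (R y))"
        using lt_le_trans[OF N_add[OF Nx(4,2)]] by simp
      then show False using R[OF x] R[OF y] by simp
    qed
  qed
qed

lemma decreasing_sequence_bounded:
  assumes "Card_order \<theta>" "infinite (Field \<theta>)" "\<forall>\<beta>\<in>Field \<theta>. N (b \<beta>)"
    and dec: "\<forall>\<beta>\<in>Field \<theta>. \<forall>\<beta>'\<in>Field \<theta>. (\<beta>, \<beta>') \<in> \<theta> \<and> \<beta> \<noteq> \<beta>' \<longrightarrow> E (b \<beta>') (b \<beta>)"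
  obtains n where "N n" "\<And>\<beta>. \<beta> \<in> Field \<theta> \<Longrightarrow> E (b \<beta>) n"
proof -
  obtain x where "x \<in> Field \<theta>" using assms(2) by fastforce
  from wfE_min[OF Card_order_wf_strict[OF assms(1)] this]
  obtain \<beta>0 where b0: "\<beta>0 \<in> Field \<theta>" "\<And>\<beta>. (\<beta>, \<beta>0) \<in> \<theta> - Id \<Longrightarrow> \<beta> \<notin> Field \<theta>" by blast
  have "E (b \<beta>) (sc (b \<beta>0))" if b: "\<beta> \<in> Field \<theta>" for \<beta>
  proof (cases "\<beta> = \<beta>0")
    case False
    then have "(\<beta>0, \<beta>) \<in> \<theta>" using Card_order_linear[OF assms(1) b b0(1)] b0(2)[of \<beta>] b by blast
    then have "E (b \<beta>) (b \<beta>0)" using dec b b0(1) False by simp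
    then show ?thesis by simp
  qed simp
  moreover have "N (sc (b \<beta>0))" using assms(3) b0(1) by simp
  ultimately show ?thesis using that by metis
qed

text \<open>Subtraction from a common bound \<open>n\<close> exchanges the sides. A number filling
  the reflected pair is itself below \<open>n\<close> and reflects back into the given cut.\<close>

lemma is_cut_reflect:
  assumes cut: "is_cut E om \<kappa> \<theta> a b"
  obtains a' b' where "is_cut E om \<theta> \<kappa> a' b'"
proof -
  note cut = cut[unfolded is_cut_def]
  have k: "Card_order \<kappa>" "infinite (Field \<kappa>)" "regularCard \<kappa>"
    and t: "Card_order \<theta>" "infinite (Field \<theta>)" "regularCard \<theta>" using cut by simp_all
  have Nb: "\<forall>\<beta>\<in>Field \<theta>. N (b \<beta>)"
    and inc: "\<forall>\<alpha>\<in>Field \<kappa>. \<forall>\<alpha>'\<in>Field \<kappa>. (\<alpha>, \<alpha>') \<in> \<kappa> \<and> \<alpha> \<noteq> \<alpha>' \<longrightarrow> E (a \<alpha>) (a \<alpha>')"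
    and dec: "\<forall>\<beta>\<in>Field \<theta>. \<forall>\<beta>'\<in>Field \<theta>. (\<beta>, \<beta>') \<in> \<theta> \<and> \<beta> \<noteq> \<beta>' \<longrightarrow> E (b \<beta>') (b \<beta>)"
    and ab: "\<forall>\<alpha>\<in>Field \<kappa>. \<forall>\<beta>\<in>Field \<theta>. E (a \<alpha>) (b \<beta>)"
    and gap: "\<not> (\<exists>c. N c \<and> (\<forall>\<alpha>\<in>Field \<kappa>. \<forall>\<beta>\<in>Field \<theta>. E (a \<alpha>) c \<and> E c (b \<beta>)))"
    using cut by simp_all
  obtain n where n: "N n" "\<And>\<beta>. \<beta> \<in> Field \<theta> \<Longrightarrow> E (b \<beta>) n"
    using decreasing_sequence_bounded[OF t(1,2) Nb dec] by blast
  obtain \<beta>0 where b0: "\<beta>0 \<in> Field \<theta>" using t(2) by fastforce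
  obtain \<alpha>0 where a0: "\<alpha>0 \<in> Field \<kappa>" using k(2) by fastforce
  have ln: "le (b \<beta>) n" if "\<beta> \<in> Field \<theta>" for \<beta> using n(2)[OF that] by (rule lt_imp_le)
  have an: "le (a \<alpha>) n" if "\<alpha> \<in> Field \<kappa>" for \<alpha>
    using lt_trans[OF n(1) _ n(2)[OF b0], of "a \<alpha>"] ab that b0 lt_imp_le[of "a \<alpha>" n] by simp
  obtain R where R: "\<And>x. le x n \<Longrightarrow> le (R x) n" "\<And>x. le x n \<Longrightarrow> R (R x) = x"
    "\<And>x y. le x n \<Longrightarrow> le y n \<Longrightarrow> E x y \<Longrightarrow> E (R y) (R x)" using order_reversal[OF n(1)] by metis
  have NR: "N (R x)" if "le x n" for x using N_le[OF n(1) R(1)[OF that]] .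
  have "False" if c: "N c" "\<forall>\<beta>\<in>Field \<theta>. \<forall>\<alpha>\<in>Field \<kappa>. E (R (b \<beta>)) c \<and> E c (R (a \<alpha>))" for c
  proof -
    have cn: "le c n"
    proof (rule lt_imp_le)
      have "E c (R (a \<alpha>0))" using c(2) a0 b0 by simp
      then show "E c n" using lt_le_trans[OF n(1) _ R(1)[OF an[OF a0]]] by simp
    qed
    have "E (a \<alpha>) (R c) \<and> E (R c) (b \<beta>)" if F: "\<alpha> \<in> Field \<kappa>" "\<beta> \<in> Field \<theta>" for \<alpha> \<beta>
      using R(3)[OF cn R(1)[OF an[OF F(1)]]] R(3)[OF R(1)[OF ln[OF F(2)]] cn]
        R(2)[OF an[OF F(1)]] R(2)[OF ln[OF F(2)]] c(2) F by simp
    then show False using gap NR[OF cn] by metis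
  qed
  then have "\<not> (\<exists>c. N c \<and> (\<forall>\<beta>\<in>Field \<theta>. \<forall>\<alpha>\<in>Field \<kappa>. E (R (b \<beta>)) c \<and> E c (R (a \<alpha>))))" by metis
  then have "is_cut E om \<theta> \<kappa> (\<lambda>\<beta>. R (b \<beta>)) (\<lambda>\<alpha>. R (a \<alpha>))"
    unfolding is_cut_def using k t inc dec ab by (simp add: NR R(3) ln an)
  then show ?thesis by (rule that)
qed

section \<open>Symmetric cuts\<close>

text \<open>Overspill for prefixes: if the lengths of all members of a chain satisfy
  \<open>Q\<close>, the prefix of length \<open>m\<close> of a bound still extends every
  member.\<close>

lemma longest_prefix:
  assumes "dpred E (\<lambda>\<rho>. Q (\<rho> 0))" "N L" "Q zero"
  obtains m where "N m" "le m L" "Q m" "\<And>y. le y L \<Longrightarrow> Q y \<Longrightarrow> le y m"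
proof -
  note [dintro] = dpred_subst1[OF assms(1)]
  have "dpred E (\<lambda>\<rho>. le (\<rho> 0) L \<and> Q (\<rho> 0))" by (intro dintro)
  from N_greatest[OF this assms(2) _ N_zero] zero_le[OF assms(2)] assms(3)
  obtain m where m: "N m" "le m L \<and> Q m" "\<And>y. N y \<Longrightarrow> le y L \<and> Q y \<Longrightarrow> le y m" by blast
  show ?thesis
  proof (rule that[OF m(1)])
    show "le m L" "Q m" using m(2) by simp_all
    show "le y m" if "le y L" "Q y" for y using m(3)[OF N_le[OF assms(2) that(1)]] that by simp
  qed
qed

text \<open>The sequences are moreover nonincreasing. The last entry of the longest good prefix of a
  bound exceeds its own position, hence every \<open>a \<alpha>\<close>, and is at most every
  earlier entry, in particular each \<open>b \<beta>\<close>. Each stage imposes a single definable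
  condition on the bound, so a longest prefix takes the place of filling pre-cuts.\<close>

lemma no_symmetric_cut:
  fixes \<kappa> :: "'a rel"
  assumes nt: "\<not> t_le E \<mu>" and k: "Card_order \<kappa>" "infinite (Field \<kappa>)" "\<kappa> \<le>o \<mu>"
    and Na: "\<forall>\<alpha>\<in>Field \<kappa>. N (a \<alpha>)" and Nb: "\<forall>\<alpha>\<in>Field \<kappa>. N (b \<alpha>)"
    and inc: "\<forall>\<alpha>\<in>Field \<kappa>. \<forall>\<alpha>'\<in>Field \<kappa>. (\<alpha>, \<alpha>') \<in> \<kappa> \<and> \<alpha> \<noteq> \<alpha>' \<longrightarrow> E (a \<alpha>) (a \<alpha>')"
    and dec: "\<forall>\<alpha>\<in>Field \<kappa>. \<forall>\<alpha>'\<in>Field \<kappa>. (\<alpha>, \<alpha>') \<in> \<kappa> \<and> \<alpha> \<noteq> \<alpha>' \<longrightarrow> E (b \<alpha>') (b \<alpha>)"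
    and ab: "\<forall>\<alpha>\<in>Field \<kappa>. E (a \<alpha>) (b \<alpha>)"
  shows "\<exists>c. N c \<and> (\<forall>\<alpha>\<in>Field \<kappa>. E (a \<alpha>) c \<and> E c (b \<alpha>))"
proof -
  obtain n where n: "N n" "\<And>\<beta>. \<beta> \<in> Field \<kappa> \<Longrightarrow> E (b \<beta>) n"
    using decreasing_sequence_bounded[OF k(1,2) Nb dec] by blast
  obtain \<alpha>0 where a0: "\<alpha>0 \<in> Field \<kappa>" using k(2) by fastforce
  define T where "T m u \<longleftrightarrow> le m (len u) \<and> (\<forall>i. E i m \<longrightarrow> E i (ap u i) \<and> (\<forall>j. E j i \<longrightarrow> le (ap u i) (ap u j)))" for m u
  have dT: "dterm E t \<Longrightarrow> dpred E (\<lambda>\<rho>. T (t \<rho>) u)" for t u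
    by (rule dpred_subst1[of E "\<lambda>m. T m u"]) (unfold T_def, intro dintro)
  define P where "P f \<delta> c \<longleftrightarrow> (\<delta> \<in> Field \<kappa> \<longrightarrow> tree_node E n c \<and> len c = sc (a \<delta>) \<and> T (sc (a \<delta>)) c \<and>
    ap c (a \<delta>) = b \<delta> \<and> (\<forall>\<beta>. (\<beta>, \<delta>) \<in> \<kappa> - Id \<longrightarrow> tree_le E (f \<beta>) c))" for f \<delta> c
  have fn: "fn c (len c)" and lt: "E (len c) n" if "tree_node E n c" for c
    using that by (simp_all add: tree_node_iff sq_def)
  have "\<exists>f. \<forall>\<delta>. P f \<delta> (f \<delta>)"
  proof (rule dependent_wf_choice[OF Card_order_wf_strict[OF k(1)]])
    show "P f \<delta> c = P g \<delta> c" if "\<And>z. (z, \<delta>) \<in> \<kappa> - Id \<Longrightarrow> f z = g z" for f g \<delta> c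
      using that by (simp add: P_def)
    fix \<delta> f assume IH: "\<And>\<beta>. (\<beta>, \<delta>) \<in> \<kappa> - Id \<Longrightarrow> P f \<beta> (f \<beta>)"
    show "\<exists>c. P f \<delta> c"
    proof (cases "\<delta> \<in> Field \<kappa>")
      case d: True
      let ?D = "underS \<kappa> \<delta>"
      have D: "\<beta> \<in> Field \<kappa>" "E (a \<beta>) (a \<delta>)" "E (b \<delta>) (b \<beta>)" and PD: "P f \<beta> (f \<beta>)" if "\<beta> \<in> ?D" for \<beta>
      proof -
        have b: "(\<beta>, \<delta>) \<in> \<kappa>" "\<beta> \<noteq> \<delta>" using that by (simp_all add: underS_def)
        then show F: "\<beta> \<in> Field \<kappa>" by (auto simp: Field_def)
        show "E (a \<beta>) (a \<delta>)" "E (b \<delta>) (b \<beta>)" using inc dec b F d by simp_all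
        show "P f \<beta> (f \<beta>)" using IH b by simp
      qed
      have fb: "tree_node E n (f \<beta>)" "len (f \<beta>) = sc (a \<beta>)" "T (sc (a \<beta>)) (f \<beta>)" "ap (f \<beta>) (a \<beta>) = b \<beta>"
        "\<And>\<gamma>. (\<gamma>, \<beta>) \<in> \<kappa> - Id \<Longrightarrow> tree_le E (f \<gamma>) (f \<beta>)" if "\<beta> \<in> ?D" for \<beta>
        using PD[OF that] D(1)[OF that] by (simp_all add: P_def)
      have "\<exists>u. tree_node E n u \<and> (\<forall>s\<in>f ` ?D. tree_le E s u)"
      proof (rule chain_bound[OF nt n(1) n(2)[OF a0]])
        have "|?D| \<le>o \<mu>" using card_of_underS[OF k(1) d] k(3) ordLess_imp_ordLeq ordLeq_transitive by blast
        then show "|f ` ?D| \<le>o \<mu>" using card_of_image ordLeq_transitive by blast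
        show "tree_node E n s" if "s \<in> f ` ?D" for s using that fb(1) by auto
        fix s t assume "s \<in> f ` ?D" "t \<in> f ` ?D"
        then obtain \<beta> \<gamma> where bg: "\<beta> \<in> ?D" "s = f \<beta>" "\<gamma> \<in> ?D" "t = f \<gamma>" by auto
        show "tree_le E s t \<or> tree_le E t s"
        proof (cases "\<beta> = \<gamma>")
          case False
          then show ?thesis using Card_order_linear[OF k(1) D(1)[OF bg(1)] D(1)[OF bg(3)]]
              fb(5)[OF bg(1), of \<gamma>] fb(5)[OF bg(3), of \<beta>] bg(2,4) by auto
        qed (simp add: bg tree_le_refl)
      qed
      then obtain u where u: "tree_node E n u" "\<forall>s\<in>f ` ?D. tree_le E s u" by blast
      have agree: "E i (len u) \<and> ap (f \<beta>) i = ap u i" if "\<beta> \<in> ?D" "E i (len (f \<beta>))" for \<beta> i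
        using tree_le_iff[OF fn[OF fb(1)[OF that(1)]] fn[OF u(1)]] u(2) that by simp
      \<comment> \<open>Entries that stay at least \<open>b \<delta>\<close> allow the prefix to be
        continued by the constant \<open>b \<delta>\<close> without breaking monotonicity.\<close>
      define Q where "Q m \<longleftrightarrow> T m u \<and> (\<forall>i. E i m \<longrightarrow> le (b \<delta>) (ap u i))" for m
      have NA: "N (a \<delta>)" and NB: "N (b \<delta>)" using Na Nb d by simp_all
      have "dpred E (\<lambda>\<rho>. Q (\<rho> 0))" unfolding Q_def by (intro dintro dT)
      moreover have "Q zero"
        using zero_le[OF N_trans[OF n(1) lt[OF u(1)]]] by (simp add: Q_def T_def)
      ultimately obtain m where m: "N m" "le m (a \<delta>)" "Q m" "\<And>y. le y (a \<delta>) \<Longrightarrow> Q y \<Longrightarrow> le y m"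
        using longest_prefix[of Q "a \<delta>"] NA by blast
      have mD: "le (sc (a \<beta>)) m" if b: "\<beta> \<in> ?D" for \<beta>
      proof (rule m(4))
        have Nab: "N (a \<beta>)" using Na D(1)[OF b] by simp
        show "le (sc (a \<beta>)) (a \<delta>)" using sc_le_iff[OF Nab NA] D(2)[OF b] by simp
        have L: "le (sc (a \<beta>)) (len u)"
          using tree_le_len[OF fn[OF fb(1)[OF b]] fn[OF u(1)]] u(2) b fb(2)[OF b] Nab
            N_trans[OF n(1) lt[OF u(1)]] by simp
        have ji: "E j (sc (a \<beta>))" if "E j i" "E i (sc (a \<beta>))" for i j
          using lt_trans[OF N_sc[OF Nab] that] .
        have val: "le (b \<beta>) (ap (f \<beta>) i)" if i: "E i (sc (a \<beta>))" for i
          using i fb(3)[OF b] fb(2,4)[OF b] by (auto simp: T_def)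
        have bb: "le (b \<delta>) (ap (f \<beta>) i)" if i: "E i (sc (a \<beta>))" for i
        proof -
          have "E (ap (f \<beta>) i) n" using fb(1)[OF b] i fb(2)[OF b] by (auto simp: tree_node_iff sq_def)
          then show ?thesis using le_trans[OF N_trans[OF n(1)] lt_imp_le[OF D(3)[OF b]] val[OF i]] by simp
        qed
        show "Q (sc (a \<beta>))" unfolding Q_def T_def
        proof (intro conjI allI impI L)
          fix i assume i: "E i (sc (a \<beta>))"
          have eq: "ap u i = ap (f \<beta>) i" using agree[OF b] i fb(2)[OF b] by simp
          show "E i (ap u i)" using fb(3)[OF b] i fb(2)[OF b] unfolding T_def eq by (simp del: mem_sc)
          show "le (b \<delta>) (ap u i)" using bb[OF i] eq by simp
          fix j assume j: "E j i"
          have "ap u j = ap (f \<beta>) j" using agree[OF b, of j] ji[OF j i] fb(2)[OF b] by simp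
          then show "le (ap u i) (ap u j)" using fb(3)[OF b] i j fb(2)[OF b] unfolding T_def eq by (simp del: mem_sc)
        qed
      qed
      \<comment> \<open>The padding \<open>b \<delta>\<close> exceeds all positions up to
        \<open>a \<delta>\<close>; since \<open>m\<close> is at most \<open>a \<delta>\<close>, the
        entry at \<open>a \<delta>\<close> is the required one.\<close>
      define c where "c = mk (sc (a \<delta>)) (\<lambda>i. if E i m then ap u i else b \<delta>)"
      have dc: "dterm E (\<lambda>\<rho>. if E (\<rho> 0) m then ap u (\<rho> 0) else b \<delta>)" by (intro dintro)
      have c: "fn c (sc (a \<delta>))" "len c = sc (a \<delta>)"
        "\<And>i. E i (sc (a \<delta>)) \<Longrightarrow> ap c i = (if E i m then ap u i else b \<delta>)"
        unfolding c_def using fn_mk[OF dc] len_mk[OF dc] ap_mk[OF dc] by simp_all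
      have mu: "E i (len u)" if "E i m" for i
        using m(3) lt_le_trans[OF N_trans[OF n(1) lt[OF u(1)]] that] by (simp add: Q_def T_def)
      have uval: "E (ap u i) n" if "E i m" for i
        using u(1) mu[OF that] by (simp add: tree_node_iff sq_def)
      have abd: "E (a \<delta>) (b \<delta>)" using ab d by simp
      have "P f \<delta> c" unfolding P_def
      proof (intro impI conjI allI)
        show "len c = sc (a \<delta>)" by (rule c(2))
        have "E (sc (a \<delta>)) n"
          using le_lt_trans[OF n(1) _ n(2)[OF d], of "sc (a \<delta>)"] sc_le_iff[OF NA NB] abd by simp
        then show "tree_node E n c" unfolding tree_node_iff sq_def
          using c uval n(2)[OF d] by simp
        have "\<not> E (a \<delta>) m" using not_lt[OF NA m(1)] m(2) by simp
        then show "ap c (a \<delta>) = b \<delta>" using c(3) by simp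
        show "T (sc (a \<delta>)) c" unfolding T_def c(2)
        proof (intro conjI allI impI)
          fix i assume i: "E i (sc (a \<delta>))"
          then have "le i (a \<delta>)" by (simp add: le_iff_lt_sc)
          then have "E i (b \<delta>)" using le_lt_trans[OF NB _ abd] by simp
          then show "E i (ap c i)" using c(3)[OF i] m(3) by (simp add: Q_def T_def)
          fix j assume j: "E j i"
          have j': "E j (sc (a \<delta>))" using lt_trans[OF N_sc[OF NA] j i] .
          have "E j m" if "E i m" using lt_trans[OF m(1) j that] .
          then show "le (ap c i) (ap c j)"
            using c(3)[OF i] c(3)[OF j'] m(3) j by (auto simp: Q_def T_def)
        qed simp
        fix \<beta> assume "(\<beta>, \<delta>) \<in> \<kappa> - Id"
        then have b: "\<beta> \<in> ?D" by (auto simp: underS_def)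
        show "tree_le E (f \<beta>) c"
        proof (subst tree_le_iff)
          show "fn (f \<beta>) (len (f \<beta>))" "fn c (len c)" using fn[OF fb(1)[OF b]] c by simp_all
          show "\<forall>x. E x (len (f \<beta>)) \<longrightarrow> E x (len c) \<and> ap (f \<beta>) x = ap c x"
          proof (intro allI impI)
            fix x assume x: "E x (len (f \<beta>))"
            have xm: "E x m" using lt_le_trans[OF m(1) _ mD[OF b]] x fb(2)[OF b] by simp
            have "E x (sc (a \<delta>))" using lt_le_trans[OF NA xm m(2)] by simp
            then show "E x (len c) \<and> ap (f \<beta>) x = ap c x" using c agree[OF b x] xm by simp
          qed
        qed
      qed
      then show ?thesis by blast
    qed (simp add: P_def)
  qed
  then obtain f where f: "\<And>\<delta>. P f \<delta> (f \<delta>)" by blast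
  have fb: "tree_node E n (f \<beta>)" "len (f \<beta>) = sc (a \<beta>)" "T (sc (a \<beta>)) (f \<beta>)" "ap (f \<beta>) (a \<beta>) = b \<beta>"
    "\<And>\<gamma>. (\<gamma>, \<beta>) \<in> \<kappa> - Id \<Longrightarrow> tree_le E (f \<gamma>) (f \<beta>)" if "\<beta> \<in> Field \<kappa>" for \<beta>
    using f[of \<beta>] that by (simp_all add: P_def)
  have "\<exists>u. tree_node E n u \<and> (\<forall>s\<in>f ` Field \<kappa>. tree_le E s u)"
  proof (rule chain_bound[OF nt n(1) n(2)[OF a0]])
    have "|Field \<kappa>| \<le>o \<mu>" using card_of_Field_ordIso[OF k(1)] k(3) ordIso_ordLeq_trans by blast
    then show "|f ` Field \<kappa>| \<le>o \<mu>" using card_of_image ordLeq_transitive by blast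
    show "tree_node E n s" if "s \<in> f ` Field \<kappa>" for s using that fb(1) by auto
    fix s t assume "s \<in> f ` Field \<kappa>" "t \<in> f ` Field \<kappa>"
    then obtain \<beta> \<gamma> where bg: "\<beta> \<in> Field \<kappa>" "s = f \<beta>" "\<gamma> \<in> Field \<kappa>" "t = f \<gamma>" by auto
    show "tree_le E s t \<or> tree_le E t s"
    proof (cases "\<beta> = \<gamma>")
      case False
      then show ?thesis using Card_order_linear[OF k(1) bg(1) bg(3)]
          fb(5)[OF bg(1), of \<gamma>] fb(5)[OF bg(3), of \<beta>] bg(2,4) by auto
    qed (simp add: bg tree_le_refl)
  qed
  then obtain u where u: "tree_node E n u" "\<forall>s\<in>f ` Field \<kappa>. tree_le E s u" by blast
  have agree: "E i (len u) \<and> ap (f \<beta>) i = ap u i" if "\<beta> \<in> Field \<kappa>" "E i (len (f \<beta>))" for \<beta> i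
    using tree_le_iff[OF fn[OF fb(1)[OF that(1)]] fn[OF u(1)]] u(2) that by simp
  have Nu: "N (len u)" using N_trans[OF n(1) lt[OF u(1)]] .
  have "T zero u" using zero_le[OF Nu] by (simp add: T_def)
  then obtain m where m: "N m" "le m (len u)" "T m u" "\<And>y. le y (len u) \<Longrightarrow> T y u \<Longrightarrow> le y m"
    using longest_prefix[OF dT[OF dterm_var(1)] Nu, of u] by blast
  have mD: "E (a \<beta>) m" if b: "\<beta> \<in> Field \<kappa>" for \<beta>
  proof -
    have Nab: "N (a \<beta>)" using Na b by simp
    have L: "le (sc (a \<beta>)) (len u)"
      using tree_le_len[OF fn[OF fb(1)[OF b]] fn[OF u(1)]] u(2) b fb(2)[OF b] Nab Nu by simp
    have ji: "E j (sc (a \<beta>))" if "E j i" "E i (sc (a \<beta>))" for i j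
      using lt_trans[OF N_sc[OF Nab] that] .
    have "T (sc (a \<beta>)) u" unfolding T_def
    proof (intro conjI allI impI L)
      fix i assume i: "E i (sc (a \<beta>))"
      have eq: "ap u i = ap (f \<beta>) i" using agree[OF b] i fb(2)[OF b] by simp
      show "E i (ap u i)" using fb(3)[OF b] i fb(2)[OF b] unfolding T_def eq by (simp del: mem_sc)
      fix j assume j: "E j i"
      have "ap u j = ap (f \<beta>) j" using agree[OF b, of j] ji[OF j i] fb(2)[OF b] by simp
      then show "le (ap u i) (ap u j)" using fb(3)[OF b] i j fb(2)[OF b] unfolding T_def eq by (simp del: mem_sc)
    qed
    then have "le (sc (a \<beta>)) m" using m(4)[OF L] by simp
    then show ?thesis using sc_le_iff[OF Nab m(1)] by simp
  qed
  \<comment> \<open>The last position of the good prefix, at or beyond every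
    \<open>a \<alpha>\<close>; its entry fills the cut.\<close>
  obtain l where l: "N l" "m = sc l" using N_cases[OF m(1)] mD[OF a0] by auto
  have c1: "le (a \<alpha>) l" if "\<alpha> \<in> Field \<kappa>" for \<alpha> using mD[OF that] l(2) by (simp add: le_def)
  have lm: "E l (len u)" using lt_le_trans[OF Nu _ m(2), of l] l(2) by simp
  have Nc: "N (ap u l)" using u(1) lm N_trans[OF n(1)] by (simp add: tree_node_iff sq_def)
  have "E (a \<alpha>) (ap u l) \<and> E (ap u l) (b \<alpha>)" if F: "\<alpha> \<in> Field \<kappa>" for \<alpha>
  proof
    have "E l (ap u l)" using m(3) l(2) by (simp add: T_def)
    then show "E (a \<alpha>) (ap u l)" using le_lt_trans[OF Nc c1[OF F]] by simp
    \<comment> \<open>Monotonicity gives a weak inequality only; a later index makes it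
      strict.\<close>
    obtain \<beta> where \<beta>: "(\<alpha>, \<beta>) \<in> \<kappa>" "\<alpha> \<noteq> \<beta>" using Card_order_no_max[OF k(1,2) F] by blast
    then have F': "\<beta> \<in> Field \<kappa>" by (auto simp: Field_def)
    have "ap u (a \<beta>) = b \<beta>" using agree[OF F', of "a \<beta>"] fb(2,4)[OF F'] by simp
    moreover have "\<forall>j. E j l \<longrightarrow> le (ap u l) (ap u j)" using m(3) l(2) by (simp add: T_def)
    ultimately have "le (ap u l) (b \<beta>)"
      using c1[OF F'] le_def[of "a \<beta>" l] le_refl[of "ap u l"] by metis
    moreover have "E (b \<beta>) (b \<alpha>)" using dec F F' \<beta> by simp
    ultimately show "E (ap u l) (b \<alpha>)" using le_lt_trans[of "b \<alpha>"] Nb F by simp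
  qed
  then show ?thesis using Nc by (intro exI[of _ "ap u l"]) simp
qed

section \<open>Asymmetric cuts\<close>

text \<open>The index set \<open>I\<close> is closed under predecessors so that the recursion can
  run along a proper initial segment, for a single row, or along the whole field, for the main
  chain.\<close>

lemma transfinite_chain:
  fixes r :: "'a rel"
  assumes r: "Card_order r" and I: "\<And>\<beta> \<delta>. \<delta> \<in> I \<Longrightarrow> \<beta> \<in> underS r \<delta> \<Longrightarrow> \<beta> \<in> I"
    and step: "\<And>\<delta> f. \<delta> \<in> I \<Longrightarrow> \<forall>\<beta>\<in>underS r \<delta>. ok \<beta> (f \<beta>) \<Longrightarrow>
      \<forall>\<beta>\<in>underS r \<delta>. \<forall>\<gamma>\<in>underS r \<beta>. tree_le E (f \<gamma>) (f \<beta>) \<Longrightarrow>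
      \<exists>c. ok \<delta> c \<and> (\<forall>\<beta>\<in>underS r \<delta>. tree_le E (f \<beta>) c)"
  shows "\<exists>f. \<forall>\<delta>\<in>I. ok \<delta> (f \<delta>) \<and> (\<forall>\<beta>\<in>underS r \<delta>. tree_le E (f \<beta>) (f \<delta>))"
proof -
  define P where "P f \<delta> c \<longleftrightarrow> (\<delta> \<in> I \<longrightarrow> ok \<delta> c \<and> (\<forall>\<beta>\<in>underS r \<delta>. tree_le E (f \<beta>) c))" for f \<delta> c
  have "\<exists>f. \<forall>\<delta>. P f \<delta> (f \<delta>)"
  proof (rule dependent_wf_choice[OF Card_order_wf_strict[OF r]])
    show "P f \<delta> c = P g \<delta> c" if "\<And>z. (z, \<delta>) \<in> r - Id \<Longrightarrow> f z = g z" for f g \<delta> c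
      using that by (simp add: P_def underS_def)
    fix \<delta> f assume IH: "\<And>\<beta>. (\<beta>, \<delta>) \<in> r - Id \<Longrightarrow> P f \<beta> (f \<beta>)"
    show "\<exists>c. P f \<delta> c"
    proof (cases "\<delta> \<in> I")
      case True
      have PD: "P f \<beta> (f \<beta>)" "\<beta> \<in> I" if "\<beta> \<in> underS r \<delta>" for \<beta>
        using IH[of \<beta>] I[OF True that] that by (simp_all add: underS_def)
      have "\<forall>\<beta>\<in>underS r \<delta>. ok \<beta> (f \<beta>)"
        "\<forall>\<beta>\<in>underS r \<delta>. \<forall>\<gamma>\<in>underS r \<beta>. tree_le E (f \<gamma>) (f \<beta>)"
        using PD unfolding P_def by simp_all
      from step[OF True this] show ?thesis using True by (simp add: P_def)
    qed (simp add: P_def)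
  qed
  then obtain f where "\<And>\<delta>. P f \<delta> (f \<delta>)" by blast
  then show ?thesis unfolding P_def by (intro exI[of _ f]) simp
qed

lemma chain_image_comparable:
  fixes r :: "'a rel"
  assumes r: "Card_order r" and S: "S \<subseteq> Field r"
    and le: "\<And>\<beta> \<gamma>. \<gamma> \<in> S \<Longrightarrow> \<beta> \<in> underS r \<gamma> \<Longrightarrow> tree_le E (f \<beta>) (f \<gamma>)"
    and s: "s \<in> f ` S" and t: "t \<in> f ` S"
  shows "tree_le E s t \<or> tree_le E t s"
proof -
  obtain \<beta> where b: "\<beta> \<in> S" "s = f \<beta>" using s by auto
  obtain \<gamma> where g: "\<gamma> \<in> S" "t = f \<gamma>" using t by auto
  show ?thesis
  proof (cases "\<beta> = \<gamma>")
    case False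
    have "\<beta> \<in> Field r" "\<gamma> \<in> Field r" using b(1) g(1) S by auto
    then have "\<beta> \<in> underS r \<gamma> \<or> \<gamma> \<in> underS r \<beta>"
      using Card_order_linear[OF r] False by (auto simp: underS_def)
    then show ?thesis using le[OF g(1)] le[OF b(1)] b(2) g(2) by auto
  qed (simp add: b g tree_le_refl)
qed

lemma underS_trans:
  assumes "Card_order r" "\<beta> \<in> underS r \<gamma>" "\<gamma> \<in> underS r \<delta>" shows "\<beta> \<in> underS r \<delta>"
  using assms Card_order_trans[OF assms(1), of \<beta> \<gamma> \<delta>] Card_order_antisym[OF assms(1), of \<beta> \<gamma>]
  by (auto simp: underS_def)

lemma underS_Field: "\<beta> \<in> underS r \<delta> \<Longrightarrow> \<beta> \<in> Field r \<and> \<delta> \<in> Field r"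
  by (auto simp: underS_def Field_def)

lemma underS_linear:
  assumes "Card_order r" "\<beta> \<in> Field r" "\<gamma> \<in> Field r"
  shows "\<beta> = \<gamma> \<or> \<beta> \<in> underS r \<gamma> \<or> \<gamma> \<in> underS r \<beta>"
  using Card_order_linear[OF assms] by (auto simp: underS_def)

text \<open>Provides one row of the main construction: \<open>G\<close> records distances from a new
  point at time \<open>h\<close> to earlier points, with nonzero entries for those kept alive, and
  \<open>F k j\<close> is the distance of two earlier points. The points \<open>a \<beta>\<close>
  form an external set, so their values cannot be prescribed by separation; they are placed one
  after another along a chain, and a bound of it is cut to a good prefix.\<close>

lemma prescribed_values:
  fixes \<theta> :: "'a rel"
  assumes nt: "\<not> t_le E \<mu>" and r: "Card_order \<theta>" "\<theta> \<le>o \<mu>" and nc: "no_cut_below \<theta>"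
    and d: "\<delta> \<in> Field \<theta>" and n: "N n" and h: "E h n" and l: "le l h"
    and al: "\<And>\<beta>. \<beta> \<in> underS \<theta> \<delta> \<Longrightarrow> E (a \<beta>) l"
    and inc: "\<And>\<beta> \<gamma>. \<beta> \<in> underS \<theta> \<gamma> \<Longrightarrow> E (a \<beta>) (a \<gamma>)"
    and v: "\<And>\<beta>. \<beta> \<in> underS \<theta> \<delta> \<Longrightarrow> E (v \<beta>) n"
    and F: "dterm E (\<lambda>\<rho>. F (\<rho> 0) (\<rho> 1))"
    and Fa: "\<And>\<beta> \<gamma>. \<gamma> \<in> underS \<theta> \<delta> \<Longrightarrow> \<beta> \<in> underS \<theta> \<gamma> \<Longrightarrow> le h (F (a \<gamma>) (a \<beta>))"
  shows "\<exists>G. tree_node E n G \<and> len G = h \<and> (\<forall>\<beta>\<in>underS \<theta> \<delta>. ap G (a \<beta>) = v \<beta>) \<and>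
    (\<forall>j. E j h \<longrightarrow> \<not> E j l \<longrightarrow> ap G j = zero) \<and>
    (\<forall>k. E k h \<longrightarrow> (\<forall>j. E j k \<longrightarrow> ap G j \<noteq> zero \<longrightarrow> ap G k \<noteq> zero \<longrightarrow> le h (F k j)))"
proof -
  let ?D = "underS \<theta> \<delta>"
  have Nh: "N h" using N_trans[OF n h] .
  have Nl: "N l" using N_le[OF Nh l] .
  have Na: "N (a \<beta>)" if "\<beta> \<in> ?D" for \<beta> using N_trans[OF Nl al[OF that]] .
  have zn: "E zero n" using zero_cases[OF n] h by auto
  have smaller: "\<gamma> \<in> ?D" if "\<beta> \<in> ?D" "\<gamma> \<in> underS \<theta> \<beta>" for \<beta> \<gamma>
    using underS_trans[OF r(1) that(2,1)] .
  note [dintro] = dterm_subst2[OF F]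
  define S where "S m u \<longleftrightarrow> le m (len u) \<and>
    (\<forall>k. E k m \<longrightarrow> (\<forall>j. E j k \<longrightarrow> ap u j \<noteq> zero \<longrightarrow> ap u k \<noteq> zero \<longrightarrow> le h (F k j)))" for m u
  \<comment> \<open>\<open>V x\<close> reserves room for a point \<open>x\<close> still to be
    placed: all points kept so far that precede it are far enough from it.\<close>
  define V where "V x m u \<longleftrightarrow> (\<forall>j. E j m \<longrightarrow> ap u j \<noteq> zero \<longrightarrow> E j x \<longrightarrow> le h (F x j))" for x m u
  have dS: "dpred E (\<lambda>\<rho>. S (\<rho> 0) u)" for u unfolding S_def by (intro dintro)
  have dSV: "dpred E (\<lambda>\<rho>. S (\<rho> 0) u \<and> V x (\<rho> 0) u)" for u x unfolding S_def V_def by (intro dintro)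
  define ok where "ok \<beta> s \<longleftrightarrow> tree_node E n s \<and> len s = sc (a \<beta>) \<and> S (sc (a \<beta>)) s \<and> ap s (a \<beta>) = v \<beta> \<and>
    (\<forall>\<gamma>\<in>?D. V (a \<gamma>) (sc (a \<beta>)) s)" for \<beta> s
  have ok: "tree_node E n s" "len s = sc (a \<beta>)" "S (sc (a \<beta>)) s" "ap s (a \<beta>) = v \<beta>"
    "\<forall>\<gamma>\<in>?D. V (a \<gamma>) (sc (a \<beta>)) s" if "ok \<beta> s" for \<beta> s
    using that by (auto simp only: ok_def)
  have fn: "fn c (len c)" and lt: "E (len c) n" and val: "\<And>i. E i (len c) \<Longrightarrow> E (ap c i) n"
    if "tree_node E n c" for c
    using that by (simp_all add: tree_node_iff sq_def)
  have bound: "\<exists>u. tree_node E n u \<and> (\<forall>\<beta>\<in>B. tree_le E (f \<beta>) u)"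
    if B: "B \<subseteq> ?D" and okB: "\<forall>\<beta>\<in>B. ok \<beta> (f \<beta>)"
      and ch: "\<forall>\<beta>\<in>B. \<forall>\<gamma>\<in>underS \<theta> \<beta>. tree_le E (f \<gamma>) (f \<beta>)" for f B
  proof -
    have "\<exists>u. tree_node E n u \<and> (\<forall>s\<in>f ` B. tree_le E s u)"
    proof (rule chain_bound[OF nt n zn])
      have "|?D| \<le>o \<mu>" using card_of_underS[OF r(1) d] r(2) ordLess_imp_ordLeq ordLeq_transitive by blast
      then have "|B| \<le>o \<mu>" using card_of_mono1[OF B] ordLeq_transitive by blast
      then show "|f ` B| \<le>o \<mu>" using card_of_image ordLeq_transitive by blast
      show "tree_node E n s" if "s \<in> f ` B" for s using that okB ok(1) by auto
      have BF: "B \<subseteq> Field \<theta>" using B underS_Field[of _ \<theta> \<delta>] by auto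
      show "tree_le E s t \<or> tree_le E t s" if "s \<in> f ` B" "t \<in> f ` B" for s t
        by (rule chain_image_comparable[OF r(1) BF _ that]) (use ch in simp)
    qed
    then show ?thesis by simp
  qed
  have agree: "E i (len u) \<and> ap s i = ap u i"
    if "tree_node E n u" "tree_le E s u" "ok \<beta> s" "E i (sc (a \<beta>))" for u s \<beta> i
    using tree_le_iff[OF fn[OF ok(1)[OF that(3)]] fn[OF that(1)]] that(2,4) ok(2)[OF that(3)] by (simp del: mem_sc)
  have inherit: "S y u \<and> V (a \<gamma>) y u"
    if u: "tree_node E n u" "tree_le E s u" "ok \<beta> s" and b: "\<beta> \<in> ?D" and g: "\<gamma> \<in> ?D" and y: "le y (sc (a \<beta>))"
    for u s \<beta> \<gamma> y
  proof -
    have Nab: "N (sc (a \<beta>))" using Na[OF b] by simp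
    have lu: "le (sc (a \<beta>)) (len u)"
      using tree_le_len[OF fn[OF ok(1)[OF u(3)]] fn[OF u(1)] _ _ u(2)] ok(2)[OF u(3)] Nab
        N_trans[OF n lt[OF u(1)]] by simp
    have "le y (len u)" using le_trans[OF N_trans[OF n lt[OF u(1)]] y lu] .
    moreover have low: "E i (sc (a \<beta>))" if "E i y" for i using lt_le_trans[OF Nab that y] .
    moreover have low2: "E j (sc (a \<beta>))" if "E j i" "E i y" for i j using lt_trans[OF Nab that(1) low[OF that(2)]] .
    ultimately show ?thesis using ok(3)[OF u(3)] bspec[OF ok(5)[OF u(3)] g] agree[OF u]
      unfolding S_def V_def by (simp del: mem_sc)
  qed
  have "\<exists>f. \<forall>\<beta>\<in>?D. ok \<beta> (f \<beta>) \<and> (\<forall>\<gamma>\<in>underS \<theta> \<beta>. tree_le E (f \<gamma>) (f \<beta>))"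
  proof (rule transfinite_chain[OF r(1)])
    show "\<gamma> \<in> ?D" if "\<beta> \<in> ?D" "\<gamma> \<in> underS \<theta> \<beta>" for \<gamma> \<beta> using smaller[OF that] .
    fix \<beta> f assume b: "\<beta> \<in> ?D" and okB: "\<forall>\<gamma>\<in>underS \<theta> \<beta>. ok \<gamma> (f \<gamma>)"
      and ch: "\<forall>\<gamma>\<in>underS \<theta> \<beta>. \<forall>\<gamma>'\<in>underS \<theta> \<gamma>. tree_le E (f \<gamma>') (f \<gamma>)"
    let ?B = "underS \<theta> \<beta>"
    have BD: "?B \<subseteq> ?D" using smaller[OF b] by auto
    have Nb: "N (a \<beta>)" using Na[OF b] .
    obtain u where u: "tree_node E n u" "\<forall>\<gamma>\<in>?B. tree_le E (f \<gamma>) u" using bound[OF BD okB ch] by blast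
    have Nu: "N (len u)" using N_trans[OF n lt[OF u(1)]] .
    \<comment> \<open>The lower side consists of the stages already reached, the upper side of the
      greatest lengths through which \<open>u\<close> respects \<open>S\<close> and one reserved
      point. Both have fewer than \<open>\<theta>\<close> members.\<close>
    have "\<exists>c. N c \<and> le c (a \<beta>) \<and> (\<forall>x\<in>(\<lambda>\<gamma>. sc (a \<gamma>)) ` ?B. le x c) \<and>
      (\<forall>\<gamma>\<in>?D. \<forall>y. le y c \<longrightarrow> S y u \<and> V (a \<gamma>) y u)"
    proof (rule fill_conditions[OF nc])
      have "|?B| <o \<theta>" using card_of_underS[OF r(1)] underS_Field[OF b] by simp
      then show "|(\<lambda>\<gamma>. sc (a \<gamma>)) ` ?B| <o \<theta>" using card_of_image ordLeq_ordLess_trans by blast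
      show "le x (a \<beta>)" if x: "x \<in> (\<lambda>\<gamma>. sc (a \<gamma>)) ` ?B" for x
      proof -
        obtain \<gamma> where g: "\<gamma> \<in> ?B" "x = sc (a \<gamma>)" using x by auto
        then show ?thesis using sc_le_iff[OF Na[OF smaller[OF b g(1)]] Nb] inc[OF g(1)] by simp
      qed
      show "N (a \<beta>)" by (rule Nb)
      show "|?D| <o \<theta>" using card_of_underS[OF r(1) d] .
      show "dpred E (\<lambda>\<rho>. S (\<rho> 0) u \<and> V (a \<gamma>) (\<rho> 0) u)" for \<gamma> by (rule dSV)
      show "S zero u \<and> V (a \<gamma>) zero u" for \<gamma> using zero_le[OF Nu] by (simp add: S_def V_def)
      show "S y u \<and> V (a \<gamma>) y u"
        if g: "\<gamma> \<in> ?D" and x: "x \<in> (\<lambda>\<gamma>. sc (a \<gamma>)) ` ?B" and y: "le y x" for \<gamma> x y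
      proof -
        obtain \<gamma>' where g': "\<gamma>' \<in> ?B" "x = sc (a \<gamma>')" using x by auto
        show ?thesis
          by (rule inherit[OF u(1) _ _ smaller[OF b g'(1)] g]) (use u(2) okB g' y in auto)
      qed
    qed
    then obtain c where c: "N c" "le c (a \<beta>)" "\<forall>\<gamma>\<in>?B. le (sc (a \<gamma>)) c" "\<forall>\<gamma>\<in>?D. S c u \<and> V (a \<gamma>) c u"
      by auto
    have Sc: "S c u" and Vc: "\<And>\<gamma>. \<gamma> \<in> ?D \<Longrightarrow> V (a \<gamma>) c u" using c(4) b by auto
    \<comment> \<open>Zeros between \<open>c\<close> and \<open>a \<beta>\<close> discard the points
      of \<open>u\<close> that might conflict with the reserved ones.\<close>
    define s where "s = mk (sc (a \<beta>)) (\<lambda>i. if E i c then ap u i else if i = a \<beta> then v \<beta> else zero)"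
    have ds: "dterm E (\<lambda>\<rho>. if E (\<rho> 0) c then ap u (\<rho> 0) else if \<rho> 0 = a \<beta> then v \<beta> else zero)"
      by (intro dintro)
    have s: "fn s (sc (a \<beta>))" "len s = sc (a \<beta>)"
      "\<And>i. E i (sc (a \<beta>)) \<Longrightarrow> ap s i = (if E i c then ap u i else if i = a \<beta> then v \<beta> else zero)"
      unfolding s_def using fn_mk[OF ds] len_mk[OF ds] ap_mk[OF ds] by simp_all
    have uc: "E i (len u)" if "E i c" for i using lt_le_trans[OF Nu that] Sc by (simp add: S_def)
    have ac: "\<not> E (a \<beta>) c" using not_lt[OF Nb c(1)] c(2) by simp
    have "ok \<beta> s" unfolding ok_def
    proof (intro conjI ballI)
      have "E (sc (a \<beta>)) n"
        using le_lt_trans[OF n _ h, of "sc (a \<beta>)"] le_trans[OF Nh _ l, of "sc (a \<beta>)"] sc_le_iff[OF Nb Nl] al[OF b] by simp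
      then show "tree_node E n s" unfolding tree_node_iff sq_def
        using s val[OF u(1)] uc v[OF b] zn by (simp del: mem_sc)
      show "len s = sc (a \<beta>)" by (rule s(2))
      show "ap s (a \<beta>) = v \<beta>" using s(3) ac by simp
      show "S (sc (a \<beta>)) s" unfolding S_def s(2)
      proof (intro conjI allI impI)
        fix k j assume k: "E k (sc (a \<beta>))" and j: "E j k" and nz: "ap s j \<noteq> zero" "ap s k \<noteq> zero"
        have j': "E j (sc (a \<beta>))" using lt_trans[OF N_sc[OF Nb] j k] .
        show "le h (F k j)"
        proof (cases "E k c")
          case True
          then have "E j c" using lt_trans[OF c(1) j] by simp
          then show ?thesis using Sc True j nz s(3)[OF k] s(3)[OF j'] by (simp add: S_def)
        next
          case False
          then have ka: "k = a \<beta>" using nz(2) s(3)[OF k] by (auto split: if_splits)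
          have "E j c" using nz(1) s(3)[OF j'] j ka by (auto split: if_splits)
          then show ?thesis using Vc[OF b] nz(1) s(3)[OF j'] j ka by (simp add: V_def)
        qed
      qed simp
      fix \<gamma> assume g: "\<gamma> \<in> ?D"
      show "V (a \<gamma>) (sc (a \<beta>)) s" unfolding V_def
      proof (intro allI impI)
        fix j assume j: "E j (sc (a \<beta>))" "ap s j \<noteq> zero" "E j (a \<gamma>)"
        show "le h (F (a \<gamma>) j)"
        proof (cases "E j c")
          case True
          then show ?thesis using Vc[OF g] j s(3)[OF j(1)] by (simp add: V_def)
        next
          case False
          then have ja: "j = a \<beta>" using j(2) s(3)[OF j(1)] by (auto split: if_splits)
          have "\<beta> \<noteq> \<gamma>" using j(3) ja by auto
          moreover have "\<gamma> \<notin> underS \<theta> \<beta>" using inc[of \<gamma> \<beta>] lt_asym[OF Nb] j(3) ja by auto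
          ultimately have "\<beta> \<in> underS \<theta> \<gamma>"
            using underS_linear[OF r(1), of \<beta> \<gamma>] underS_Field[OF b] underS_Field[OF g] by simp
          then show ?thesis using Fa[OF g] ja by simp
        qed
      qed
    qed
    moreover have "tree_le E (f \<gamma>) s" if g: "\<gamma> \<in> ?B" for \<gamma>
    proof (subst tree_le_iff)
      have og: "ok \<gamma> (f \<gamma>)" using okB g by simp
      show "fn (f \<gamma>) (len (f \<gamma>))" "fn s (len s)" using fn[OF ok(1)[OF og]] s by simp_all
      show "\<forall>x. E x (len (f \<gamma>)) \<longrightarrow> E x (len s) \<and> ap (f \<gamma>) x = ap s x"
      proof (intro allI impI)
        fix x assume "E x (len (f \<gamma>))"
        then have x: "E x (sc (a \<gamma>))" using ok(2)[OF og] by simp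
        have xc: "E x c" using lt_le_trans[OF c(1) x] c(3) g by simp
        have xs: "E x (sc (a \<beta>))" using lt_le_trans[OF Nb xc c(2)] by simp
        show "E x (len s) \<and> ap (f \<gamma>) x = ap s x"
          using agree[OF u(1) _ og x] u(2) g s(2) s(3)[OF xs] xs xc by simp
      qed
    qed
    ultimately show "\<exists>s. ok \<beta> s \<and> (\<forall>\<gamma>\<in>?B. tree_le E (f \<gamma>) s)" by (intro exI[of _ s]) simp
  qed
  then obtain f where "\<forall>\<beta>\<in>?D. ok \<beta> (f \<beta>) \<and> (\<forall>\<gamma>\<in>underS \<theta> \<beta>. tree_le E (f \<gamma>) (f \<beta>))"
    by (elim exE)
  then have f: "\<forall>\<beta>\<in>?D. ok \<beta> (f \<beta>)"
    "\<forall>\<beta>\<in>?D. \<forall>\<gamma>\<in>underS \<theta> \<beta>. tree_le E (f \<gamma>) (f \<beta>)" by simp_all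
  obtain u where u: "tree_node E n u" "\<forall>\<gamma>\<in>?D. tree_le E (f \<gamma>) u" using bound[OF subset_refl f] by blast
  have Nu: "N (len u)" using N_trans[OF n lt[OF u(1)]] .
  have "S zero u" using zero_le[OF Nu] by (simp add: S_def)
  \<comment> \<open>Searching up to \<open>l\<close> instead of \<open>h\<close> yields the zeros of
    \<open>G\<close> from \<open>l\<close> on.\<close>
  then obtain m where m: "N m" "le m l" "S m u" "\<And>y. le y l \<Longrightarrow> S y u \<Longrightarrow> le y m"
    using longest_prefix[OF dS Nl, of u] by metis
  have am: "E (a \<beta>) m" if b: "\<beta> \<in> ?D" for \<beta>
  proof -
    have "S (sc (a \<beta>)) u"
      using inherit[OF u(1) bspec[OF u(2) b] bspec[OF f(1) b] b b le_refl] by (rule conjunct1)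
    moreover have "le (sc (a \<beta>)) l" using sc_le_iff[OF Na[OF b] Nl] al[OF b] by simp
    ultimately show ?thesis using m(4) sc_le_iff[OF Na[OF b] m(1)] by simp
  qed
  define G where "G = mk h (\<lambda>i. if E i m then ap u i else zero)"
  have dG: "dterm E (\<lambda>\<rho>. if E (\<rho> 0) m then ap u (\<rho> 0) else zero)" by (intro dintro)
  have G: "fn G h" "len G = h" "\<And>i. E i h \<Longrightarrow> ap G i = (if E i m then ap u i else zero)"
    unfolding G_def using fn_mk[OF dG] len_mk[OF dG] ap_mk[OF dG] by simp_all
  have um: "E i (len u)" if "E i m" for i using lt_le_trans[OF Nu that] m(3) by (simp add: S_def)
  have ml: "E i l" "E i h" if "E i m" for i
    using lt_le_trans[OF Nl that m(2)] lt_le_trans[OF Nh _ l] by simp_all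
  show ?thesis
  proof (intro exI[of _ G] conjI ballI allI impI)
    show "tree_node E n G" unfolding tree_node_iff sq_def
      using G val[OF u(1)] um zn h by simp
    show "len G = h" by (rule G(2))
    show "ap G (a \<beta>) = v \<beta>" if b: "\<beta> \<in> ?D" for \<beta>
    proof -
      have okb: "ok \<beta> (f \<beta>)" using f(1) b by simp
      have "ap u (a \<beta>) = v \<beta>" using agree[OF u(1) _ okb, of "a \<beta>"] u(2) b ok(4)[OF okb] by simp
      then show ?thesis using G(3)[OF ml(2)[OF am[OF b]]] am[OF b] by simp
    qed
    show "ap G j = zero" if "E j h" "\<not> E j l" for j using G(3)[OF that(1)] ml(1)[of j] that by auto
    show "le h (F k j)" if kj: "E k h" "E j k" "ap G j \<noteq> zero" "ap G k \<noteq> zero" for k j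
    proof -
      have "E j h" using lt_trans[OF Nh kj(2,1)] .
      then show ?thesis using m(3) kj G(3)[of j] G(3)[OF kj(1)] by (auto simp: S_def split: if_splits)
    qed
  qed
qed

text \<open>The entry at time \<open>k\<close> of a node is a function assigning to each earlier time \<open>j\<close> either zero
  (the point \<open>j\<close> is dead at time \<open>k\<close>) or the distance of the points \<open>j\<close> and \<open>k\<close>. Points alive at
  time \<open>i\<close> have mutual distances at least \<open>i\<close>.\<close>
lemma no_asymmetric_cut:
  fixes \<theta> \<kappa> :: "'a rel"
  assumes nt: "\<not> t_le E \<mu>" and cut: "is_cut E om \<theta> \<kappa> a b" and less: "\<kappa> <o \<theta>" and \<mu>: "\<theta> \<le>o \<mu>"
    and nc: "no_cut_below \<theta>"
  shows False
proof -
  note cut = cut[unfolded is_cut_def]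
  have r: "Card_order \<theta>" "infinite (Field \<theta>)" and k: "Card_order \<kappa>" "infinite (Field \<kappa>)"
    using cut by simp_all
  have Na: "\<forall>\<alpha>\<in>Field \<theta>. N (a \<alpha>)" and Nb: "\<forall>\<beta>\<in>Field \<kappa>. N (b \<beta>)"
    and inc0: "\<forall>\<alpha>\<in>Field \<theta>. \<forall>\<alpha>'\<in>Field \<theta>. (\<alpha>, \<alpha>') \<in> \<theta> \<and> \<alpha> \<noteq> \<alpha>' \<longrightarrow> E (a \<alpha>) (a \<alpha>')"
    and dec: "\<forall>\<beta>\<in>Field \<kappa>. \<forall>\<beta>'\<in>Field \<kappa>. (\<beta>, \<beta>') \<in> \<kappa> \<and> \<beta> \<noteq> \<beta>' \<longrightarrow> E (b \<beta>') (b \<beta>)"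
    and ab: "\<forall>\<alpha>\<in>Field \<theta>. \<forall>\<beta>\<in>Field \<kappa>. E (a \<alpha>) (b \<beta>)"
    and gap: "\<not> (\<exists>c. N c \<and> (\<forall>\<alpha>\<in>Field \<theta>. \<forall>\<beta>\<in>Field \<kappa>. E (a \<alpha>) c \<and> E c (b \<beta>)))"
    using cut by simp_all
  obtain n where n: "N n" "\<And>\<beta>. \<beta> \<in> Field \<kappa> \<Longrightarrow> E (b \<beta>) n"
    using decreasing_sequence_bounded[OF k Nb dec] by blast
  obtain \<epsilon>0 where e0: "\<epsilon>0 \<in> Field \<kappa>" using k(2) by fastforce
  have an: "E (a \<alpha>) n" if "\<alpha> \<in> Field \<theta>" for \<alpha>
    using lt_trans[OF n(1) _ n(2)[OF e0], of "a \<alpha>"] ab that e0 by simp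
  have zn: "E zero n" using zero_cases[OF n(1)] n(2)[OF e0] by auto
  have inc: "E (a \<beta>) (a \<gamma>)" if "\<beta> \<in> underS \<theta> \<gamma>" for \<beta> \<gamma>
    using inc0 underS_Field[OF that] that by (simp add: underS_def)
  \<comment> \<open>Zero means dead, so prescribed distances have to be nonzero.\<close>
  have b_pos: "b \<epsilon> \<noteq> zero" if "\<epsilon> \<in> Field \<kappa>" for \<epsilon>
  proof -
    obtain \<alpha> where "\<alpha> \<in> Field \<theta>" using r(2) by fastforce
    then have "E (a \<alpha>) (b \<epsilon>)" using ab that by simp
    then show ?thesis by auto
  qed
  obtain K g where K: "K \<subseteq> Field \<theta>" "\<not> |K| \<le>o \<kappa>" and gF: "\<And>\<beta> \<gamma>. g \<beta> \<gamma> \<in> Field \<kappa>"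
    and g: "\<And>W \<epsilon>. W \<subseteq> K \<Longrightarrow> \<not> |W| \<le>o \<kappa> \<Longrightarrow> \<epsilon> \<in> Field \<kappa> \<Longrightarrow>
      \<exists>\<beta>\<in>W. \<exists>\<gamma>\<in>W. (\<beta>, \<gamma>) \<in> \<theta> \<and> \<beta> \<noteq> \<gamma> \<and> (g \<beta> \<gamma>, \<epsilon>) \<notin> \<kappa>"
    using unbounded_colouring[OF k r(1) less] by metis
  \<comment> \<open>Whether a point is alive at time \<open>i\<close> is read from the row of time
    \<open>i\<close>; the distance of \<open>j\<close> and a later \<open>k\<close> is read from the
    row of time \<open>k\<close>, when the later point appeared.\<close>
  define R where "R u i \<longleftrightarrow> len (ap u i) = i \<and> (\<forall>k. E k i \<longrightarrow>
    (\<forall>j. E j k \<longrightarrow> ap (ap u i) j \<noteq> zero \<longrightarrow> ap (ap u i) k \<noteq> zero \<longrightarrow> le i (ap (ap u k) j)))" for u i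
  define A where "A x m u \<longleftrightarrow> (\<forall>i. E i m \<longrightarrow> E x i \<longrightarrow> ap (ap u i) x \<noteq> zero)" for x m u
  define S where "S m u \<longleftrightarrow> le m (len u) \<and> (\<forall>i. E i m \<longrightarrow> R u i)" for m u
  have dS: "dpred E (\<lambda>\<rho>. S (\<rho> 0) u)" for u unfolding S_def R_def by (intro dintro)
  have dA: "dpred E (\<lambda>\<rho>. A x (\<rho> 0) u)" for x u unfolding A_def by (intro dintro)
  have dSA: "dpred E (\<lambda>\<rho>. S (\<rho> 0) u \<and> A x (\<rho> 0) u)" for x u by (intro dpred_conj dS dA)
  \<comment> \<open>For \<open>\<beta>\<close> not below \<open>\<delta>\<close> the aliveness
    clause is vacuous, because no time up to \<open>a \<delta>\<close> comes after
    \<open>a \<beta>\<close>. Stating it for the whole field lets bounds inherit it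
    uniformly.\<close>
  define ok where "ok \<delta> c \<longleftrightarrow> sq (tree_node E n) n c \<and> len c = sc (a \<delta>) \<and> S (sc (a \<delta>)) c \<and>
    (\<forall>\<beta>\<in>underS \<theta> \<delta>. ap (ap c (a \<delta>)) (a \<beta>) = b (g \<beta> \<delta>)) \<and> (\<forall>\<beta>\<in>Field \<theta>. A (a \<beta>) (sc (a \<delta>)) c)" for \<delta> c
  have ok: "sq (tree_node E n) n c" "len c = sc (a \<delta>)" "S (sc (a \<delta>)) c"
    "\<forall>\<beta>\<in>underS \<theta> \<delta>. ap (ap c (a \<delta>)) (a \<beta>) = b (g \<beta> \<delta>)" "\<forall>\<beta>\<in>Field \<theta>. A (a \<beta>) (sc (a \<delta>)) c"
    if "ok \<delta> c" for \<delta> c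
    using that by (auto simp only: ok_def)
  have fn: "fn c (len c)" and lt: "E (len c) n" and val: "\<And>i. E i (len c) \<Longrightarrow> tree_node E n (ap c i)"
    if "sq (tree_node E n) n c" for c
    using that by (simp_all add: sq_def)
  have Nlen: "N (len u)" if "sq (tree_node E n) n u" for u using N_trans[OF n(1) lt[OF that]] .
  have bound: "\<exists>u. sq (tree_node E n) n u \<and> (\<forall>\<beta>\<in>B. tree_le E (f \<beta>) u)"
    if B: "B \<subseteq> Field \<theta>" and okB: "\<forall>\<beta>\<in>B. ok \<beta> (f \<beta>)"
      and ch: "\<forall>\<beta>\<in>B. \<forall>\<gamma>\<in>underS \<theta> \<beta>. tree_le E (f \<gamma>) (f \<beta>)" for f B
  proof -
    have "\<exists>u. sq (tree_node E n) n u \<and> (\<forall>s\<in>f ` B. tree_le E s u)"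
    proof (rule coded_chain_bound[OF nt n(1) zn])
      have "|Field \<theta>| \<le>o \<mu>" using card_of_Field_ordIso[OF r(1)] \<mu> ordIso_ordLeq_trans by blast
      then have "|B| \<le>o \<mu>" using card_of_mono1[OF B] ordLeq_transitive by blast
      then show "|f ` B| \<le>o \<mu>" using card_of_image ordLeq_transitive by blast
      show "sq (tree_node E n) n s" if "s \<in> f ` B" for s using that okB ok(1) by auto
      show "tree_le E s t \<or> tree_le E t s" if "s \<in> f ` B" "t \<in> f ` B" for s t
        by (rule chain_image_comparable[OF r(1) B _ that]) (use ch in simp)
    qed
    then show ?thesis by simp
  qed
  have agree: "E i (len u) \<and> ap s i = ap u i"
    if "sq (tree_node E n) n u" "tree_le E s u" "ok \<beta> s" "E i (sc (a \<beta>))" for u s \<beta> i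
    using tree_le_iff[OF fn[OF ok(1)[OF that(3)]] fn[OF that(1)]] that(2,4) ok(2)[OF that(3)]
    by (simp del: mem_sc)
  have inherit: "S y u \<and> A (a \<gamma>) y u"
    if u: "sq (tree_node E n) n u" "tree_le E s u" "ok \<beta> s" and b: "\<beta> \<in> Field \<theta>" and g: "\<gamma> \<in> Field \<theta>"
      and y: "le y (sc (a \<beta>))" for u s \<beta> \<gamma> y
  proof -
    have Nab: "N (sc (a \<beta>))" using Na b by simp
    have lu: "le (sc (a \<beta>)) (len u)"
      using tree_le_len[OF fn[OF ok(1)[OF u(3)]] fn[OF u(1)] _ _ u(2)] ok(2)[OF u(3)] Nab Nlen[OF u(1)]
      by simp
    have "le y (len u)" using le_trans[OF Nlen[OF u(1)] y lu] .
    moreover have low: "E i (sc (a \<beta>))" if "E i y" for i using lt_le_trans[OF Nab that y] .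
    moreover have low2: "E j (sc (a \<beta>))" if "E j i" "E i y" for i j
      using lt_trans[OF Nab that(1) low[OF that(2)]] .
    moreover have "R u i" if i: "E i y" for i
    proof -
      have eq: "ap s i = ap u i" using agree[OF u low[OF i]] by simp
      have eq': "ap s j = ap u j" if "E j i" for j using agree[OF u low2[OF that i]] by simp
      have "R s i" using ok(3)[OF u(3)] low[OF i] by (simp add: S_def del: mem_sc)
      then show ?thesis unfolding R_def eq using eq' by simp
    qed
    ultimately show ?thesis using bspec[OF ok(5)[OF u(3)] g] agree[OF u]
      unfolding S_def A_def by (simp del: mem_sc)
  qed
  have "\<exists>f. \<forall>\<delta>\<in>Field \<theta>. ok \<delta> (f \<delta>) \<and> (\<forall>\<beta>\<in>underS \<theta> \<delta>. tree_le E (f \<beta>) (f \<delta>))"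
  proof (rule transfinite_chain[OF r(1)])
    show "\<beta> \<in> Field \<theta>" if "\<beta> \<in> underS \<theta> \<delta>" for \<beta> \<delta> using underS_Field[OF that] by simp
    fix \<delta> f assume d: "\<delta> \<in> Field \<theta>" and okB: "\<forall>\<beta>\<in>underS \<theta> \<delta>. ok \<beta> (f \<beta>)"
      and ch: "\<forall>\<beta>\<in>underS \<theta> \<delta>. \<forall>\<gamma>\<in>underS \<theta> \<beta>. tree_le E (f \<gamma>) (f \<beta>)"
    let ?D = "underS \<theta> \<delta>"
    have DF: "?D \<subseteq> Field \<theta>" using underS_Field[of _ \<theta> \<delta>] by auto
    have Nd: "N (a \<delta>)" using Na d by simp
    obtain u where u: "sq (tree_node E n) n u" "\<forall>\<beta>\<in>?D. tree_le E (f \<beta>) u" using bound[OF DF okB ch] by blast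
    have Nu: "N (len u)" using Nlen[OF u(1)] .
    \<comment> \<open>The index \<open>\<delta>\<close> contributes just the condition
      \<open>S\<close>, its aliveness clause being vacuous up to \<open>a \<delta>\<close>; it keeps
      the set of conditions nonempty when \<open>\<delta>\<close> has no predecessors.\<close>
    have "\<exists>l. N l \<and> le l (a \<delta>) \<and> (\<forall>x\<in>(\<lambda>\<beta>. sc (a \<beta>)) ` ?D. le x l) \<and>
      (\<forall>\<gamma>\<in>insert \<delta> ?D. \<forall>y. le y l \<longrightarrow> S y u \<and> A (a \<gamma>) y u)"
    proof (rule fill_conditions[OF nc])
      have "|?D| <o \<theta>" using card_of_underS[OF r(1) d] .
      then show "|(\<lambda>\<beta>. sc (a \<beta>)) ` ?D| <o \<theta>" using card_of_image ordLeq_ordLess_trans by blast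
      show "le x (a \<delta>)" if x: "x \<in> (\<lambda>\<beta>. sc (a \<beta>)) ` ?D" for x
      proof -
        obtain \<beta> where b: "\<beta> \<in> ?D" "x = sc (a \<beta>)" using x by auto
        have "N (a \<beta>)" using Na DF b(1) by auto
        then show ?thesis using sc_le_iff[OF _ Nd] inc[OF b(1)] b(2) by simp
      qed
      show "N (a \<delta>)" by (rule Nd)
      \<comment> \<open>\<open>\<delta>\<close> and its predecessors lie in a proper initial
        segment, so there are still fewer than \<open>\<theta>\<close> conditions.\<close>
      obtain \<delta>' where d': "(\<delta>, \<delta>') \<in> \<theta>" "\<delta> \<noteq> \<delta>'" using Card_order_no_max[OF r d] by auto
      then have d'S: "\<delta> \<in> underS \<theta> \<delta>'" by (simp add: underS_def)
      then have "insert \<delta> ?D \<subseteq> underS \<theta> \<delta>'" using underS_trans[OF r(1) _ d'S] by auto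
      moreover have "|underS \<theta> \<delta>'| <o \<theta>" using card_of_underS[OF r(1)] underS_Field[OF d'S] by simp
      ultimately show "|insert \<delta> ?D| <o \<theta>" using card_of_mono1 ordLeq_ordLess_trans by blast
      show "dpred E (\<lambda>\<rho>. S (\<rho> 0) u \<and> A (a \<gamma>) (\<rho> 0) u)" for \<gamma> by (rule dSA)
      show "S zero u \<and> A (a \<gamma>) zero u" for \<gamma> using zero_le[OF Nu] by (simp add: S_def A_def)
      show "S y u \<and> A (a \<gamma>) y u"
        if g: "\<gamma> \<in> insert \<delta> ?D" and x: "x \<in> (\<lambda>\<beta>. sc (a \<beta>)) ` ?D" and y: "le y x" for \<gamma> x y
      proof -
        obtain \<beta> where b: "\<beta> \<in> ?D" "x = sc (a \<beta>)" using x by auto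
        have "\<beta> \<in> Field \<theta>" "\<gamma> \<in> Field \<theta>" using b(1) g DF d by auto
        then show ?thesis using inherit[OF u(1), of "f \<beta>" \<beta> \<gamma> y] u(2) okB b y by simp
      qed
    qed
    then obtain l where l: "N l" "le l (a \<delta>)" "\<forall>\<beta>\<in>?D. le (sc (a \<beta>)) l"
      "\<forall>\<gamma>\<in>insert \<delta> ?D. S l u \<and> A (a \<gamma>) l u" by auto
    have Sl: "S l u" and Al: "\<And>\<gamma>. \<gamma> \<in> ?D \<Longrightarrow> A (a \<gamma>) l u" using l(4) by auto
    have al: "E (a \<beta>) l" if b: "\<beta> \<in> ?D" for \<beta>
    proof -
      have "N (a \<beta>)" using Na DF b by auto
      from sc_le_iff[OF this l(1)] show ?thesis using l(3) b by simp
    qed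
    have dist: "ap (ap u (a \<gamma>)) (a \<beta>) = b (g \<beta> \<gamma>)" if gb: "\<gamma> \<in> ?D" "\<beta> \<in> underS \<theta> \<gamma>" for \<beta> \<gamma>
    proof -
      have og: "ok \<gamma> (f \<gamma>)" using okB gb(1) by simp
      have "ap (f \<gamma>) (a \<gamma>) = ap u (a \<gamma>)" using agree[OF u(1) _ og, of "a \<gamma>"] u(2) gb(1) by simp
      then show ?thesis using ok(4)[OF og] gb(2) by simp
    qed
    \<comment> \<open>All points introduced from time \<open>l\<close> on are declared dead at time
      \<open>a \<delta>\<close>, since \<open>u\<close> is abandoned at \<open>l\<close>.\<close>
    have "\<exists>G. tree_node E n G \<and> len G = a \<delta> \<and> (\<forall>\<beta>\<in>?D. ap G (a \<beta>) = b (g \<beta> \<delta>)) \<and>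
      (\<forall>j. E j (a \<delta>) \<longrightarrow> \<not> E j l \<longrightarrow> ap G j = zero) \<and>
      (\<forall>k. E k (a \<delta>) \<longrightarrow> (\<forall>j. E j k \<longrightarrow> ap G j \<noteq> zero \<longrightarrow> ap G k \<noteq> zero \<longrightarrow> le (a \<delta>) (ap (ap u k) j)))"
    proof (rule prescribed_values[OF nt r(1) \<mu> nc d n(1) an[OF d] l(2) al inc])
      show "E (b (g \<beta> \<delta>)) n" for \<beta> using n(2)[OF gF] .
      show "dterm E (\<lambda>\<rho>. ap (ap u (\<rho> 0)) (\<rho> 1))" by (intro dintro)
      \<comment> \<open>The distances already fixed among the points \<open>a \<beta>\<close> are
        values of \<open>b\<close>, hence above \<open>a \<delta>\<close>.\<close>
      show "le (a \<delta>) (ap (ap u (a \<gamma>)) (a \<beta>))" if "\<gamma> \<in> ?D" "\<beta> \<in> underS \<theta> \<gamma>" for \<beta> \<gamma>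
        unfolding dist[OF that] using ab d gF by (simp add: lt_imp_le)
    qed
    then obtain G where G: "tree_node E n G" "len G = a \<delta>" "\<forall>\<beta>\<in>?D. ap G (a \<beta>) = b (g \<beta> \<delta>)"
      "\<And>j. E j (a \<delta>) \<Longrightarrow> \<not> E j l \<Longrightarrow> ap G j = zero"
      "\<And>k j. E k (a \<delta>) \<Longrightarrow> E j k \<Longrightarrow> ap G j \<noteq> zero \<Longrightarrow> ap G k \<noteq> zero \<Longrightarrow> le (a \<delta>) (ap (ap u k) j)"
      by auto
    define rs where "rs i = mk i (ap G)" for i
    have dap: "dterm E (\<lambda>\<rho>. ap G (\<rho> 0))" by (intro dintro)
    have rs: "fn (rs i) i" "len (rs i) = i" "\<And>j. E j i \<Longrightarrow> ap (rs i) j = ap G j" for i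
      unfolding rs_def using fn_mk[OF dap] len_mk[OF dap] ap_mk[OF dap] by simp_all
    have drs: "dterm E t \<Longrightarrow> dterm E (\<lambda>\<rho>. rs (t \<rho>))" for t
      by (rule dterm_subst1[of E rs]) (unfold rs_def mk_def, intro dintro)
    \<comment> \<open>From time \<open>l\<close> on all rows are restrictions of the single row
      \<open>G\<close>. The points alive in them were introduced before \<open>l\<close>, and their
      distances, at least \<open>a \<delta>\<close>, meet the requirement of every time up to
      \<open>a \<delta>\<close>.\<close>
    define c where "c = mk (sc (a \<delta>)) (\<lambda>i. if E i l then ap u i else rs i)"
    have dc: "dterm E (\<lambda>\<rho>. if E (\<rho> 0) l then ap u (\<rho> 0) else rs (\<rho> 0))" by (intro dintro drs)
    have c: "fn c (sc (a \<delta>))" "len c = sc (a \<delta>)"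
      "\<And>i. E i (sc (a \<delta>)) \<Longrightarrow> ap c i = (if E i l then ap u i else rs i)"
      unfolding c_def using fn_mk[OF dc] len_mk[OF dc] ap_mk[OF dc] by simp_all
    have ul: "E i (len u)" if "E i l" for i using lt_le_trans[OF Nu that] Sl by (simp add: S_def)
    have ila: "le i (a \<delta>)" if "E i (sc (a \<delta>))" for i using that by (simp add: le_iff_lt_sc)
    have nl: "\<not> E (a \<delta>) l" using not_lt[OF Nd l(1)] l(2) by simp
    have cd: "ap c (a \<delta>) = rs (a \<delta>)" using c(3)[of "a \<delta>"] nl by simp
    have Gval: "E (ap G j) n" if "E j (a \<delta>)" for j
      using G(1) that G(2) by (simp add: tree_node_iff sq_def)
    have lin: "E j (a \<delta>)" if "E j i" "E i (sc (a \<delta>))" for i j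
      using lt_le_trans[OF Nd that(1) ila[OF that(2)]] .
    have "ok \<delta> c" unfolding ok_def
    proof (intro conjI ballI)
      have "E (sc (a \<delta>)) n"
        using le_lt_trans[OF n(1) _ n(2)[OF e0], of "sc (a \<delta>)"] sc_le_iff[OF Nd, of "b \<epsilon>0"] Nb ab d e0 by simp
      moreover have "tree_node E n (ap c i)" if i: "E i (sc (a \<delta>))" for i
      proof (cases "E i l")
        case True
        then show ?thesis using c(3)[OF i] val[OF u(1) ul[OF True]] by simp
      next
        case False
        have "E i n" using le_lt_trans[OF n(1) ila[OF i] an[OF d]] .
        moreover have "E (ap G j) n" if "E j i" for j using Gval[OF lin[OF that i]] .
        ultimately have "tree_node E n (rs i)" using rs by (simp add: tree_node_iff sq_def)
        then show ?thesis using c(3)[OF i] False by simp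
      qed
      ultimately show "sq (tree_node E n) n c" unfolding sq_def using c(1,2) by (simp del: mem_sc)
      show "len c = sc (a \<delta>)" by (rule c(2))
      show "ap (ap c (a \<delta>)) (a \<beta>) = b (g \<beta> \<delta>)" if b: "\<beta> \<in> ?D" for \<beta>
        unfolding cd using rs(3)[OF inc[OF b]] G(3) b by simp
      show "S (sc (a \<delta>)) c" unfolding S_def c(2)
      proof (intro conjI allI impI le_refl)
        fix i assume i: "E i (sc (a \<delta>))"
        show "R c i"
        proof (cases "E i l")
          case True
          have "ap c j = ap u j" if "E j i" for j
            using c(3)[of j] lt_trans[OF N_sc[OF Nd] that i] lt_trans[OF l(1) that True] by simp
          then show ?thesis using Sl True c(3)[OF i] by (simp add: S_def R_def)
        next
          case False
          have ci: "ap c i = rs i" using c(3)[OF i] False by simp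
          show ?thesis unfolding R_def ci
          proof (intro conjI allI impI)
            show "len (rs i) = i" by (rule rs(2))
            fix k j assume kj: "E k i" "E j k" "ap (rs i) j \<noteq> zero" "ap (rs i) k \<noteq> zero"
            have Ni: "N i" using N_le[OF Nd ila[OF i]] .
            have ka: "E k (a \<delta>)" using lin[OF kj(1) i] .
            have ji: "E j i" using lt_trans[OF Ni kj(2,1)] .
            have nz: "ap G j \<noteq> zero" "ap G k \<noteq> zero" using kj(3,4) rs(3)[OF ji] rs(3)[OF kj(1)] by simp_all
            then have kl: "E k l" using G(4)[OF ka] by auto
            have "ap c k = ap u k" using c(3)[of k] ka kl by simp
            moreover have "le (a \<delta>) (ap (ap u k) j)" using G(5)[OF ka kj(2) nz] .
            moreover have "N (ap (ap u k) j)"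
            proof -
              have "tree_node E n (ap u k)" "len (ap u k) = k"
                using val[OF u(1) ul[OF kl]] Sl kl by (simp_all add: S_def R_def)
              then have "E (ap (ap u k) j) n" using kj(2) by (simp add: tree_node_iff sq_def)
              then show ?thesis by (rule N_trans[OF n(1)])
            qed
            ultimately show "le i (ap (ap c k) j)" using le_trans[OF _ ila[OF i]] by simp
          qed
        qed
      qed
      fix \<beta> assume b: "\<beta> \<in> Field \<theta>"
      show "A (a \<beta>) (sc (a \<delta>)) c" unfolding A_def
      proof (intro allI impI)
        fix i assume i: "E i (sc (a \<delta>))" and bi: "E (a \<beta>) i"
        have bd: "E (a \<beta>) (a \<delta>)" using lin[OF bi i] .
        then have "\<beta> \<noteq> \<delta>" "\<delta> \<notin> underS \<theta> \<beta>" using inc[of \<delta> \<beta>] lt_asym[OF Nd, of "a \<beta>"] by auto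
        then have bD: "\<beta> \<in> ?D" using underS_linear[OF r(1) b d] by simp
        show "ap (ap c i) (a \<beta>) \<noteq> zero"
        proof (cases "E i l")
          case True
          then show ?thesis using Al[OF bD] bi c(3)[OF i] by (simp add: A_def)
        next
          case False
          then show ?thesis using c(3)[OF i] rs(3)[OF bi] G(3) bD b_pos[OF gF] by simp
        qed
      qed
    qed
    moreover have "tree_le E (f \<beta>) c" if b: "\<beta> \<in> ?D" for \<beta>
    proof (subst tree_le_iff)
      have ob: "ok \<beta> (f \<beta>)" using okB b by simp
      show "fn (f \<beta>) (len (f \<beta>))" "fn c (len c)" using fn[OF ok(1)[OF ob]] c by simp_all
      show "\<forall>x. E x (len (f \<beta>)) \<longrightarrow> E x (len c) \<and> ap (f \<beta>) x = ap c x"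
      proof (intro allI impI)
        fix x assume "E x (len (f \<beta>))"
        then have x: "E x (sc (a \<beta>))" using ok(2)[OF ob] by simp
        have xl: "E x l" using lt_le_trans[OF l(1) x] l(3) b by simp
        have xs: "E x (sc (a \<delta>))" using lt_le_trans[OF Nd xl l(2)] by simp
        show "E x (len c) \<and> ap (f \<beta>) x = ap c x"
          using agree[OF u(1) _ ob x] u(2) b c(2) c(3)[OF xs] xs xl by simp
      qed
    qed
    ultimately show "\<exists>c. ok \<delta> c \<and> (\<forall>\<beta>\<in>?D. tree_le E (f \<beta>) c)" by (intro exI[of _ c]) simp
  qed
  then obtain f where
    "\<forall>\<delta>\<in>Field \<theta>. ok \<delta> (f \<delta>) \<and> (\<forall>\<beta>\<in>underS \<theta> \<delta>. tree_le E (f \<beta>) (f \<delta>))" by (elim exE)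
  then have f: "\<forall>\<delta>\<in>Field \<theta>. ok \<delta> (f \<delta>)"
    "\<forall>\<delta>\<in>Field \<theta>. \<forall>\<beta>\<in>underS \<theta> \<delta>. tree_le E (f \<beta>) (f \<delta>)" by simp_all
  obtain u where u: "sq (tree_node E n) n u" "\<forall>\<delta>\<in>Field \<theta>. tree_le E (f \<delta>) u"
    using bound[OF subset_refl f] by blast
  have Nu: "N (len u)" using Nlen[OF u(1)] .
  have all: "S (sc (a \<alpha>)) u" "A (a \<beta>) (sc (a \<alpha>)) u" if "\<alpha> \<in> Field \<theta>" "\<beta> \<in> Field \<theta>" for \<alpha> \<beta>
    using inherit[OF u(1) bspec[OF u(2) that(1)] bspec[OF f(1) that(1)] that le_refl] by simp_all
  have dist: "ap (ap u (a \<gamma>)) (a \<beta>) = b (g \<beta> \<gamma>)" if gb: "\<beta> \<in> underS \<theta> \<gamma>" for \<beta> \<gamma>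
  proof -
    have gF: "\<gamma> \<in> Field \<theta>" using underS_Field[OF gb] by simp
    then have og: "ok \<gamma> (f \<gamma>)" using f(1) by simp
    have "ap (f \<gamma>) (a \<gamma>) = ap u (a \<gamma>)" using agree[OF u(1) _ og, of "a \<gamma>"] u(2) gF by simp
    then show ?thesis using ok(4)[OF og] gb by simp
  qed
  have S0: "S zero u" using zero_le[OF Nu] by (simp add: S_def)
  have "\<forall>\<beta>\<in>Field \<theta>. \<exists>\<epsilon>. \<epsilon> \<in> Field \<kappa> \<and> S (b \<epsilon>) u \<and> A (a \<beta>) (b \<epsilon>) u"
  proof
    fix \<beta> assume b: "\<beta> \<in> Field \<theta>"
    have "S zero u \<and> A (a \<beta>) zero u" using S0 by (simp add: A_def)
    \<comment> \<open>The greatest length through which \<open>u\<close> is correct and keeps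
      \<open>a \<beta>\<close> alive is above all \<open>a \<alpha>\<close>. It does not fill the
      cut, so it reaches some \<open>b \<epsilon>\<close>.\<close>
    then obtain m where m: "N m" "le m (len u)" "S m u \<and> A (a \<beta>) m u"
      "\<And>y. le y (len u) \<Longrightarrow> S y u \<and> A (a \<beta>) y u \<Longrightarrow> le y m"
      using longest_prefix[OF dSA Nu, of u "a \<beta>"] by metis
    have am: "E (a \<alpha>) m" if al: "\<alpha> \<in> Field \<theta>" for \<alpha>
    proof -
      have "le (sc (a \<alpha>)) (len u)" using all(1)[OF al b] by (simp add: S_def)
      then have "le (sc (a \<alpha>)) m" using m(4) all[OF al b] by simp
      then show ?thesis using sc_le_iff[OF _ m(1), of "a \<alpha>"] Na al by simp
    qed
    have "\<not> (\<forall>\<alpha>\<in>Field \<theta>. \<forall>\<beta>\<in>Field \<kappa>. E (a \<alpha>) m \<and> E m (b \<beta>))" using gap m(1) by auto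
    then obtain \<epsilon> where e: "\<epsilon> \<in> Field \<kappa>" "\<not> E m (b \<epsilon>)" using am by auto
    then have le: "le (b \<epsilon>) m" using not_lt[OF m(1)] Nb by simp
    have low: "E i m" if "E i (b \<epsilon>)" for i using lt_le_trans[OF m(1) that le] .
    have "S (b \<epsilon>) u \<and> A (a \<beta>) (b \<epsilon>) u"
      using m(3) low le_trans[OF Nu le m(2)] by (simp add: S_def A_def)
    then show "\<exists>\<epsilon>. \<epsilon> \<in> Field \<kappa> \<and> S (b \<epsilon>) u \<and> A (a \<beta>) (b \<epsilon>) u" using e(1) by (intro exI[of _ \<epsilon>]) simp
  qed
  from bchoice[OF this] obtain h where h: "\<forall>\<beta>\<in>Field \<theta>. h \<beta> \<in> Field \<kappa> \<and> S (b (h \<beta>)) u \<and> A (a \<beta>) (b (h \<beta>)) u"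
    by (elim exE)
  have kF: "|Field \<kappa>| =o \<kappa>" using card_of_Field_ordIso[OF k(1)] .
  have Kbig: "\<not> |K| \<le>o |Field \<kappa>|"
    using K(2) ordLeq_ordIso_trans[OF _ kF] by auto
  have hK: "h ` K \<subseteq> Field \<kappa>" using h K(1) by auto
  obtain \<epsilon> where e: "\<epsilon> \<in> Field \<kappa>" "\<not> |{\<beta> \<in> K. h \<beta> = \<epsilon>}| \<le>o |Field \<kappa>|"
    using pigeonhole_large_fibre[OF k(2) hK Kbig] by (elim bexE)
  define W where "W = {\<beta> \<in> K. h \<beta> = \<epsilon>}"
  have W: "W \<subseteq> K" "\<not> |W| \<le>o \<kappa>"
    using e(2) ordLeq_ordIso_trans[OF _ ordIso_symmetric[OF kF]] by (auto simp: W_def)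
  \<comment> \<open>\<open>S\<close> and \<open>A\<close> speak of times strictly below
    \<open>b \<epsilon>\<close>; a further index provides such a time that is still above all
    \<open>a \<alpha>\<close>.\<close>
  obtain \<epsilon>' where e': "(\<epsilon>, \<epsilon>') \<in> \<kappa>" "\<epsilon> \<noteq> \<epsilon>'" using Card_order_no_max[OF k e(1)] by auto
  have e'F: "\<epsilon>' \<in> Field \<kappa>" using e' by (auto simp: Field_def)
  have ee: "E (b \<epsilon>') (b \<epsilon>)" using dec e(1) e'F e' by simp
  obtain \<beta> \<gamma> where bg: "\<beta> \<in> W" "\<gamma> \<in> W" "(\<beta>, \<gamma>) \<in> \<theta>" "\<beta> \<noteq> \<gamma>" "(g \<beta> \<gamma>, \<epsilon>') \<notin> \<kappa>"
    using g[OF W e'F] by auto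
  have F: "\<beta> \<in> Field \<theta>" "\<gamma> \<in> Field \<theta>" and hW: "h \<beta> = \<epsilon>" "h \<gamma> = \<epsilon>"
    using bg(1,2) K(1) by (auto simp: W_def)
  have bS: "\<beta> \<in> underS \<theta> \<gamma>" using bg by (simp add: underS_def)
  have alive: "ap (ap u (b \<epsilon>')) (a \<beta>) \<noteq> zero" "ap (ap u (b \<epsilon>')) (a \<gamma>) \<noteq> zero"
    using h F hW ee ab e'F by (auto simp: A_def)
  have "R u (b \<epsilon>')" using h F(1) hW(1) ee by (simp add: S_def)
  then have Rk: "\<forall>k. E k (b \<epsilon>') \<longrightarrow> (\<forall>j. E j k \<longrightarrow> ap (ap u (b \<epsilon>')) j \<noteq> zero \<longrightarrow>
      ap (ap u (b \<epsilon>')) k \<noteq> zero \<longrightarrow> le (b \<epsilon>') (ap (ap u k) j))" unfolding R_def by (elim conjE)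
  have "E (a \<gamma>) (b \<epsilon>')" using ab F(2) e'F by simp
  from Rk[rule_format, OF this inc[OF bS] alive] have "le (b \<epsilon>') (b (g \<beta> \<gamma>))"
    unfolding dist[OF bS] .
  \<comment> \<open>A colour beyond \<open>\<epsilon>'\<close> means a smaller distance, since
    \<open>b\<close> decreases.\<close>
  moreover have "E (b (g \<beta> \<gamma>)) (b \<epsilon>')"
  proof -
    have "g \<beta> \<gamma> \<noteq> \<epsilon>'" using bg(5) Card_order_refl[OF k(1) e'F] by auto
    moreover have "(\<epsilon>', g \<beta> \<gamma>) \<in> \<kappa>" using Card_order_linear[OF k(1) gF e'F] bg(5) calculation by auto
    ultimately show ?thesis using dec gF e'F by simp
  qed
  ultimately show False using not_lt[of "b (g \<beta> \<gamma>)" "b \<epsilon>'"] Nb gF e'F by simp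
qed

section \<open>Minimal cuts and the reverse implication\<close>

lemma p_le_imp_t_le:
  fixes \<mu> :: "'a rel"
  assumes \<mu>: "Card_order \<mu>" and p: "p_le E \<mu>" shows "t_le E \<mu>"
proof (rule ccontr)
  assume nt: "\<not> t_le E \<mu>"
  \<comment> \<open>Cuts are minimised with respect to a cardinal bounding both sides, in effect the
    larger side; for infinite cardinals this amounts to the sum.\<close>
  define S :: "'a rel set" where "S = {\<nu>. Card_order \<nu> \<and> \<nu> \<le>o \<mu> \<and>
    (\<exists>\<kappa> \<theta> a b. is_cut E om \<kappa> \<theta> a b \<and> \<kappa> \<le>o \<nu> \<and> \<theta> \<le>o \<nu>)}"
  have card: "Card_order \<kappa>" "Card_order \<theta>" if "is_cut E om \<kappa> \<theta> a b" for \<kappa> \<theta> :: "'a rel" and a b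
    using that by (simp_all add: is_cut_def)
  from p obtain \<kappa>0 \<theta>0 :: "'a rel" and a0 b0 where c0: "is_cut E om \<kappa>0 \<theta>0 a0 b0" "\<kappa>0 +c \<theta>0 \<le>o \<mu>"
    unfolding p_le_def is_omega_iff by blast
  have "\<kappa>0 \<le>o \<mu>" using ordLeq_transitive[OF ordLeq_csum1[OF card(1)[OF c0(1)]] c0(2)] .
  moreover have "\<theta>0 \<le>o \<mu>" using ordLeq_transitive[OF ordLeq_csum2[OF card(2)[OF c0(1)]] c0(2)] .
  moreover have "\<mu> \<le>o \<mu>" using \<mu> ordLeq_refl by blast
  ultimately have \<mu>S: "\<mu> \<in> S" using \<mu> c0(1) unfolding S_def by blast
  have "\<forall>r\<in>S. Card_order r" by (simp add: S_def)
  then obtain \<nu> where \<nu>: "\<nu> \<in> S" "\<forall>\<nu>'\<in>S. \<nu> \<le>o \<nu>'" using exists_minim_Card_order[of S] \<mu>S by blast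
  then obtain \<kappa> \<theta> a b where cut: "is_cut E om \<kappa> \<theta> a b" and \<kappa>\<nu>: "\<kappa> \<le>o \<nu>" and \<theta>\<nu>: "\<theta> \<le>o \<nu>" and \<nu>\<mu>: "\<nu> \<le>o \<mu>"
    unfolding S_def by blast
  have nc: "no_cut_below \<rho>" if \<rho>: "\<rho> \<le>o \<nu>" for \<rho> unfolding no_cut_below_def
  proof
    assume "\<exists>r r' a b. is_cut E om r r' a b \<and> r <o \<rho> \<and> r' <o \<rho>"
    then obtain r r' c d where c: "is_cut E om r r' c d" "r <o \<rho>" "r' <o \<rho>" by blast
    have lt: "r <o \<nu>" "r' <o \<nu>" using c(2,3) \<rho> ordLess_ordLeq_trans by blast+
    have \<mu>r: "r \<le>o \<mu>" "r' \<le>o \<mu>" using lt \<nu>\<mu> ordLess_imp_ordLeq ordLeq_transitive by blast+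
    have rr: "r \<le>o r" "r' \<le>o r'" using card[OF c(1)] ordLeq_refl by blast+
    have wo: "Well_order r" "Well_order r'" using card[OF c(1)] by (simp_all add: card_order_on_def)
    \<comment> \<open>The larger of the two sides would be a member of \<open>S\<close> smaller than
      the least one.\<close>
    have "r \<in> S \<or> r' \<in> S"
      using ordLeq_total[OF wo] rr \<mu>r card[OF c(1)] c(1) unfolding S_def by blast
    then show False using \<nu>(2) lt not_ordLess_ordLeq by blast
  qed
  have \<kappa>\<mu>: "\<kappa> \<le>o \<mu>" and \<theta>\<mu>: "\<theta> \<le>o \<mu>" using \<kappa>\<nu> \<theta>\<nu> \<nu>\<mu> ordLeq_transitive by blast+
  have wo: "Well_order \<kappa>" "Well_order \<theta>" using card[OF cut] by (simp_all add: card_order_on_def)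
  have "\<kappa> <o \<theta> \<or> \<theta> <o \<kappa> \<or> \<kappa> =o \<theta>"
    using wo not_ordLess_iff_ordLeq ordIso_iff_ordLeq by blast
  then consider "\<kappa> <o \<theta>" | "\<theta> <o \<kappa>" | "\<kappa> =o \<theta>" by blast
  then show False
  proof cases
    case 1
    obtain a' b' where "is_cut E om \<theta> \<kappa> a' b'" using is_cut_reflect[OF cut] by blast
    from no_asymmetric_cut[OF nt this 1 \<theta>\<mu> nc[OF \<theta>\<nu>]] show ?thesis .
  next
    case 2
    from no_asymmetric_cut[OF nt cut 2 \<kappa>\<mu> nc[OF \<kappa>\<nu>]] show ?thesis .
  next
    case 3
    \<comment> \<open>Sides of equal size are indexed by one cardinal, the order isomorphism
      \<open>h\<close> transporting the upper side.\<close>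
    then obtain h where "iso \<kappa> \<theta> h" unfolding ordIso_def by auto
    then have h: "bij_betw h (Field \<kappa>) (Field \<theta>)"
      "\<forall>\<alpha>\<in>Field \<kappa>. \<forall>\<alpha>'\<in>Field \<kappa>. (\<alpha>, \<alpha>') \<in> \<kappa> \<longleftrightarrow> (h \<alpha>, h \<alpha>') \<in> \<theta>" unfolding iso_iff2 by simp_all
    have hF: "h \<alpha> \<in> Field \<theta>" if "\<alpha> \<in> Field \<kappa>" for \<alpha> using h(1) that by (auto simp: bij_betw_def)
    have hne: "h \<alpha> \<noteq> h \<alpha>'" if "\<alpha> \<in> Field \<kappa>" "\<alpha>' \<in> Field \<kappa>" "\<alpha> \<noteq> \<alpha>'" for \<alpha> \<alpha>'
      using h(1) that by (auto simp: bij_betw_def inj_on_def)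
    note cut = cut[unfolded is_cut_def]
    have "\<exists>c. N c \<and> (\<forall>\<alpha>\<in>Field \<kappa>. E (a \<alpha>) c \<and> E c (b (h \<alpha>)))"
      by (rule no_symmetric_cut[OF nt _ _ \<kappa>\<mu>]) (use cut h(2) hF hne in simp_all)
    then obtain c where c: "N c" "\<forall>\<alpha>\<in>Field \<kappa>. E (a \<alpha>) c \<and> E c (b (h \<alpha>))" by (elim exE conjE)
    have "E c (b \<beta>)" if "\<beta> \<in> Field \<theta>" for \<beta>
    proof -
      have "\<beta> \<in> h ` Field \<kappa>" using h(1) that by (simp add: bij_betw_def)
      then show ?thesis using c(2) by auto
    qed
    moreover have "\<not> (\<exists>c. N c \<and> (\<forall>\<alpha>\<in>Field \<kappa>. \<forall>\<beta>\<in>Field \<theta>. E (a \<alpha>) c \<and> E c (b \<beta>)))"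
      using cut by simp
    ultimately show False using c by auto
  qed
qed

end

text \<open>Least cardinals are compared through their upper bounds, which avoids choosing
  representatives for them.\<close>

theorem mainTheorem4:
  fixes E :: "'a \<Rightarrow> 'a \<Rightarrow> bool"
  assumes "ZFC_minus E"
    and "omega_nonstandard E"
  shows "\<forall>\<mu> :: 'a rel. Card_order \<mu> \<longrightarrow> (p_le E \<mu> \<longleftrightarrow> t_le E \<mu>)"
proof -
  interpret zfc_minus_model E using assms(1) by unfold_locales
  show ?thesis using p_le_imp_t_le t_le_imp_p_le by blast
qed

end
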